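(* Let $W$ be a Coxeter group of type $F_4$ and let $w\in W$ be a proper quasi-Coxeter element. Let $F_4(a_1)$ be the Carter diagram that is a 4-cycle on vertices $s_1,s_2,s_3,s_4$ with double edges $s_1s_4$ and $s_2s_3$ and single edges $s_1s_2$ and $s_3s_4$. Then the interval group $G([1,w])$ admits a presentation over generators $\boldsymbol{s}_1,\boldsymbol{s}_2,\boldsymbol{s}_3,\boldsymbol{s}_4$ corresponding to the vertices of $F_4(a_1)$ with relations $R(F_4(a_1))$ and the commutator relators $$[\boldsymbol{s}_2^{-1}\boldsymbol{s}_1\boldsymbol{s}_2,\ \boldsymbol{s}_3^{-1}\boldsymbol{s}_4\boldsymbol{s}_3]\quad\text{and}\quad[\boldsymbol{s}_2\boldsymbol{s}_1\boldsymbol{s}_2^{-1},\ \boldsymbol{s}_3\boldsymbol{s}_4\boldsymbol{s}_3^{-1}].$$ Furthermore, $G([1,w])$ is not isomorphic to the Artin group $A(F_4)$.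
   Context: Let $(W,R)$ be a finite Coxeter system and $T=\bigcup_{g\in W}g^{-1}Rg$ its set of reflections. The reflection length $\ell_T(g)$ is the least $k$ such that $g$ is a product of $k$ elements of $T$; a factorization of $g$ into $\ell_T(g)$ reflections is a reduced decomposition. A Coxeter element is any conjugate of the product of all elements of $R$ in some order. An element $w$ is quasi-Coxeter if it has a reduced decomposition $w=t_1\cdots t_m$ with $\langle t_1,\dots,t_m\rangle=W$; it is proper if it is not a Coxeter element. In type $F_4$ there is a single conjugacy class of proper quasi-Coxeter elements, with Carter diagram $F_4(a_1)$. Write $x\preceq y$ if $\ell_T(y)=\ell_T(x)+\ell_T(x^{-1}y)$, and $[1,w]=\{x\in W: x\preceq w\}$. The interval group $G([1,w])$ is the group with generators $\boldsymbol{x}$ in bijection with $x\in[1,w]$ and relations $\boldsymbol{u}\boldsymbol{v}=\boldsymbol{r}$ whenever $u,v,r\in[1,w]$, $uv=r$ and $\ell_T(r)=\ell_T(u)+\ell_T(v)$. $R(F_4(a_1))$ is the set of braid relations defined by the diagram: $\boldsymbol{s}\boldsymbol{t}\boldsymbol{s}\boldsymbol{t}=\boldsymbol{t}\boldsymbol{s}\boldsymbol{t}\boldsymbol{s}$ for vertices joined by a double edge, $\boldsymbol{s}\boldsymbol{t}\boldsymbol{s}=\boldsymbol{t}\boldsymbol{s}\boldsymbol{t}$ for vertices joined by a single edge, and $\boldsymbol{s}\boldsymbol{t}=\boldsymbol{t}\boldsymbol{s}$ for vertices not joined. $[a,b]$ is the commutator. *)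

theory Defs
  imports "HOL-Algebra.Multiplicative_Group"
begin

section \<open>Groups given by generators and relations\<close>

text \<open>
  A letter \<open>(x, True)\<close> stands for the generator \<open>x\<close> and \<open>(x, False)\<close> for its formal inverse.
  A relation is a pair of words, to be read as an equation; a relator \<open>r\<close> is the relation
  \<open>(r, [])\<close>.
\<close>

type_synonym 'a word = "('a \<times> bool) list"

definition words :: "'a set \<Rightarrow> 'a word set" where
  "words X = lists (X \<times> UNIV)"

inductive_set word_cong :: "'a set \<Rightarrow> ('a word \<times> 'a word) set \<Rightarrow> ('a word \<times> 'a word) set"
  for X :: "'a set" and E :: "('a word \<times> 'a word) set" where
  refl: "u \<in> words X \<Longrightarrow> (u, u) \<in> word_cong X E"
| sym: "(u, v) \<in> word_cong X E \<Longrightarrow> (v, u) \<in> word_cong X E"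
| trans: "(u, v) \<in> word_cong X E \<Longrightarrow> (v, z) \<in> word_cong X E \<Longrightarrow> (u, z) \<in> word_cong X E"
| cancel: "u \<in> words X \<Longrightarrow> v \<in> words X \<Longrightarrow> x \<in> X \<Longrightarrow>
    (u @ [(x, b), (x, \<not> b)] @ v, u @ v) \<in> word_cong X E"
| relation: "u \<in> words X \<Longrightarrow> v \<in> words X \<Longrightarrow> (l, r) \<in> E \<Longrightarrow> l \<in> words X \<Longrightarrow> r \<in> words X \<Longrightarrow>
    (u @ l @ v, u @ r @ v) \<in> word_cong X E"

definition presented_group :: "'a set \<Rightarrow> ('a word \<times> 'a word) set \<Rightarrow> 'a word set monoid" where
  "presented_group X E =
    \<lparr>carrier = words X // word_cong X E,
     mult = (\<lambda>A B. \<Union>u\<in>A. \<Union>v\<in>B. word_cong X E `` {u @ v}),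
     one = word_cong X E `` {[]}\<rparr>"

definition presented_gen :: "'a set \<Rightarrow> ('a word \<times> 'a word) set \<Rightarrow> 'a \<Rightarrow> 'a word set" where
  "presented_gen X E x = word_cong X E `` {[(x, True)]}"

text \<open>\<open>G\<close> is presented by \<open>\<langle>X | E\<rangle>\<close>, where the generator \<open>x\<close> stands for the element \<open>f x\<close> of \<open>G\<close>.\<close>

definition is_presentation ::
  "('b, 'c) monoid_scheme \<Rightarrow> 'a set \<Rightarrow> ('a word \<times> 'a word) set \<Rightarrow> ('a \<Rightarrow> 'b) \<Rightarrow> bool" where
  "is_presentation G X E f \<longleftrightarrow>
    (\<exists>\<phi> \<in> iso (presented_group X E) G. \<forall>x\<in>X. \<phi> (presented_gen X E x) = f x)"

definition word_inv :: "'a word \<Rightarrow> 'a word" where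
  "word_inv u = rev (map (\<lambda>(x, b). (x, \<not> b)) u)"

definition word_commutator :: "'a word \<Rightarrow> 'a word \<Rightarrow> 'a word" where
  "word_commutator u v = word_inv u @ word_inv v @ u @ v"

lemma words_simps [simp]:
  "[] \<in> words X"
  "a # u \<in> words X \<longleftrightarrow> fst a \<in> X \<and> u \<in> words X"
  "u @ v \<in> words X \<longleftrightarrow> u \<in> words X \<and> v \<in> words X"
  by (auto simp: words_def mem_Times_iff)

lemma word_inv_in_words [simp]: "u \<in> words X \<Longrightarrow> word_inv u \<in> words X"
  by (induction u) (auto simp: word_inv_def split: prod.split)

lemma word_cong_in_words: "(u, v) \<in> word_cong X E \<Longrightarrow> u \<in> words X \<and> v \<in> words X"
  by (induction rule: word_cong.induct) auto

lemma equiv_word_cong: "equiv (words X) (word_cong X E)"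
proof (rule equivI)
  show "word_cong X E \<subseteq> words X \<times> words X"
    using word_cong_in_words by auto
  show "refl_on (words X) (word_cong X E)"
    by (rule refl_onI) (rule word_cong.refl)
  show "sym (word_cong X E)"
    by (rule symI) (rule word_cong.sym)
  show "trans (word_cong X E)"
    by (rule transI) (rule word_cong.trans)
qed

lemma word_cong_context:
  "(u, v) \<in> word_cong X E \<Longrightarrow> p \<in> words X \<Longrightarrow> q \<in> words X \<Longrightarrow>
    (p @ u @ q, p @ v @ q) \<in> word_cong X E"
proof (induction rule: word_cong.induct)
  case (refl u)
  then show ?case by (simp add: word_cong.refl)
next
  case (sym u v)
  then show ?case by (blast intro: word_cong.sym)
next
  case (trans u v z)
  then show ?case by (metis word_cong.trans)
next
  case (cancel u v x b)
  then show ?case using word_cong.cancel[of "p @ u" X "v @ q" x b E] by simp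
next
  case (relation u v l r)
  then show ?case using word_cong.relation[of "p @ u" X "v @ q" l r E] by simp
qed

lemma word_cong_append:
  assumes "(u, u') \<in> word_cong X E" "(v, v') \<in> word_cong X E"
  shows "(u @ v, u' @ v') \<in> word_cong X E"
  using word_cong_context[OF assms(1), of "[]" v] word_cong_context[OF assms(2), of u' "[]"]
    word_cong_in_words[OF assms(1)] word_cong_in_words[OF assms(2)]
  by (simp, metis word_cong.trans)

lemma word_cong_left_inverse: "u \<in> words X \<Longrightarrow> (word_inv u @ u, []) \<in> word_cong X E"
proof (induction u)
  case Nil
  then show ?case by (auto simp: word_inv_def intro: word_cong.refl)
next
  case (Cons a u)
  obtain x b where a: "a = (x, b)" by (cases a)
  have "(word_inv u @ [(x, \<not> b), (x, \<not> \<not> b)] @ u, word_inv u @ u) \<in> word_cong X E"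
    using Cons.prems a by (intro word_cong.cancel) auto
  moreover have "word_inv (a # u) @ a # u = word_inv u @ [(x, \<not> b), (x, \<not> \<not> b)] @ u"
    by (simp add: a word_inv_def)
  ultimately show ?case using Cons by (metis word_cong.trans words_simps(2))
qed

lemma presented_mult:
  assumes "u \<in> words X" "v \<in> words X"
  shows "word_cong X E `` {u} \<otimes>\<^bsub>presented_group X E\<^esub> word_cong X E `` {v} = word_cong X E `` {u @ v}"
proof -
  have eq: "word_cong X E `` {u' @ v'} = word_cong X E `` {u @ v}"
    if "u' \<in> word_cong X E `` {u}" "v' \<in> word_cong X E `` {v}" for u' v'
    using that equiv_class_eq[OF equiv_word_cong word_cong_append[of u u' X E v v']] by simp
  have ne: "u \<in> word_cong X E `` {u}" "v \<in> word_cong X E `` {v}"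
    using assms by (auto intro: word_cong.refl)
  have "(\<Union>u'\<in>word_cong X E `` {u}. \<Union>v'\<in>word_cong X E `` {v}. word_cong X E `` {u' @ v'})
      = (\<Union>u'\<in>word_cong X E `` {u}. \<Union>v'\<in>word_cong X E `` {v}. word_cong X E `` {u @ v})"
    by (intro SUP_cong HOL.refl eq)
  also have "\<dots> = word_cong X E `` {u @ v}"
    using ne by blast
  finally show ?thesis by (simp add: presented_group_def)
qed

lemma group_presented_group: "group (presented_group X E)"
proof -
  let ?G = "presented_group X E" and ?c = "\<lambda>u. word_cong X E `` {u}"
  have carr: "A \<in> carrier ?G \<longleftrightarrow> (\<exists>u\<in>words X. A = ?c u)" for A
    by (auto simp: presented_group_def quotient_def)
  have one: "\<one>\<^bsub>?G\<^esub> = ?c []" by (simp add: presented_group_def)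
  show ?thesis
  proof (rule groupI)
    fix A B assume "A \<in> carrier ?G" "B \<in> carrier ?G"
    then obtain u v where "u \<in> words X" "A = ?c u" "v \<in> words X" "B = ?c v"
      unfolding carr by blast
    then show "A \<otimes>\<^bsub>?G\<^esub> B \<in> carrier ?G"
      unfolding carr by (intro bexI[of _ "u @ v"]) (simp_all add: presented_mult)
  next
    show "\<one>\<^bsub>?G\<^esub> \<in> carrier ?G"
      unfolding carr one by (intro bexI[of _ "[]"]) simp_all
  next
    fix A B C assume "A \<in> carrier ?G" "B \<in> carrier ?G" "C \<in> carrier ?G"
    then obtain u v z where "u \<in> words X" "A = ?c u" "v \<in> words X" "B = ?c v"
      "z \<in> words X" "C = ?c z" unfolding carr by blast
    then show "A \<otimes>\<^bsub>?G\<^esub> B \<otimes>\<^bsub>?G\<^esub> C = A \<otimes>\<^bsub>?G\<^esub> (B \<otimes>\<^bsub>?G\<^esub> C)"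
      by (simp add: presented_mult)
  next
    fix A assume "A \<in> carrier ?G"
    then obtain u where u: "u \<in> words X" "A = ?c u" unfolding carr by blast
    then show "\<one>\<^bsub>?G\<^esub> \<otimes>\<^bsub>?G\<^esub> A = A" by (simp add: one presented_mult)
    have "?c (word_inv u) \<otimes>\<^bsub>?G\<^esub> A = \<one>\<^bsub>?G\<^esub>"
      using u equiv_class_eq[OF equiv_word_cong word_cong_left_inverse[OF u(1)]]
      by (simp add: presented_mult one)
    moreover have "?c (word_inv u) \<in> carrier ?G"
      unfolding carr using u(1) word_inv_in_words by blast
    ultimately show "\<exists>B\<in>carrier ?G. B \<otimes>\<^bsub>?G\<^esub> A = \<one>\<^bsub>?G\<^esub>" by blast
  qed
qed


section \<open>Coxeter systems and Artin groups\<close>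

definition list_prod :: "('a, 'b) monoid_scheme \<Rightarrow> 'a list \<Rightarrow> 'a" where
  "list_prod G xs = foldr (\<lambda>x y. x \<otimes>\<^bsub>G\<^esub> y) xs \<one>\<^bsub>G\<^esub>"

text \<open>
  \<open>group.ord\<close> is \<open>0\<close> for elements of infinite order; the corresponding relation below is then
  the trivial relation between empty words, as it should be.
\<close>

definition coxeter_relations :: "'a set \<Rightarrow> ('a \<Rightarrow> 'a \<Rightarrow> nat) \<Rightarrow> ('a word \<times> 'a word) set" where
  "coxeter_relations R m =
    {(concat (replicate (m r s) [(r, True), (s, True)]), []) | r s. r \<in> R \<and> s \<in> R}"

definition coxeter_system :: "('a, 'b) monoid_scheme \<Rightarrow> 'a set \<Rightarrow> bool" where
  "coxeter_system W R \<longleftrightarrow>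
    group W \<and> R \<subseteq> carrier W \<and> (\<forall>r\<in>R. group.ord W r = 2) \<and>
    is_presentation W R (coxeter_relations R (\<lambda>r s. group.ord W (r \<otimes>\<^bsub>W\<^esub> s))) (\<lambda>r. r)"

definition finite_coxeter_system :: "('a, 'b) monoid_scheme \<Rightarrow> 'a set \<Rightarrow> bool" where
  "finite_coxeter_system W R \<longleftrightarrow> coxeter_system W R \<and> finite (carrier W)"

text \<open>A labelled diagram on \<open>I\<close> is encoded by its matrix \<open>m\<close>: \<open>1\<close> on the diagonal, and \<open>2\<close>, \<open>3\<close>, \<open>4\<close>
  for no edge, a single edge and a double edge.\<close>

definition coxeter_type ::
  "('a, 'b) monoid_scheme \<Rightarrow> 'a set \<Rightarrow> 'i set \<Rightarrow> ('i \<Rightarrow> 'i \<Rightarrow> nat) \<Rightarrow> bool" where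
  "coxeter_type W R I m \<longleftrightarrow>
    (\<exists>f. bij_betw f I R \<and> (\<forall>i\<in>I. \<forall>j\<in>I. group.ord W (f i \<otimes>\<^bsub>W\<^esub> f j) = m i j))"

fun alternating_word :: "nat \<Rightarrow> 'a \<Rightarrow> 'a \<Rightarrow> 'a word" where
  "alternating_word 0 x y = []"
| "alternating_word (Suc n) x y = (x, True) # alternating_word n y x"

definition braid_relations :: "'i set \<Rightarrow> ('i \<Rightarrow> 'i \<Rightarrow> nat) \<Rightarrow> ('i word \<times> 'i word) set" where
  "braid_relations I m =
    {(alternating_word (m i j) i j, alternating_word (m i j) j i) | i j. i \<in> I \<and> j \<in> I \<and> i \<noteq> j}"

definition artin_group :: "'i set \<Rightarrow> ('i \<Rightarrow> 'i \<Rightarrow> nat) \<Rightarrow> 'i word set monoid" where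
  "artin_group I m = presented_group I (braid_relations I m)"

definition F4 :: "nat \<Rightarrow> nat \<Rightarrow> nat" where
  "F4 i j = (if i = j then 1
     else if {i, j} = {2, 3} then 4
     else if {i, j} \<in> {{1, 2}, {3, 4}} then 3
     else 2)"

definition F4a1 :: "nat \<Rightarrow> nat \<Rightarrow> nat" where
  "F4a1 i j = (if i = j then 1
     else if {i, j} \<in> {{1, 4}, {2, 3}} then 4
     else if {i, j} \<in> {{1, 2}, {3, 4}} then 3
     else 2)"


section \<open>Reflection length and quasi-Coxeter elements\<close>

definition reflections :: "('a, 'b) monoid_scheme \<Rightarrow> 'a set \<Rightarrow> 'a set" where
  "reflections W R = {inv\<^bsub>W\<^esub> g \<otimes>\<^bsub>W\<^esub> r \<otimes>\<^bsub>W\<^esub> g | g r. g \<in> carrier W \<and> r \<in> R}"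

definition refl_length :: "('a, 'b) monoid_scheme \<Rightarrow> 'a set \<Rightarrow> 'a \<Rightarrow> nat" where
  "refl_length W R g =
    (LEAST k. \<exists>ts. set ts \<subseteq> reflections W R \<and> length ts = k \<and> g = list_prod W ts)"

definition reduced_decomposition :: "('a, 'b) monoid_scheme \<Rightarrow> 'a set \<Rightarrow> 'a \<Rightarrow> 'a list \<Rightarrow> bool" where
  "reduced_decomposition W R g ts \<longleftrightarrow>
    set ts \<subseteq> reflections W R \<and> length ts = refl_length W R g \<and> g = list_prod W ts"

definition coxeter_element :: "('a, 'b) monoid_scheme \<Rightarrow> 'a set \<Rightarrow> 'a \<Rightarrow> bool" where
  "coxeter_element W R c \<longleftrightarrow>
    (\<exists>rs. \<exists>g\<in>carrier W. distinct rs \<and> set rs = R \<and>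
      c = inv\<^bsub>W\<^esub> g \<otimes>\<^bsub>W\<^esub> list_prod W rs \<otimes>\<^bsub>W\<^esub> g)"

definition quasi_coxeter :: "('a, 'b) monoid_scheme \<Rightarrow> 'a set \<Rightarrow> 'a \<Rightarrow> bool" where
  "quasi_coxeter W R w \<longleftrightarrow>
    (\<exists>ts. reduced_decomposition W R w ts \<and> generate W (set ts) = carrier W)"

definition proper_quasi_coxeter :: "('a, 'b) monoid_scheme \<Rightarrow> 'a set \<Rightarrow> 'a \<Rightarrow> bool" where
  "proper_quasi_coxeter W R w \<longleftrightarrow> quasi_coxeter W R w \<and> \<not> coxeter_element W R w"

text \<open>
  Carter's diagrams: \<open>w\<close> is written as a product of two elements, each of them a product of
  pairwise commuting reflections, such that the concatenated factorization is reduced. The vertices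
  of the diagram are the reflections that occur, and the edge between two of them is given by the
  order of their product. The reflection at the vertex \<open>i\<close> is \<open>s i\<close>.
\<close>

definition carter_realization ::
  "('a, 'b) monoid_scheme \<Rightarrow> 'a set \<Rightarrow> 'a \<Rightarrow> 'i set \<Rightarrow> ('i \<Rightarrow> 'i \<Rightarrow> nat) \<Rightarrow> ('i \<Rightarrow> 'a) \<Rightarrow> bool" where
  "carter_realization W R w I m s \<longleftrightarrow>
    (\<exists>xs ys. distinct (xs @ ys) \<and> set (xs @ ys) = I \<and>
       reduced_decomposition W R w (map s (xs @ ys)) \<and>
       (\<forall>i\<in>set xs. \<forall>j\<in>set xs. s i \<otimes>\<^bsub>W\<^esub> s j = s j \<otimes>\<^bsub>W\<^esub> s i) \<and>
       (\<forall>i\<in>set ys. \<forall>j\<in>set ys. s i \<otimes>\<^bsub>W\<^esub> s j = s j \<otimes>\<^bsub>W\<^esub> s i)) \<and>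
    (\<forall>i\<in>I. \<forall>j\<in>I. group.ord W (s i \<otimes>\<^bsub>W\<^esub> s j) = m i j)"


section \<open>Interval groups\<close>

definition abs_le :: "('a, 'b) monoid_scheme \<Rightarrow> 'a set \<Rightarrow> 'a \<Rightarrow> 'a \<Rightarrow> bool" where
  "abs_le W R x y \<longleftrightarrow>
    refl_length W R y = refl_length W R x + refl_length W R (inv\<^bsub>W\<^esub> x \<otimes>\<^bsub>W\<^esub> y)"

definition interval :: "('a, 'b) monoid_scheme \<Rightarrow> 'a set \<Rightarrow> 'a \<Rightarrow> 'a set" where
  "interval W R w = {x \<in> carrier W. abs_le W R x w}"

definition interval_relations ::
  "('a, 'b) monoid_scheme \<Rightarrow> 'a set \<Rightarrow> 'a \<Rightarrow> ('a word \<times> 'a word) set" where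
  "interval_relations W R w =
    {([(u, True), (v, True)], [(r, True)]) | u v r.
       u \<in> interval W R w \<and> v \<in> interval W R w \<and> r \<in> interval W R w \<and> u \<otimes>\<^bsub>W\<^esub> v = r \<and>
       refl_length W R r = refl_length W R u + refl_length W R v}"

definition interval_group :: "('a, 'b) monoid_scheme \<Rightarrow> 'a set \<Rightarrow> 'a \<Rightarrow> 'a word set monoid" where
  "interval_group W R w = presented_group (interval W R w) (interval_relations W R w)"

definition interval_gen :: "('a, 'b) monoid_scheme \<Rightarrow> 'a set \<Rightarrow> 'a \<Rightarrow> 'a \<Rightarrow> 'a word set" where
  "interval_gen W R w x = presented_gen (interval W R w) (interval_relations W R w) x"


section \<open>The presentation on the vertices of the diagram\<close>

text \<open>The words \<open>y\<^sup>-\<^sup>1 x y\<close> and \<open>y x y\<^sup>-\<^sup>1\<close> in two generators.\<close>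

definition conj_word :: "'i \<Rightarrow> 'i \<Rightarrow> 'i word" where
  "conj_word x y = [(y, False), (x, True), (y, True)]"

definition conj_word' :: "'i \<Rightarrow> 'i \<Rightarrow> 'i word" where
  "conj_word' x y = [(y, True), (x, True), (y, False)]"

definition F4a1_relations :: "(nat word \<times> nat word) set" where
  "F4a1_relations = braid_relations {1..4} F4a1 \<union>
    {(word_commutator (conj_word 1 2) (conj_word 4 3), []),
     (word_commutator (conj_word' 1 2) (conj_word' 4 3), [])}"

end

theory Submission
  imports Defs
begin

text \<open>
  The Coxeter group of type \<open>F4\<close> is the orthogonal group of the form
  \<open>x1\<^sup>2 + x2\<^sup>2 + x3\<^sup>2 + x4\<^sup>2\<close> over the field with three elements: its twelve short roots become
  the lines of norm \<open>1\<close> and its twelve long roots the lines of norm \<open>-1\<close>. Elements are written as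
  words of roots, read as products of reflections, and two words give the same element if and only if
  they move the four unit vectors in the same way. This turns the statements about the one group
  \<open>W\<close> into finite computations with words. That an abstract Coxeter group of type \<open>F4\<close> is no larger
  than this linear group (\<open>F4_group_exists\<close>) is seen along the chain \<open>F4 > B3 > B2 > A1\<close>: words for
  the \<open>24\<close>, \<open>6\<close>, \<open>4\<close> and \<open>2\<close> cosets are permuted by the generators as a consequence of the Coxeter
  relations, and the images of the unit vectors tell the cosets apart.

  A proper quasi-Coxeter element is conjugate to a fixed product of two long and two short reflections
  (\<open>generating_word_conjugate\<close>, \<open>proper_quasi_coxeter_realization\<close>). Every element is a product of
  at most four reflections (\<open>act_short_word\<close>). Hurwitz moves bring the long factors of a generating
  reduced decomposition to the front. A single short root, or two commuting ones, leave one of the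
  three orthogonal frames of short roots invariant, and so does every long root; the same holds with
  long and short exchanged. Hence the decomposition consists of two non-commuting long roots and two
  non-commuting short ones. The long pairs are all conjugate, and for a fixed long pair the \<open>96\<close> short
  pairs give Coxeter elements, conjugates of the fixed word, or a group that leaves the span of the
  long pair invariant.

  The interval group is governed by the reduced decompositions of \<open>w\<close>. A map from the reflections to a
  group extends to the interval group if and only if all reduced decompositions of \<open>w\<close> have the same
  image (\<open>interval_group_presentation\<close>). There are \<open>648\<close> of them, and replacing two adjacent factors by
  another factorization of their product links them all. It therefore suffices to lift the \<open>24\<close>
  reflections to the group of the diagram such that the relations \<open>a b = c d\<close> between factorizations of
  the same element below \<open>w\<close> hold (\<open>reduced_words_equal\<close>). The lifts are defined by successive
  conjugation of the four vertices. Their relations follow from those of the diagram by explicit chains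
  of words: both sides of the desired relation are multiplied by the same letters, the results are
  linked by relations established before, and the additional letters are cancelled. The two commutator
  relators say that the lifts of \<open>h7\<close> and \<open>m24\<close> commute, and those of \<open>e4\<close> and \<open>p12\<close>. These are again
  relations between factorizations of elements below \<open>w\<close>, so that they hold in the interval group too.

  The Artin group of type \<open>F4\<close> has fewer homomorphisms to the alternating group on four letters than
  the group of the diagram (\<open>diagram_group_not_artin\<close>).
\<close>

section \<open>Words evaluated in a group\<close>

definition word_eval :: "('b, 'c) monoid_scheme \<Rightarrow> ('a \<Rightarrow> 'b) \<Rightarrow> 'a word \<Rightarrow> 'b" where
  "word_eval G f u = list_prod G (map (\<lambda>(x, b). if b then f x else inv\<^bsub>G\<^esub> f x) u)"

definition satisfies :: "('b, 'c) monoid_scheme \<Rightarrow> ('a \<Rightarrow> 'b) \<Rightarrow> ('a word \<times> 'a word) set \<Rightarrow> bool" where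
  "satisfies G f E \<longleftrightarrow> (\<forall>(l, r)\<in>E. word_eval G f l = word_eval G f r)"

lemma list_prod_simps [simp]:
  "list_prod G [] = \<one>\<^bsub>G\<^esub>"
  "list_prod G (x # xs) = x \<otimes>\<^bsub>G\<^esub> list_prod G xs"
  by (simp_all add: list_prod_def)

lemma word_eval_simps [simp]:
  "word_eval G f [] = \<one>\<^bsub>G\<^esub>"
  "word_eval G f ((x, True) # u) = f x \<otimes>\<^bsub>G\<^esub> word_eval G f u"
  "word_eval G f ((x, False) # u) = inv\<^bsub>G\<^esub> f x \<otimes>\<^bsub>G\<^esub> word_eval G f u"
  by (simp_all add: word_eval_def)

lemma word_eval_Cons:
  "word_eval G f ((x, b) # u) = (if b then f x else inv\<^bsub>G\<^esub> f x) \<otimes>\<^bsub>G\<^esub> word_eval G f u"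
  by (simp add: word_eval_def)

context group
begin

lemma list_prod_closed [simp, intro]: "set xs \<subseteq> carrier G \<Longrightarrow> list_prod G xs \<in> carrier G"
  by (induction xs) auto

lemma list_prod_append:
  "set xs \<subseteq> carrier G \<Longrightarrow> set ys \<subseteq> carrier G \<Longrightarrow>
    list_prod G (xs @ ys) = list_prod G xs \<otimes> list_prod G ys"
  by (induction xs) (auto simp: m_assoc)

lemma inv_cancel [simp]:
  "x \<in> carrier G \<Longrightarrow> y \<in> carrier G \<Longrightarrow> x \<otimes> (inv x \<otimes> y) = y"
  "x \<in> carrier G \<Longrightarrow> y \<in> carrier G \<Longrightarrow> inv x \<otimes> (x \<otimes> y) = y"
  by (simp_all add: m_assoc[symmetric])

lemma list_prod_conj:
  "g \<in> carrier G \<Longrightarrow> set xs \<subseteq> carrier G \<Longrightarrow>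
    list_prod G (map (\<lambda>x. inv g \<otimes> x \<otimes> g) xs) = inv g \<otimes> list_prod G xs \<otimes> g"
by (induction xs) (simp_all add: m_assoc)

lemma word_eval_closed [simp, intro]:
  "f \<in> X \<rightarrow> carrier G \<Longrightarrow> u \<in> words X \<Longrightarrow> word_eval G f u \<in> carrier G"
  by (induction u) (auto simp: word_eval_Cons Pi_iff)

lemma word_eval_append:
  "f \<in> X \<rightarrow> carrier G \<Longrightarrow> u \<in> words X \<Longrightarrow> v \<in> words X \<Longrightarrow>
    word_eval G f (u @ v) = word_eval G f u \<otimes> word_eval G f v"
proof (induction u)
  case Nil
  then show ?case using word_eval_closed[of f X v] by simp
next
  case (Cons a u)
  then show ?case using word_eval_closed[of f X v] word_eval_closed[of f X u]
    by (cases a) (auto simp: word_eval_Cons m_assoc Pi_iff)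
qed

lemma word_eval_cong:
  assumes f: "f \<in> X \<rightarrow> carrier G" and E: "satisfies G f E"
  shows "(u, v) \<in> word_cong X E \<Longrightarrow> word_eval G f u = word_eval G f v"
proof (induction rule: word_cong.induct)
  case (cancel u v x b)
  have x: "f x \<in> carrier G" using cancel f by auto
  have "word_eval G f ([(x, b), (x, \<not> b)] @ v) = word_eval G f v"
    using x cancel f word_eval_closed[OF f, of v]
    by (cases b) (simp_all add: m_assoc[symmetric])
  then show ?case using cancel word_eval_append[OF f, of u "[(x, b), (x, \<not> b)] @ v"]
    word_eval_append[OF f, of u v] by simp
next
  case (relation u v l r)
  then show ?case using E by (auto simp: word_eval_append[OF f] satisfies_def)
qed auto

lemma hom_word_eval:
  assumes "group H" "h \<in> hom G H" "f \<in> X \<rightarrow> carrier G" "u \<in> words X"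
  shows "h (word_eval G f u) = word_eval H (\<lambda>x. h (f x)) u"
proof -
  interpret H: group H by fact
  interpret h: group_hom G H h by unfold_locales fact
  show ?thesis using assms(4)
  proof (induction u)
    case (Cons a u)
    then show ?case using assms(3) word_eval_closed[OF assms(3), of u]
      by (cases a) (auto simp: word_eval_Cons Pi_iff)
  qed simp
qed

end

section \<open>The universal property of a presentation\<close>

lemma presented_carrier: "carrier (presented_group X E) = (\<lambda>u. word_cong X E `` {u}) ` words X"
  by (auto simp: presented_group_def quotient_def)

lemma presented_gen_closed [simp]: "presented_gen X E \<in> X \<rightarrow> carrier (presented_group X E)"
  by (auto simp: presented_gen_def presented_carrier)

lemma presented_gen_eval:
  "u \<in> words X \<Longrightarrow> word_eval (presented_group X E) (presented_gen X E) u = word_cong X E `` {u}"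
proof (induction u)
  case Nil
  then show ?case by (simp add: presented_group_def)
next
  case (Cons a u)
  interpret P: group "presented_group X E" by (rule group_presented_group)
  obtain x b where a: "a = (x, b)" by (cases a)
  have x: "x \<in> X" using Cons a by simp
  have "inv\<^bsub>presented_group X E\<^esub> presented_gen X E x = word_cong X E `` {[(x, False)]}"
  proof (rule P.inv_equality)
    have "([(x, False), (x, True)], []) \<in> word_cong X E"
      using word_cong.cancel[of "[]" X "[]" x False E] x by simp
    then have "word_cong X E `` {[(x, False), (x, True)]} = word_cong X E `` {[]}"
      by (rule equiv_class_eq[OF equiv_word_cong])
    then show "word_cong X E `` {[(x, False)]} \<otimes>\<^bsub>presented_group X E\<^esub> presented_gen X E x =
        \<one>\<^bsub>presented_group X E\<^esub>"
      using x by (simp add: presented_gen_def presented_mult) (simp add: presented_group_def)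
  qed (use x in \<open>auto simp: presented_carrier presented_gen_def\<close>)
  then show ?case using Cons a x
    by (auto simp: word_eval_Cons presented_gen_def presented_mult)
qed

lemma presented_gen_satisfies:
  assumes "\<And>l r. (l, r) \<in> E \<Longrightarrow> l \<in> words X \<and> r \<in> words X"
  shows "satisfies (presented_group X E) (presented_gen X E) E"
  unfolding satisfies_def
proof clarify
  fix l r assume "(l, r) \<in> E"
  then have "(l, r) \<in> word_cong X E" using assms word_cong.relation[of "[]" X "[]" l r E] by auto
  then show "word_eval (presented_group X E) (presented_gen X E) l =
      word_eval (presented_group X E) (presented_gen X E) r"
    using equiv_class_eq[OF equiv_word_cong, of l r] word_cong_in_words[of l r]
    by (simp add: presented_gen_eval)
qed

text \<open>
  Any representative of a class may be used to define the homomorphism, because congruent words have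
  the same value.
\<close>

lemma (in group) presented_hom_exists:
  assumes f: "f \<in> X \<rightarrow> carrier G" and E: "satisfies G f E"
  obtains h where "h \<in> hom (presented_group X E) G"
    and "\<And>u. u \<in> words X \<Longrightarrow> h (word_cong X E `` {u}) = word_eval G f u"
    and "\<And>x. x \<in> X \<Longrightarrow> h (presented_gen X E x) = f x"
proof -
  define h where "h A = word_eval G f (SOME u. u \<in> A)" for A
  have h: "h (word_cong X E `` {u}) = word_eval G f u" if "u \<in> words X" for u
  proof -
    have "u \<in> word_cong X E `` {u}" using that by (auto intro: word_cong.refl)
    then have "(SOME v. v \<in> word_cong X E `` {u}) \<in> word_cong X E `` {u}" by (rule someI)
    then show ?thesis using word_eval_cong[OF f E] by (simp add: h_def)
  qed
  show thesis
  proof (rule that[of h])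
    show "h \<in> hom (presented_group X E) G"
    proof (rule homI)
      fix A B assume "A \<in> carrier (presented_group X E)" "B \<in> carrier (presented_group X E)"
      then obtain u v where "u \<in> words X" "v \<in> words X" "A = word_cong X E `` {u}" "B = word_cong X E `` {v}"
        by (auto simp: presented_carrier)
      then show "h (A \<otimes>\<^bsub>presented_group X E\<^esub> B) = h A \<otimes> h B"
        by (simp add: presented_mult h word_eval_append[OF f])
    next
      fix A assume "A \<in> carrier (presented_group X E)"
      then show "h A \<in> carrier G" using f by (auto simp: presented_carrier h)
    qed
    show "h (presented_gen X E x) = f x" if "x \<in> X" for x
      using that f h[of "[(x, True)]"] by (simp add: presented_gen_def Pi_iff)
  qed (rule h)
qed

lemma presented_induct:
  assumes "A \<in> carrier (presented_group X E)"
  obtains u where "u \<in> words X" "A = word_eval (presented_group X E) (presented_gen X E) u"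
  using assms by (auto simp: presented_carrier presented_gen_eval)

text \<open>
  A homomorphism in the other direction that takes \<open>f x\<close> to the generator \<open>x\<close> is inverse to the one
  given by the universal property as soon as the elements \<open>f x\<close> generate \<open>G\<close>.
\<close>

lemma (in group) is_presentationI:
  assumes f: "f \<in> X \<rightarrow> carrier G" and E: "satisfies G f E"
    and h: "h \<in> hom G (presented_group X E)" "\<And>x. x \<in> X \<Longrightarrow> h (f x) = presented_gen X E x"
    and gen: "\<And>g. g \<in> carrier G \<Longrightarrow> \<exists>u\<in>words X. g = word_eval G f u"
  shows "is_presentation G X E f"
proof -
  obtain k where k: "k \<in> hom (presented_group X E) G"
    "\<And>u. u \<in> words X \<Longrightarrow> k (word_cong X E `` {u}) = word_eval G f u"
    "\<And>x. x \<in> X \<Longrightarrow> k (presented_gen X E x) = f x"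
    using presented_hom_exists[OF f E] by blast
  have eval: "word_eval (presented_group X E) (\<lambda>x. h (f x)) u = word_cong X E `` {u}" if "u \<in> words X" for u
  proof -
    have "word_eval (presented_group X E) (\<lambda>x. h (f x)) u =
        word_eval (presented_group X E) (presented_gen X E) u"
      using that by (induction u) (auto simp: word_eval_Cons h(2))
    then show ?thesis using that by (simp add: presented_gen_eval)
  qed
  have hk: "h (k A) = A" if "A \<in> carrier (presented_group X E)" for A
    using that hom_word_eval[OF group_presented_group h(1) f] by (auto simp: presented_carrier k(2) eval)
  have "inj_on k (carrier (presented_group X E))" by (rule inj_on_inverseI[of _ h]) (rule hk)
  moreover have "k ` carrier (presented_group X E) = carrier G"
  proof
    show "k ` carrier (presented_group X E) \<subseteq> carrier G" using k(1) by (auto simp: hom_def)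
    show "carrier G \<subseteq> k ` carrier (presented_group X E)"
    proof
      fix g assume "g \<in> carrier G"
      then obtain u where "u \<in> words X" "g = word_eval G f u" using gen by blast
      then show "g \<in> k ` carrier (presented_group X E)"
        by (simp add: presented_carrier k(2)[symmetric])
    qed
  qed
  ultimately have "k \<in> iso (presented_group X E) G" using k(1) by (simp add: iso_def bij_betw_def)
  then show ?thesis using k(3) by (auto simp: is_presentation_def)
qed

lemma is_presentation_generates:
  assumes "group G" "is_presentation G X E f" "g \<in> carrier G"
  obtains u where "u \<in> words X" "g = word_eval G f u"
proof -
  interpret group G by fact
  interpret P: group "presented_group X E" by (rule group_presented_group)
  obtain \<phi> where \<phi>: "\<phi> \<in> iso (presented_group X E) G" "\<forall>x\<in>X. \<phi> (presented_gen X E x) = f x"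
    using assms(2) by (auto simp: is_presentation_def)
  have "g \<in> \<phi> ` carrier (presented_group X E)"
    using \<phi>(1) assms(3) by (auto simp: iso_def bij_betw_def)
  then obtain u where u: "u \<in> words X"
    "g = \<phi> (word_eval (presented_group X E) (presented_gen X E) u)"
    by (auto elim: presented_induct)
  have "\<phi> (word_eval (presented_group X E) (presented_gen X E) u) =
      word_eval G (\<lambda>x. \<phi> (presented_gen X E x)) u"
    using \<phi>(1) u(1) by (intro P.hom_word_eval assms(1)) (auto simp: iso_def)
  also have "\<dots> = word_eval G f u"
    using u(1) \<phi>(2) by (induction u) (auto simp: word_eval_Cons)
  finally show thesis using u that by simp
qed

lemma is_presentation_hom:
  assumes "group G" "is_presentation G X E f" "group H" "k \<in> X \<rightarrow> carrier H" "satisfies H k E"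
  obtains h where "h \<in> hom G H" "\<And>x. x \<in> X \<Longrightarrow> h (f x) = k x"
proof -
  interpret group G by fact
  interpret P: group "presented_group X E" by (rule group_presented_group)
  interpret H: group H by fact
  obtain \<phi> where \<phi>: "\<phi> \<in> iso (presented_group X E) G" "\<forall>x\<in>X. \<phi> (presented_gen X E x) = f x"
    using assms(2) by (auto simp: is_presentation_def)
  obtain h where h: "h \<in> hom (presented_group X E) H"
    "\<And>u. u \<in> words X \<Longrightarrow> h (word_cong X E `` {u}) = word_eval H k u"
    "\<And>x. x \<in> X \<Longrightarrow> h (presented_gen X E x) = k x"
    using H.presented_hom_exists[OF assms(4,5)] by blast
  define i where "i = inv_into (carrier (presented_group X E)) \<phi>"
  have i: "i \<in> hom G (presented_group X E)"
    using P.iso_set_sym[OF \<phi>(1)] by (simp add: i_def iso_def)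
  have "i (f x) = presented_gen X E x" if "x \<in> X" for x
  proof -
    have "presented_gen X E x \<in> carrier (presented_group X E)"
      using presented_gen_closed[of X E] that by blast
    then show ?thesis
      unfolding i_def using \<phi> that by (intro inv_into_f_eq) (simp_all add: iso_def bij_betw_def)
  qed
  then show thesis
    using that[of "h \<circ> i"] i h(1,3) by (simp add: hom_def Pi_iff)
qed

section \<open>Certified derivations of equations between positive words\<close>

text \<open>
  A derivation is recorded as a chain of words in which neighbours differ by one application of a known
  equation. Neither the equation nor the place of its application has to be stored: cutting off the
  common prefix and the common suffix of the two neighbours recovers the equation. The same cut, applied
  to the two ends of the chain, is the cancellation law and yields a new equation for later chains.
\<close>

fun strip_prefix :: "'x list \<Rightarrow> 'x list \<Rightarrow> 'x list \<times> 'x list" where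
  "strip_prefix (x # xs) (y # ys) = (if x = y then strip_prefix xs ys else (x # xs, y # ys))"
| "strip_prefix xs ys = (xs, ys)"

definition strip :: "'x list \<Rightarrow> 'x list \<Rightarrow> 'x list \<times> 'x list" where
  "strip u v = (case strip_prefix u v of (u', v') \<Rightarrow>
     case strip_prefix (rev u') (rev v') of (u'', v'') \<Rightarrow> (rev u'', rev v''))"

text \<open>
  The conditional stops the search at the first hit when the function is evaluated by rewriting.
\<close>

fun member_eq :: "('x list \<times> 'x list) list \<Rightarrow> 'x list \<times> 'x list \<Rightarrow> bool" where
  "member_eq [] e \<longleftrightarrow> False"
| "member_eq (d # E) e \<longleftrightarrow> (if d = e then True else member_eq E e)"

lemma member_eq_iff [simp]: "member_eq E e \<longleftrightarrow> e \<in> set E"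
  by (induction E) auto

fun step_ok :: "('x list \<times> 'x list) list \<Rightarrow> 'x list \<times> 'x list \<Rightarrow> bool" where
  "step_ok E (l, r) \<longleftrightarrow>
    (if l = r then True else if member_eq E (l, r) then True else member_eq E (r, l))"

fun chain_ok :: "('x list \<times> 'x list) list \<Rightarrow> 'x list list \<Rightarrow> bool" where
  "chain_ok E (u # v # ws) \<longleftrightarrow> step_ok E (strip u v) \<and> chain_ok E (v # ws)"
| "chain_ok E ws \<longleftrightarrow> True"

fun chains_ok :: "('x list \<times> 'x list) list \<Rightarrow> 'x list list list \<Rightarrow> bool" where
  "chains_ok E [] \<longleftrightarrow> True"
| "chains_ok E (c # cs) \<longleftrightarrow>
    c \<noteq> [] \<and> chain_ok E c \<and> chains_ok (strip (hd c) (last c) # E) cs"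

definition holds :: "('b, 'c) monoid_scheme \<Rightarrow> ('x \<Rightarrow> 'b) \<Rightarrow> 'x list \<times> 'x list \<Rightarrow> bool" where
  "holds G f e \<longleftrightarrow> list_prod G (map f (fst e)) = list_prod G (map f (snd e))"

lemma strip_prefix_append:
  obtains p where "u = p @ fst (strip_prefix u v)" "v = p @ snd (strip_prefix u v)"
proof -
  have "\<exists>p. u = p @ fst (strip_prefix u v) \<and> v = p @ snd (strip_prefix u v)"
  proof (induction u v rule: strip_prefix.induct)
    case (1 x xs y ys)
    then show ?case by (cases "x = y") (auto intro: exI[of _ "y # _"])
  qed auto
  then show thesis using that by blast
qed

lemma strip_append:
  obtains p q where "u = p @ fst (strip u v) @ q" "v = p @ snd (strip u v) @ q"
proof -
  obtain p where p: "u = p @ fst (strip_prefix u v)" "v = p @ snd (strip_prefix u v)"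
    by (rule strip_prefix_append)
  obtain q where q:
    "rev (fst (strip_prefix u v)) =
      q @ fst (strip_prefix (rev (fst (strip_prefix u v))) (rev (snd (strip_prefix u v))))"
    "rev (snd (strip_prefix u v)) =
      q @ snd (strip_prefix (rev (fst (strip_prefix u v))) (rev (snd (strip_prefix u v))))"
    by (rule strip_prefix_append)
  have "fst (strip_prefix u v) = fst (strip u v) @ rev q"
    using arg_cong[OF q(1), of rev] by (simp only: strip_def case_prod_beta rev_append rev_rev_ident fst_conv)
  moreover have "snd (strip_prefix u v) = snd (strip u v) @ rev q"
    using arg_cong[OF q(2), of rev] by (simp only: strip_def case_prod_beta rev_append rev_rev_ident snd_conv)
  ultimately show thesis using p by (intro that[of p "rev q"]) argo+
qed

context group
begin

lemma holds_strip:
  assumes f: "range f \<subseteq> carrier G"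
  shows "holds G f (strip u v) \<longleftrightarrow> holds G f (u, v)"
proof -
  obtain p q where pq: "u = p @ fst (strip u v) @ q" "v = p @ snd (strip u v) @ q"
    by (rule strip_append)
  have c: "list_prod G (map f w) \<in> carrier G" for w using f by (intro list_prod_closed) auto
  have a: "list_prod G (map f (x @ y)) = list_prod G (map f x) \<otimes> list_prod G (map f y)" for x y
    using f by (simp, intro list_prod_append) auto
  show ?thesis
    unfolding holds_def fst_conv snd_conv by (subst (3) pq(1), subst (3) pq(2)) (simp only: a, simp add: c)
qed

lemma holds_step:
  assumes "\<forall>e\<in>set E. holds G f e" "step_ok E e"
  shows "holds G f e"
  using assms by (cases e) (auto simp: holds_def split: if_splits)

lemma holds_chain:
  assumes f: "range f \<subseteq> carrier G"
  shows "\<forall>e\<in>set E. holds G f e \<Longrightarrow> chain_ok E c \<Longrightarrow> c \<noteq> [] \<Longrightarrow> holds G f (hd c, last c)"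
proof (induction E c rule: chain_ok.induct)
  case (1 E u v ws)
  then have "holds G f (strip u v)" by (intro holds_step[of E]) auto
  then have "holds G f (u, v)" by (simp add: holds_strip[OF f])
  moreover have "holds G f (hd (v # ws), last (v # ws))" using 1 by simp
  ultimately show ?case by (simp add: holds_def)
qed (auto simp: holds_def)

lemma holds_chains:
  assumes f: "range f \<subseteq> carrier G"
  shows "\<forall>e\<in>set E. holds G f e \<Longrightarrow> chains_ok E cs \<Longrightarrow> c \<in> set cs \<Longrightarrow> holds G f (hd c, last c)"
proof (induction E cs rule: chains_ok.induct)
  case (2 E d cs)
  have "holds G f (hd d, last d)" using 2 holds_chain[OF f] by simp
  then show ?case using 2 by (auto simp: holds_strip[OF f])
qed simp

end

section \<open>The group of type F4 over the field with three elements\<close>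

text \<open>
  The field with three elements, with constructors on which rewriting computes directly.
\<close>

datatype trit = Nul | Pos | Neg

instantiation trit :: comm_ring_1
begin

definition zero_trit :: trit where "0 = Nul"
definition one_trit :: trit where "1 = Pos"

fun plus_trit :: "trit \<Rightarrow> trit \<Rightarrow> trit" where
  "Nul + x = x"
| "x + Nul = x"
| "Pos + Pos = Neg"
| "Neg + Neg = Pos"
| "Pos + Neg = Nul"
| "Neg + Pos = (Nul :: trit)"

fun uminus_trit :: "trit \<Rightarrow> trit" where
  "- Nul = Nul"
| "- Pos = Neg"
| "- Neg = (Pos :: trit)"

fun times_trit :: "trit \<Rightarrow> trit \<Rightarrow> trit" where
  "Nul * x = Nul"
| "Pos * x = x"
| "Neg * x = - (x :: trit)"

definition minus_trit :: "trit \<Rightarrow> trit \<Rightarrow> trit" where "x - y = x + - (y :: trit)"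

instance
proof
  fix a b c :: trit
  show "a + b + c = a + (b + c)" by (cases a; cases b; cases c) simp_all
  show "a + b = b + a" by (cases a; cases b) simp_all
  show "0 + a = a" by (simp add: zero_trit_def)
  show "- a + a = 0" by (cases a) (simp_all add: zero_trit_def)
  show "a - b = a + - b" by (rule minus_trit_def)
  show "a * b * c = a * (b * c)" by (cases a; cases b; cases c) simp_all
  show "a * b = b * a" by (cases a; cases b) simp_all
  show "1 * a = a" by (simp add: one_trit_def)
  show "(a + b) * c = a * c + b * c" by (cases a; cases b; cases c) simp_all
  show "(0 :: trit) \<noteq> 1" by (simp add: zero_trit_def one_trit_def)
qed

end

lemma trit_char_3 [simp]: "(3 :: trit) = 0"
proof -
  have "(3 :: trit) = 1 + 1 + 1" by simp
  also have "\<dots> = 0" by (simp only: one_trit_def zero_trit_def plus_trit.simps)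
  finally show ?thesis .
qed

lemma trit_cube: "x * (x * x) = (x :: trit)"
  by (cases x) simp_all

type_synonym vec = "trit \<times> trit \<times> trit \<times> trit"

fun dot :: "vec \<Rightarrow> vec \<Rightarrow> trit" where
  "dot (a, b, c, d) (x, y, z, w) = a * x + b * y + c * z + d * w"

fun add_smult :: "vec \<Rightarrow> trit \<Rightarrow> vec \<Rightarrow> vec" where
  "add_smult (x, y, z, w) k (a, b, c, d) = (x + k * a, y + k * b, z + k * c, w + k * d)"

text \<open>
  The orthogonal reflection \<open>v - 2 (v \<bullet> a) / (a \<bullet> a) a\<close>: in the field with three elements \<open>-2 = 1\<close>, and a
  nonzero norm \<open>a \<bullet> a\<close> is its own inverse. The arguments are matched as tuples, so that rewriting
  unfolds the definition on concrete vectors only.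
\<close>

fun reflect :: "vec \<Rightarrow> vec \<Rightarrow> vec" where
  "reflect (a, b, c, d) (x, y, z, w) =
    add_smult (x, y, z, w) (dot (x, y, z, w) (a, b, c, d) * dot (a, b, c, d) (a, b, c, d)) (a, b, c, d)"

lemma reflect_eq: "reflect a v = add_smult v (dot v a * dot a a) a"
  by (cases a; cases v) (simp only: reflect.simps)

text \<open>
  One root from each pair of opposite ones. The four roots \<open>e\<close> are the unit vectors, the eight roots \<open>h\<close>
  are the vectors \<open>(1, \<plusminus>1, \<plusminus>1, \<plusminus>1)\<close>, which modulo \<open>3\<close> are the opposites of \<open>(1/2) (1, \<plusminus>1, \<plusminus>1, \<plusminus>1)\<close>, and
  \<open>pij\<close> and \<open>mij\<close> are the sum and the difference of the unit vectors \<open>i\<close> and \<open>j\<close>.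
\<close>

datatype root = e1 | e2 | e3 | e4 | h0 | h1 | h2 | h3 | h4 | h5 | h6 | h7
  | p12 | p13 | p14 | p23 | p24 | p34 | m12 | m13 | m14 | m23 | m24 | m34

definition short_roots :: "root list" where
  "short_roots = [e1, e2, e3, e4, h0, h1, h2, h3, h4, h5, h6, h7]"

definition long_roots :: "root list" where
  "long_roots = [p12, p13, p14, p23, p24, p34, m12, m13, m14, m23, m24, m34]"

definition roots :: "root list" where
  "roots = short_roots @ long_roots"

lemma in_roots [simp]: "r \<in> set roots"
  by (cases r) (simp_all add: roots_def short_roots_def long_roots_def)

primrec vec :: "root \<Rightarrow> vec" where
  "vec e4 = (Nul, Nul, Nul, Pos)"
| "vec e3 = (Nul, Nul, Pos, Nul)"
| "vec e2 = (Nul, Pos, Nul, Nul)"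
| "vec h7 = (Pos, Neg, Neg, Neg)"
| "vec h6 = (Pos, Neg, Neg, Pos)"
| "vec h5 = (Pos, Neg, Pos, Neg)"
| "vec h4 = (Pos, Neg, Pos, Pos)"
| "vec e1 = (Pos, Nul, Nul, Nul)"
| "vec h3 = (Pos, Pos, Neg, Neg)"
| "vec h2 = (Pos, Pos, Neg, Pos)"
| "vec h1 = (Pos, Pos, Pos, Neg)"
| "vec h0 = (Pos, Pos, Pos, Pos)"
| "vec m34 = (Nul, Nul, Pos, Neg)"
| "vec p34 = (Nul, Nul, Pos, Pos)"
| "vec m23 = (Nul, Pos, Neg, Nul)"
| "vec m24 = (Nul, Pos, Nul, Neg)"
| "vec p24 = (Nul, Pos, Nul, Pos)"
| "vec p23 = (Nul, Pos, Pos, Nul)"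
| "vec m12 = (Pos, Neg, Nul, Nul)"
| "vec m13 = (Pos, Nul, Neg, Nul)"
| "vec m14 = (Pos, Nul, Nul, Neg)"
| "vec p14 = (Pos, Nul, Nul, Pos)"
| "vec p13 = (Pos, Nul, Pos, Nul)"
| "vec p12 = (Pos, Pos, Nul, Nul)"

definition unit_vecs :: "vec list" where
  "unit_vecs = map vec [e1, e2, e3, e4]"

primrec act :: "root list \<Rightarrow> vec \<Rightarrow> vec" where
  "act [] v = v"
| "act (r # us) v = reflect (vec r) (act us v)"

primrec key :: "root list \<Rightarrow> vec list" where
  "key [] = unit_vecs"
| "key (r # us) = map (reflect (vec r)) (key us)"

lemma key_act: "key us = map (act us) unit_vecs"
  by (induction us) simp_all

fun comb :: "vec \<Rightarrow> vec list \<Rightarrow> vec" where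
  "comb (x, y, z, w) [a, b, c, d] =
    add_smult (add_smult (add_smult (add_smult (Nul, Nul, Nul, Nul) x a) y b) z c) w d"
| "comb v ks = v"

lemma act_append [simp]: "act (us @ vs) v = act us (act vs v)"
  by (induction us) simp_all

lemma reflect_add_smult: "reflect a (add_smult v k w) = add_smult (reflect a v) k (reflect a w)"
  by (cases a; cases v; cases w) (simp add: reflect_eq algebra_simps)

lemma reflect_zero: "reflect a (Nul, Nul, Nul, Nul) = (Nul, Nul, Nul, Nul)"
  by (cases a) (simp add: reflect_eq zero_trit_def[symmetric])

lemma reflect_comb: "length ks = 4 \<Longrightarrow> reflect a (comb v ks) = comb v (map (reflect a) ks)"
  by (cases v) (auto simp: numeral_eq_Suc length_Suc_conv reflect_add_smult reflect_zero
      simp del: add_smult.simps)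

lemma comb_unit_vecs: "comb v unit_vecs = v"
  by (cases v) (simp add: unit_vecs_def zero_trit_def[symmetric] one_trit_def[symmetric])

text \<open>
  Products of reflections are linear, hence determined by the images of the unit vectors. This makes
  equality of elements decidable by comparing keys.
\<close>

lemma act_comb: "act us v = comb v (key us)"
proof (induction us)
  case Nil
  show ?case by (simp add: comb_unit_vecs)
next
  case (Cons r us)
  moreover have "length (key us) = 4" by (simp add: key_act unit_vecs_def)
  ultimately show ?case by (simp add: reflect_comb)
qed

lemma act_eq_iff: "act us = act vs \<longleftrightarrow> key us = key vs"
proof
  assume "key us = key vs"
  then show "act us = act vs" by (intro ext) (simp add: act_comb)
qed (simp add: key_act)

lemma dot_add_smult:
  "dot (add_smult u k v) w = dot u w + k * dot v w"
  "dot w (add_smult u k v) = dot w u + k * dot w v"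
  by (cases u; cases v; cases w; simp add: algebra_simps)+

lemma dot_sym: "dot v w = dot w v"
  by (cases v; cases w) (simp add: mult.commute)

lemma dot_reflect: "dot (reflect a v) (reflect a w) = dot v w"
proof -
  define n where "n = dot a a"
  define x where "x = dot v a"
  define y where "y = dot w a"
  have "dot (reflect a v) (reflect a w) = dot v w + (x * (y * n) + (x * (y * n) + x * (y * (n * (n * n)))))"
    by (simp add: reflect_eq dot_add_smult dot_sym[of a w] n_def[symmetric] x_def[symmetric]
        y_def[symmetric] algebra_simps)
  then show ?thesis by (simp add: trit_cube)
qed

lemma dot_act: "dot (act us v) (act us w) = dot v w"
  by (induction us arbitrary: v w) (simp_all add: dot_reflect)

lemma act_self: "act [r, r] v = v"
proof -
  have "list_all (\<lambda>r. key [r, r] = key []) roots" by code_simp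
  then have "key [r, r] = key []" by (simp add: list_all_iff)
  then show ?thesis by (metis act_eq_iff act.simps(1))
qed

lemma act_rev [simp]: "act (rev us) (act us v) = v" "act us (act (rev us) v) = v"
  using act_self by (induction us arbitrary: v) (simp_all del: act_append add: act_append)

lemma bij_act: "bij (act us)"
  by (rule bij_betw_byWitness[of _ "act (rev us)"]) auto

fun root_of :: "vec \<Rightarrow> root" where
  "root_of (x, y, z, w) =
    the (find (\<lambda>r. vec r = (x, y, z, w) \<or> vec r = (- x, - y, - z, - w)) roots)"

definition rconj :: "root \<Rightarrow> root \<Rightarrow> root" where
  "rconj b a = root_of (reflect (vec b) (vec a))"

text \<open>
  Conjugating a reflection by another one moves its root.
\<close>

lemma act_rconj: "act [rconj b a] = act [b, a, b]"
proof -
  have "list_all (\<lambda>b. list_all (\<lambda>a. key [rconj b a] = key [b, a, b]) roots) roots" by code_simp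
  then show ?thesis by (simp add: list_all_iff act_eq_iff)
qed

subsection \<open>Every element is a product of at most four reflections\<close>

definition trits :: "trit list" where
  "trits = [Nul, Pos, Neg]"

definition all_vecs :: "vec list" where
  "all_vecs = List.product trits (List.product trits (List.product trits trits))"

lemma in_all_vecs [simp]: "v \<in> set all_vecs"
proof -
  have "x \<in> set trits" for x by (cases x) (simp_all add: trits_def)
  then show ?thesis by (cases v) (simp add: all_vecs_def)
qed

text \<open>
  The theorem of Cartan and Dieudonne, one coordinate after the other: the words of \<open>to_e1\<close> move every
  vector of norm \<open>1\<close> to the first unit vector, those of \<open>to_e2\<close> move every such vector orthogonal to the
  first unit vector to the second one while fixing the first, and so on. Eight words of \<open>to_e1\<close> have
  length two and all the others at most one, so that five reflections always suffice. The table replaces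
  the \<open>120\<close> words that need all five by words of length three.
\<close>

definition to_e1 :: "root list list" where
  "to_e1 = [
    [h7], [h6], [h5], [h4], [e1], [h3], [h2], [h1], [h0], [p12], [p13], [p14], [m14], [m13], [m12],
    [h7,e1], [h7,p14], [h7,p13], [h6,p13], [], [h7,p12], [h6,p12], [h6,h1], [h7,h0]]"

definition to_e2 :: "root list list" where
  "to_e2 = [[e2], [p23], [p24], [m24], [m23], []]"

definition to_e3 :: "root list list" where
  "to_e3 = [[e3], [p34], [m34], []]"

definition to_e4 :: "root list list" where
  "to_e4 = [[e4], []]"

definition shortening_table :: "(root list \<times> root list) list" where
  "shortening_table = [
    ([e1,h7,e2,e3,e4],[h6,h5,h3]), ([e1,h7,e2,p34,e4],[e4,h2,m12]), ([e1,h7,e2,m34,e4],[e3,h1,m12]),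
    ([e1,h7,p23,e3,e4],[e3,h4,m14]), ([e1,h7,p23,p34,e4],[h6,m34,m13]),
    ([e1,h7,p23,m34,e4],[h6,p34,p13]), ([e1,h7,p24,e3,e4],[e4,h4,m13]),
    ([e1,h7,p24,p34,e4],[h5,p34,p14]), ([e1,h7,p24,m34,e4],[h6,m24,m12]),
    ([e1,h7,m24,e3,e4],[e2,h1,m13]), ([e1,h7,m24,p34,e4],[h6,p24,p12]),
    ([e1,h7,m24,m34,e4],[h3,p23,p13]), ([e1,h7,m23,e3,e4],[e2,h2,m14]),
    ([e1,h7,m23,p34,e4],[h3,p24,p14]), ([e1,h7,m23,m34,e4],[h5,p23,p12]),
    ([p14,h7,e2,e3,e4],[h6,h1,m23]), ([p14,h7,e2,p34,e4],[h2,m24,m14]),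
    ([p14,h7,e2,m34,e4],[h4,p23,p12]), ([p14,h7,p23,e3,e4],[e3,h4,h3]),
    ([p14,h7,p23,p34,e4],[e2,h6,p12]), ([p14,h7,p23,m34,e4],[h6,h1,p34]),
    ([p14,h7,p24,e3,e4],[h4,m34,m14]), ([p14,h7,p24,p34,e4],[e4,h5,m13]),
    ([p14,h7,p24,m34,e4],[e3,h6,p13]), ([p14,h7,m24,e3,e4],[h2,p23,p13]),
    ([p14,h7,m24,p34,e4],[h6,h1,p24]), ([p14,h7,m24,m34,e4],[e2,h0,m13]),
    ([p14,h7,m23,e3,e4],[e2,h5,e1]), ([p14,h7,m23,p34,e4],[e4,h3,m12]),
    ([p14,h7,m23,m34,e4],[e3,h0,m12]), ([p13,h7,e2,e3,e4],[h5,h2,m24]),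
    ([p13,h7,e2,p34,e4],[h4,p24,p12]), ([p13,h7,e2,m34,e4],[h1,m23,m13]),
    ([p13,h7,p23,e3,e4],[h4,m34,m13]), ([p13,h7,p23,p34,e4],[e4,h5,p14]),
    ([p13,h7,p23,m34,e4],[e3,h6,m14]), ([p13,h7,p24,e3,e4],[e4,h4,h3]),
    ([p13,h7,p24,p34,e4],[h5,h2,p34]), ([p13,h7,p24,m34,e4],[e2,h5,p12]),
    ([p13,h7,m24,e3,e4],[e2,h6,e1]), ([p13,h7,m24,p34,e4],[e4,h0,m12]),
    ([p13,h7,m24,m34,e4],[e3,h3,m12]), ([p13,h7,m23,e3,e4],[h1,p24,p14]),
    ([p13,h7,m23,p34,e4],[e2,h0,m14]), ([p13,h7,m23,m34,e4],[h5,h2,p23]),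
    ([p13,h6,e2,e3,e4],[h4,h3,p24]), ([p13,h6,e2,p34,e4],[h0,m23,m13]),
    ([p13,h6,e2,m34,e4],[h5,m24,p12]), ([p13,h6,p23,e3,e4],[h5,p34,m13]),
    ([p13,h6,p23,p34,e4],[e3,h7,p14]), ([p13,h6,p23,m34,e4],[e4,h4,m14]),
    ([p13,h6,p24,e3,e4],[e2,h7,e1]), ([p13,h6,p24,p34,e4],[e3,h2,m12]),
    ([p13,h6,p24,m34,e4],[e4,h1,m12]), ([p13,h6,m24,e3,e4],[e4,h5,h2]),
    ([p13,h6,m24,p34,e4],[e2,h4,p12]), ([p13,h6,m24,m34,e4],[h4,h3,m34]),
    ([p13,h6,m23,e3,e4],[h0,m24,m14]), ([p13,h6,m23,p34,e4],[h4,h3,p23]),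
    ([p13,h6,m23,m34,e4],[e2,h1,p14]), ([p12,h7,e2,e3,e4],[h4,e1,m34]),
    ([p12,h7,e2,p34,e4],[e4,h5,e1]), ([p12,h7,e2,m34,e4],[e3,h6,e1]),
    ([p12,h7,p23,e3,e4],[h1,p34,p14]), ([p12,h7,p23,p34,e4],[e3,h3,p13]),
    ([p12,h7,p23,m34,e4],[e4,h0,m13]), ([p12,h7,p24,e3,e4],[h2,p34,p13]),
    ([p12,h7,p24,p34,e4],[e3,h0,m14]), ([p12,h7,p24,m34,e4],[e4,h3,p14]),
    ([p12,h7,m24,e3,e4],[h1,m23,m12]), ([p12,h7,m24,p34,e4],[e2,h6,m14]),
    ([p12,h7,m24,m34,e4],[h4,e1,p23]), ([p12,h7,m23,e3,e4],[h2,m24,m12]),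
    ([p12,h7,m23,p34,e4],[h4,e1,p24]), ([p12,h7,m23,m34,e4],[e2,h5,m13]),
    ([p12,h6,e2,e3,e4],[h5,e1,p34]), ([p12,h6,e2,p34,e4],[e3,h7,e1]),
    ([p12,h6,e2,m34,e4],[e4,h4,e1]), ([p12,h6,p23,e3,e4],[h0,m34,m14]),
    ([p12,h6,p23,p34,e4],[e4,h1,m13]), ([p12,h6,p23,m34,e4],[e3,h2,p13]),
    ([p12,h6,p24,e3,e4],[h0,m23,m12]), ([p12,h6,p24,p34,e4],[h5,e1,p23]),
    ([p12,h6,p24,m34,e4],[e2,h7,p14]), ([p12,h6,m24,e3,e4],[h3,m34,p13]),
    ([p12,h6,m24,p34,e4],[e4,h2,m14]), ([p12,h6,m24,m34,e4],[e3,h1,p14]),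
    ([p12,h6,m23,e3,e4],[h3,p24,m12]), ([p12,h6,m23,p34,e4],[e2,h4,m13]),
    ([p12,h6,m23,m34,e4],[h5,e1,m24]), ([h1,h6,e2,e3,e4],[h5,h3,h0]),
    ([h1,h6,e2,p34,e4],[e3,h7,p12]), ([h1,h6,e2,m34,e4],[e4,h4,p12]),
    ([h1,h6,p23,e3,e4],[e3,h2,m14]), ([h1,h6,p23,p34,e4],[h0,m34,m13]),
    ([h1,h6,p23,m34,e4],[h5,p24,m14]), ([h1,h6,p24,e3,e4],[e2,h7,p13]),
    ([h1,h6,p24,p34,e4],[h5,p23,m13]), ([h1,h6,p24,m34,e4],[h0,m24,m12]),
    ([h1,h6,m24,e3,e4],[e4,h2,p13]), ([h1,h6,m24,p34,e4],[h5,m23,p13]),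
    ([h1,h6,m24,m34,e4],[h3,m34,p14]), ([h1,h6,m23,e3,e4],[e2,h4,m14]),
    ([h1,h6,m23,p34,e4],[h3,p23,m12]), ([h1,h6,m23,m34,e4],[h5,m24,p14]),
    ([h0,h7,e2,e3,e4],[h4,h2,h1]), ([h0,h7,e2,p34,e4],[e4,h5,p12]), ([h0,h7,e2,m34,e4],[e3,h6,p12]),
    ([h0,h7,p23,e3,e4],[e3,h3,p14]), ([h0,h7,p23,p34,e4],[h4,m24,p14]),
    ([h0,h7,p23,m34,e4],[h1,p34,m13]), ([h0,h7,p24,e3,e4],[e4,h3,p13]),
    ([h0,h7,p24,p34,e4],[h2,p34,m14]), ([h0,h7,p24,m34,e4],[h4,m23,p13]),
    ([h0,h7,m24,e3,e4],[e2,h6,p13]), ([h0,h7,m24,p34,e4],[h1,p24,m12]),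
    ([h0,h7,m24,m34,e4],[h4,p23,m13]), ([h0,h7,m23,e3,e4],[e2,h5,p14]),
    ([h0,h7,m23,p34,e4],[h4,p24,m14]), ([h0,h7,m23,m34,e4],[h2,p23,m12])]"

fun shorten :: "root list \<Rightarrow> root list" where
  "shorten [a, b, c, d, e] = the (map_of shortening_table [a, b, c, d, e])"
| "shorten us = us"

lemma to_unit_vecs:
  "dot v v = 1 \<Longrightarrow> \<exists>m\<in>set to_e1. act m v = vec e1"
  "dot v v = 1 \<Longrightarrow> dot v (vec e1) = 0 \<Longrightarrow> \<exists>m\<in>set to_e2. act m v = vec e2 \<and> act m (vec e1) = vec e1"
  "dot v v = 1 \<Longrightarrow> dot v (vec e1) = 0 \<Longrightarrow> dot v (vec e2) = 0 \<Longrightarrow>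
    \<exists>m\<in>set to_e3. act m v = vec e3 \<and> act m (vec e1) = vec e1 \<and> act m (vec e2) = vec e2"
  "dot v v = 1 \<Longrightarrow> dot v (vec e1) = 0 \<Longrightarrow> dot v (vec e2) = 0 \<Longrightarrow> dot v (vec e3) = 0 \<Longrightarrow>
    \<exists>m\<in>set to_e4. act m v = vec e4 \<and> act m (vec e1) = vec e1 \<and> act m (vec e2) = vec e2 \<and>
      act m (vec e3) = vec e3"
proof -
  have "list_all (\<lambda>v. dot v v = 1 \<longrightarrow> list_ex (\<lambda>m. act m v = vec e1) to_e1) all_vecs"
    by code_simp
  moreover have "list_all (\<lambda>v. dot v v = 1 \<and> dot v (vec e1) = 0 \<longrightarrow>
      list_ex (\<lambda>m. act m v = vec e2 \<and> act m (vec e1) = vec e1) to_e2) all_vecs"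
    by code_simp
  moreover have "list_all (\<lambda>v. dot v v = 1 \<and> dot v (vec e1) = 0 \<and> dot v (vec e2) = 0 \<longrightarrow>
      list_ex (\<lambda>m. act m v = vec e3 \<and> act m (vec e1) = vec e1 \<and> act m (vec e2) = vec e2) to_e3) all_vecs"
    by code_simp
  moreover have "list_all (\<lambda>v. dot v v = 1 \<and> dot v (vec e1) = 0 \<and> dot v (vec e2) = 0 \<and>
      dot v (vec e3) = 0 \<longrightarrow> list_ex (\<lambda>m. act m v = vec e4 \<and> act m (vec e1) = vec e1 \<and>
      act m (vec e2) = vec e2 \<and> act m (vec e3) = vec e3) to_e4) all_vecs"
    by code_simp
  ultimately show
    "dot v v = 1 \<Longrightarrow> \<exists>m\<in>set to_e1. act m v = vec e1"
    "dot v v = 1 \<Longrightarrow> dot v (vec e1) = 0 \<Longrightarrow> \<exists>m\<in>set to_e2. act m v = vec e2 \<and> act m (vec e1) = vec e1"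
    "dot v v = 1 \<Longrightarrow> dot v (vec e1) = 0 \<Longrightarrow> dot v (vec e2) = 0 \<Longrightarrow>
      \<exists>m\<in>set to_e3. act m v = vec e3 \<and> act m (vec e1) = vec e1 \<and> act m (vec e2) = vec e2"
    "dot v v = 1 \<Longrightarrow> dot v (vec e1) = 0 \<Longrightarrow> dot v (vec e2) = 0 \<Longrightarrow> dot v (vec e3) = 0 \<Longrightarrow>
      \<exists>m\<in>set to_e4. act m v = vec e4 \<and> act m (vec e1) = vec e1 \<and> act m (vec e2) = vec e2 \<and>
        act m (vec e3) = vec e3"
    by (simp_all only: list_all_iff list_ex_iff in_all_vecs simp_thms)
qed

lemma shorten_correct:
  assumes "m1 \<in> set to_e1" "m2 \<in> set to_e2" "m3 \<in> set to_e3" "m4 \<in> set to_e4"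
  defines "us \<equiv> rev m1 @ rev m2 @ rev m3 @ rev m4"
  shows "length (shorten us) \<le> 4" "act (shorten us) = act us"
proof -
  have "list_all (\<lambda>m1. list_all (\<lambda>m2. list_all (\<lambda>m3. list_all (\<lambda>m4.
      length (shorten (rev m1 @ rev m2 @ rev m3 @ rev m4)) \<le> 4 \<and>
      key (shorten (rev m1 @ rev m2 @ rev m3 @ rev m4)) = key (rev m1 @ rev m2 @ rev m3 @ rev m4))
      to_e4) to_e3) to_e2) to_e1"
    by code_simp
  then have "length (shorten us) \<le> 4 \<and> key (shorten us) = key us"
    using assms by (simp only: list_all_iff us_def)
  then show "length (shorten us) \<le> 4" "act (shorten us) = act us"
    by (simp_all add: act_eq_iff)
qed

text \<open>
  The images of the unit vectors are again orthonormal, so the four lists move them back one after the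
  other.
\<close>

lemma act_short_word: "\<exists>us. length us \<le> 4 \<and> act us = act vs"
proof -
  let ?f = "act vs"
  have d: "dot (vec e1) (vec e1) = 1" "dot (vec e2) (vec e2) = 1" "dot (vec e3) (vec e3) = 1"
    "dot (vec e4) (vec e4) = 1" "dot (vec e2) (vec e1) = 0" "dot (vec e3) (vec e1) = 0"
    "dot (vec e3) (vec e2) = 0" "dot (vec e4) (vec e1) = 0" "dot (vec e4) (vec e2) = 0"
    "dot (vec e4) (vec e3) = 0"
    by (simp_all add: one_trit_def zero_trit_def)
  obtain m1 where m1: "m1 \<in> set to_e1" "act m1 (?f (vec e1)) = vec e1"
    using to_unit_vecs(1)[of "?f (vec e1)", unfolded dot_act, OF d(1)] by blast
  \<comment> \<open>After the first step the map fixes one unit vector and preserves its orthogonal complement.\<close>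
  define f1 where "f1 v = act (m1 @ vs) v" for v
  have f1: "dot (f1 v) (f1 w) = dot v w" for v w unfolding f1_def by (rule dot_act)
  have f1e: "f1 (vec e1) = vec e1" using m1 by (simp add: f1_def)
  have o1: "dot (f1 v) (vec e1) = dot v (vec e1)" for v using f1[of v "vec e1"] f1e by simp
  obtain m2 where m2: "m2 \<in> set to_e2" "act m2 (f1 (vec e2)) = vec e2" "act m2 (vec e1) = vec e1"
    using to_unit_vecs(2)[of "f1 (vec e2)", unfolded f1 o1, OF d(2,5)] by blast
  define f2 where "f2 v = act (m2 @ m1 @ vs) v" for v
  have f2: "dot (f2 v) (f2 w) = dot v w" for v w unfolding f2_def by (rule dot_act)
  have f2e: "f2 (vec e1) = vec e1" "f2 (vec e2) = vec e2" using m2 f1e by (simp_all add: f2_def f1_def)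
  have o2: "dot (f2 v) (vec e1) = dot v (vec e1)" "dot (f2 v) (vec e2) = dot v (vec e2)" for v
    using f2[of v "vec e1"] f2[of v "vec e2"] f2e by simp_all
  obtain m3 where m3: "m3 \<in> set to_e3" "act m3 (f2 (vec e3)) = vec e3" "act m3 (vec e1) = vec e1"
      "act m3 (vec e2) = vec e2"
    using to_unit_vecs(3)[of "f2 (vec e3)", unfolded f2 o2, OF d(3,6,7)] by blast
  define f3 where "f3 v = act (m3 @ m2 @ m1 @ vs) v" for v
  have f3: "dot (f3 v) (f3 w) = dot v w" for v w unfolding f3_def by (rule dot_act)
  have f3e: "f3 (vec e1) = vec e1" "f3 (vec e2) = vec e2" "f3 (vec e3) = vec e3"
    using m3 f2e by (simp_all add: f3_def f2_def)
  have o3: "dot (f3 v) (vec e1) = dot v (vec e1)" "dot (f3 v) (vec e2) = dot v (vec e2)"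
      "dot (f3 v) (vec e3) = dot v (vec e3)" for v
    using f3[of v "vec e1"] f3[of v "vec e2"] f3[of v "vec e3"] f3e by simp_all
  obtain m4 where m4: "m4 \<in> set to_e4" "act m4 (f3 (vec e4)) = vec e4" "act m4 (vec e1) = vec e1"
      "act m4 (vec e2) = vec e2" "act m4 (vec e3) = vec e3"
    using to_unit_vecs(4)[of "f3 (vec e4)", unfolded f3 o3, OF d(4,8,9,10)] by blast
  have "key (m4 @ m3 @ m2 @ m1 @ vs) = key []"
    using m4 f3e by (simp add: key_act unit_vecs_def f3_def)
  then have "act (m4 @ m3 @ m2 @ m1 @ vs) = act []" by (simp only: act_eq_iff)
  then have inv: "act m4 (act m3 (act m2 (act m1 (act vs v)))) = v" for v by (metis act_append act.simps(1))
  define us where "us = rev m1 @ rev m2 @ rev m3 @ rev m4"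
  have "act us = act vs"
  proof
    fix v
    have "act us v = act us (act m4 (act m3 (act m2 (act m1 (act vs v)))))" by (simp only: inv)
    also have "\<dots> = act vs v" by (simp add: us_def)
    finally show "act us v = act vs v" .
  qed
  moreover have "length (shorten us) \<le> 4" "act (shorten us) = act us"
    using shorten_correct[OF m1(1) m2(1) m3(1) m4(1)] by (simp_all add: us_def)
  ultimately show ?thesis by metis
qed

section \<open>Coxeter groups of type F4 act faithfully\<close>

subsection \<open>Coset representatives along the chain F4, B3, B2, A1\<close>

definition simple :: "nat \<Rightarrow> root" where
  "simple i = (if i = 1 then m23 else if i = 2 then m34 else if i = 3 then e4 else h7)"

definition coxeter_equations :: "(nat list \<times> nat list) list" where
  "coxeter_equations =
    [([1,1],[]), ([2,2],[]), ([3,3],[]), ([4,4],[]),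
     ([1,2,1],[2,1,2]), ([1,3],[3,1]), ([1,4],[4,1]),
     ([2,3,2,3],[3,2,3,2]), ([2,4],[4,2]), ([3,4,3],[4,3,4])]"

text \<open>
  The chain of parabolic subgroups fixes the first unit vector, then the first two, and so on. A word
  \<open>u\<close> on level \<open>k\<close> stands for the coset \<open>H u\<close> of the next subgroup \<open>H\<close> of the chain; the reversed word moves
  the unit vector \<open>k + 1\<close>, and distinct cosets give distinct images.
\<close>

definition coset_words :: "nat \<Rightarrow> nat list list" where
  "coset_words k =
    (if k = 0 then [
      [], [4], [4,3], [4,3,2], [4,3,2,1], [4,3,2,3], [4,3,2,1,3], [4,3,2,3,4], [4,3,2,1,3,2],
      [4,3,2,1,3,4], [4,3,2,1,3,2,3], [4,3,2,1,3,2,4], [4,3,2,1,3,2,3,4], [4,3,2,1,3,2,4,3],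
      [4,3,2,1,3,2,3,4,3], [4,3,2,1,3,2,4,3,2], [4,3,2,1,3,2,3,4,3,2], [4,3,2,1,3,2,4,3,2,1],
      [4,3,2,1,3,2,3,4,3,2,1], [4,3,2,1,3,2,3,4,3,2,3], [4,3,2,1,3,2,3,4,3,2,1,3],
      [4,3,2,1,3,2,3,4,3,2,1,3,2], [4,3,2,1,3,2,3,4,3,2,1,3,2,3], [4,3,2,1,3,2,3,4,3,2,1,3,2,3,4]]
     else if k = 1 then [[], [1], [1,2], [1,2,3], [1,2,3,2], [1,2,3,2,1]]
     else if k = 2 then [[], [2], [2,3], [2,3,2]]
     else [[], [3]])"

definition parabolic :: "nat \<Rightarrow> nat list" where
  "parabolic k = (if k = 0 then [1,2,3,4] else if k = 1 then [1,2,3] else if k = 2 then [2,3]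
     else if k = 3 then [3] else [])"

text \<open>
  Each chain starts with a coset word followed by a generator and ends with a coset word that may be
  preceded by one generator of the next parabolic subgroup. The steps are braid moves, cancellations of
  squares, or ends of previous chains.
\<close>

definition coset_chains :: "nat list list list" where
  "coset_chains = [
    [[4,1],[1,4]], [[4,2],[2,4]], [[4,3,1],[4,1,3],[1,4,3]], [[4,3,4],[3,4,3]],
    [[4,3,2,4],[4,3,4,2],[3,4,3,2]], [[4,3,2,1,3,1],[4,3,2,3,1,1],[4,3,2,3]],
    [[4,3,2,1,2],[4,3,1,2,1],[1,4,3,2,1]], [[4,3,2,1,4],[4,3,2,4,1],[3,4,3,2,1]],
    [[4,3,2,3,1],[4,3,2,1,3]], [[4,3,2,3,2],[4,2,3,2,3],[2,4,3,2,3]],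
    [[4,3,2,1,3,4,1],[4,3,2,1,3,1,4],[4,3,2,3,4]], [[4,3,2,3,4,1],[4,3,2,3,1,4],[4,3,2,1,3,4]],
    [[4,3,2,3,4,2],[4,3,2,3,2,4],[2,4,3,2,3,4]], [[4,3,2,3,4,3],[4,3,2,4,3,4],[3,4,3,2,3,4]],
    [[4,3,2,1,3,2,4,2],[4,3,2,1,3,4,2,2],[4,3,2,1,3,4]],
    [[4,3,2,1,3,2,1],[4,3,2,3,1,2,1],[4,3,2,3,2,1,2],[2,4,3,2,3,1,2],[2,4,3,2,1,3,2]],
    [[4,3,2,1,3,4,2],[4,3,2,1,3,2,4]], [[4,3,2,1,3,4,3],[4,3,2,1,4,3,4],[3,4,3,2,1,3,4]],
    [[4,3,2,1,3,2,3,1],[4,3,2,1,3,2,1,3],[2,4,3,2,1,3,2,3]],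
    [[4,3,2,1,3,2,3,2],[4,3,2,1,2,3,2,3],[1,4,3,2,1,3,2,3]],
    [[4,3,2,1,3,2,4,1],[4,3,2,1,3,2,1,4],[2,4,3,2,1,3,2,4]],
    [[4,3,2,1,3,2,3,4,3,4],[4,3,2,1,3,2,4,3,4,4],[4,3,2,1,3,2,4,3]],
    [[4,3,2,1,3,2,3,4,1],[4,3,2,1,3,2,1,3,4],[2,4,3,2,1,3,2,3,4]],
    [[4,3,2,1,3,2,3,4,2],[4,3,2,1,3,2,3,2,4],[1,4,3,2,1,3,2,3,4]],
    [[4,3,2,1,3,2,4,3,1],[4,3,2,1,3,2,1,4,3],[2,4,3,2,1,3,2,4,3]],
    [[4,3,2,1,3,2,4,3,4],[4,3,2,1,3,2,3,4,3]],
    [[4,3,2,1,3,2,3,4,3,2,4],[4,3,2,1,3,2,3,4,3,4,2],[4,3,2,1,3,2,4,3,2]],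
    [[4,3,2,1,3,2,3,4,3,1],[4,3,2,1,3,2,3,1,4,3],[2,4,3,2,1,3,2,3,4,3]],
    [[4,3,2,1,3,2,4,3,2,3],[4,3,2,1,3,4,3,2,3,2],[3,4,3,2,1,3,4,2,3,2],[3,4,3,2,1,3,2,4,3,2]],
    [[4,3,2,1,3,2,4,3,2,4],[4,3,2,1,3,2,3,4,3,2]],
    [[4,3,2,1,3,2,3,4,3,2,1,4],[4,3,2,1,3,2,3,4,3,2,4,1],[4,3,2,1,3,2,4,3,2,1]],
    [[4,3,2,1,3,2,4,3,2,1,2],[4,3,2,1,3,2,1,4,3,2,1],[2,4,3,2,1,3,2,4,3,2,1]],
    [[4,3,2,1,3,2,4,3,2,1,3],[4,3,2,1,3,2,4,3,2,3,1],[3,4,3,2,1,3,2,4,3,2,1]],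
    [[4,3,2,1,3,2,4,3,2,1,4],[4,3,2,1,3,2,3,4,3,2,1]],
    [[4,3,2,1,3,2,3,4,3,2,1,3,1],[4,3,2,1,3,2,3,4,3,2,3]],
    [[4,3,2,1,3,2,3,4,3,2,1,2],[4,3,2,1,3,2,3,1,4,3,2,1],[2,4,3,2,1,3,2,3,4,3,2,1]],
    [[4,3,2,1,3,2,3,4,3,2,3,1],[4,3,2,1,3,2,3,4,3,2,1,3]],
    [[4,3,2,1,3,2,3,4,3,2,3,2],[4,3,2,1,3,2,3,2,4,3,2,3],[1,4,3,2,1,3,2,3,4,3,2,3]],
    [[4,3,2,1,3,2,3,4,3,2,3,4],[4,3,2,1,3,2,4,3,2,3,4,3],[3,4,3,2,1,3,2,4,3,2,4,3],[3,4,3,2,1,3,2,3,4,3,2,3]],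
    [[4,3,2,1,3,2,3,4,3,2,1,3,4],[4,3,2,1,3,2,3,4,3,2,3,4,1],[3,4,3,2,1,3,2,3,4,3,2,3,1],[3,4,3,2,1,3,2,3,4,3,2,1,3]],
    [[4,3,2,1,3,2,3,4,3,2,1,3,2,1],[4,3,2,1,3,2,3,2,4,3,2,1,3,2],[1,4,3,2,1,3,2,3,4,3,2,1,3,2]],
    [[4,3,2,1,3,2,3,4,3,2,1,3,2,4],[4,3,2,1,3,2,3,4,3,2,1,3,4,2],[3,4,3,2,1,3,2,3,4,3,2,1,3,2]],
    [[4,3,2,1,3,2,3,4,3,2,1,3,2,3,1],[4,3,2,1,3,2,3,2,4,3,2,1,3,2,3],[1,4,3,2,1,3,2,3,4,3,2,1,3,2,3]],
    [[4,3,2,1,3,2,3,4,3,2,1,3,2,3,2],[4,3,2,1,3,2,3,1,4,3,2,1,3,2,3],[2,4,3,2,1,3,2,3,4,3,2,1,3,2,3]],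
    [[4,3,2,1,3,2,3,4,3,2,1,3,2,3,4,1],[4,3,2,1,3,2,3,4,3,2,1,3,2,1,3,4],[1,4,3,2,1,3,2,3,4,3,2,1,3,2,3,4]],
    [[4,3,2,1,3,2,3,4,3,2,1,3,2,3,4,2],[4,3,2,1,3,2,3,1,4,3,2,1,3,2,3,4],[2,4,3,2,1,3,2,3,4,3,2,1,3,2,3,4]],
    [[4,3,2,1,3,2,3,4,3,2,1,3,2,3,4,3],[4,3,2,1,3,2,3,4,3,2,1,3,2,4,3,4],[3,4,3,2,1,3,2,3,4,3,2,1,3,2,3,4]],
    [[1,3],[3,1]], [[1,2,1],[2,1,2]], [[1,2,3,1],[1,2,1,3],[2,1,2,3]],
    [[1,2,3,2,3],[1,3,2,3,2],[3,1,2,3,2]], [[1,2,3,2,1,2],[1,2,3,1,2,1],[2,1,2,3,2,1]],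
    [[1,2,3,2,1,3],[1,2,3,2,3,1],[3,1,2,3,2,1]], [[2,3,2,3],[3,2,3,2]]]"

definition chain_end :: "nat list \<Rightarrow> nat list option" where
  "chain_end u = map_of (map (\<lambda>c. (hd c, last c)) coset_chains) u"

text \<open>
  The product of a coset word and a generator is a coset word, or the generator belongs to the next
  parabolic subgroup, or it cancels the last letter, or a chain takes care of it.
\<close>

fun target_ok :: "nat \<Rightarrow> nat list \<Rightarrow> nat \<Rightarrow> bool" where
  "target_ok k u s \<longleftrightarrow>
    u @ [s] \<in> set (coset_words k) \<or>
    u = [] \<and> s \<in> set (parabolic (Suc k)) \<or>
    u \<noteq> [] \<and> last u = s \<and> butlast u \<in> set (coset_words k) \<or>
    (case chain_end (u @ [s]) of None \<Rightarrow> False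
     | Some v \<Rightarrow> v \<in> set (coset_words k) \<or>
         v \<noteq> [] \<and> hd v \<in> set (parabolic (Suc k)) \<and> tl v \<in> set (coset_words k))"

fun targets_ok :: "nat \<Rightarrow> nat list list \<Rightarrow> nat list \<Rightarrow> bool" where
  "targets_ok k [] ss \<longleftrightarrow> True"
| "targets_ok k (u # us) [] \<longleftrightarrow> targets_ok k us (parabolic k)"
| "targets_ok k (u # us) (s # ss) \<longleftrightarrow> target_ok k u s \<and> targets_ok k (u # us) ss"

lemma coset_chains_ok: "chains_ok coxeter_equations coset_chains"
  by code_simp

lemma coset_targets_ok:
  "targets_ok 0 (coset_words 0) (parabolic 0)" "targets_ok 1 (coset_words 1) (parabolic 1)"
  "targets_ok 2 (coset_words 2) (parabolic 2)" "targets_ok 3 (coset_words 3) (parabolic 3)"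
  by code_simp+

lemma targets_ok_sound:
  "targets_ok k us ss \<Longrightarrow> (us \<noteq> [] \<longrightarrow> (\<forall>s\<in>set ss. target_ok k (hd us) s)) \<and>
    (\<forall>u\<in>set (tl us). \<forall>s\<in>set (parabolic k). target_ok k u s)"
proof (induction k us ss rule: targets_ok.induct)
  case (2 k u us)
  then show ?case by (cases us) (auto simp del: target_ok.simps)
qed (auto simp del: target_ok.simps)

lemma coset_target:
  assumes "k < 4" "u \<in> set (coset_words k)" "s \<in> set (parabolic k)"
  shows "target_ok k u s"
proof -
  have "targets_ok k (coset_words k) (parabolic k)"
    using assms(1) coset_targets_ok by (auto simp: numeral_eq_Suc less_Suc_eq)
  from targets_ok_sound[OF this] assms(2,3) show ?thesis
    by (cases "coset_words k") (auto simp del: target_ok.simps)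
qed

lemma coset_words_move:
  "list_all (\<lambda>u. u = [] \<or> act (map simple (rev u)) (vec e1) \<noteq> vec e1) (coset_words 0)"
  "list_all (\<lambda>u. u = [] \<or> act (map simple (rev u)) (vec e2) \<noteq> vec e2) (coset_words 1)"
  "list_all (\<lambda>u. u = [] \<or> act (map simple (rev u)) (vec e3) \<noteq> vec e3) (coset_words 2)"
  "list_all (\<lambda>u. u = [] \<or> act (map simple (rev u)) (vec e4) \<noteq> vec e4) (coset_words 3)"
  by code_simp+

lemma coset_words_fix:
  "list_all (\<lambda>u. act (map simple (rev u)) (vec e1) = vec e1) (coset_words 1 @ coset_words 2 @ coset_words 3)"
  "list_all (\<lambda>u. act (map simple (rev u)) (vec e2) = vec e2) (coset_words 2 @ coset_words 3)"
  "list_all (\<lambda>u. act (map simple (rev u)) (vec e3) = vec e3) (coset_words 3)"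
  by code_simp+

definition normal_forms :: "nat list set" where
  "normal_forms = {d @ c @ b @ a | a b c d. a \<in> set (coset_words 0) \<and> b \<in> set (coset_words 1) \<and>
     c \<in> set (coset_words 2) \<and> d \<in> set (coset_words 3)}"

text \<open>
  The inverse of the product fixes the first unit vector, which only the factor from level \<open>0\<close> can move;
  so this factor is empty. The next factor is then the only one that can move the second unit vector,
  and so on.
\<close>

lemma normal_form_faithful:
  assumes "u \<in> normal_forms" "act (map simple u) = act []"
  shows "u = []"
proof -
  obtain a b c d where u: "u = d @ c @ b @ a" and a: "a \<in> set (coset_words 0)"
    and b: "b \<in> set (coset_words 1)" and c: "c \<in> set (coset_words 2)" and d: "d \<in> set (coset_words 3)"
    using assms(1) by (auto simp: normal_forms_def)
  let ?A = "\<lambda>u. act (map simple (rev u))"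
  have u': "?A a (?A b (?A c (?A d v))) = v" for v
  proof -
    have "act (map simple (rev u)) v = v"
      using act_rev(1)[of "map simple u" v] assms(2) by (simp add: rev_map)
    then show ?thesis by (simp add: u)
  qed
  have fix1: "?A b (vec e1) = vec e1" "?A c (vec e1) = vec e1" "?A d (vec e1) = vec e1"
    and fix2: "?A c (vec e2) = vec e2" "?A d (vec e2) = vec e2" and fix3: "?A d (vec e3) = vec e3"
    using coset_words_fix b c d by (auto simp: list_all_iff simp del: vec.simps)
  have "?A a (vec e1) = vec e1" using u'[of "vec e1"] fix1 by (simp del: vec.simps)
  then have [simp]: "a = []" using coset_words_move(1) a by (auto simp: list_all_iff simp del: vec.simps)
  have "?A b (vec e2) = vec e2" using u'[of "vec e2"] fix2 by (simp del: vec.simps)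
  then have [simp]: "b = []" using coset_words_move(2) b by (auto simp: list_all_iff simp del: vec.simps)
  have "?A c (vec e3) = vec e3" using u'[of "vec e3"] fix3 by (simp del: vec.simps)
  then have [simp]: "c = []" using coset_words_move(3) c by (auto simp: list_all_iff simp del: vec.simps)
  have "?A d (vec e4) = vec e4" using u'[of "vec e4"] by (simp del: vec.simps)
  then have "d = []" using coset_words_move(4) d by (auto simp: list_all_iff simp del: vec.simps)
  then show ?thesis by (simp add: u)
qed

context group
begin

lemma chain_end_holds:
  assumes f: "range f \<subseteq> carrier G" and E: "\<forall>e\<in>set coxeter_equations. holds G f e"
    and "chain_end u = Some v"
  shows "list_prod G (map f u) = list_prod G (map f v)"
proof -
  have "(u, v) \<in> set (map (\<lambda>c. (hd c, last c)) coset_chains)"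
    using assms(3) unfolding chain_end_def by (rule map_of_SomeD)
  then obtain c where "c \<in> set coset_chains" "u = hd c" "v = last c" by auto
  then show ?thesis using holds_chains[OF f E coset_chains_ok] by (simp add: holds_def)
qed

lemma coset_step:
  assumes f: "range f \<subseteq> carrier G" and E: "\<forall>e\<in>set coxeter_equations. holds G f e"
    and k: "k < 4" and u: "u \<in> set (coset_words k)" and s: "s \<in> set (parabolic k)"
  shows "\<exists>u'\<in>set (coset_words k). \<exists>e. (e = [] \<or> (\<exists>x\<in>set (parabolic (Suc k)). e = [x])) \<and>
    list_prod G (map f (u @ [s])) = list_prod G (map f (e @ u'))"
proof -
  have fc: "f i \<in> carrier G" for i using f by auto
  have sq: "f i \<otimes> f i = \<one>" if "i \<in> {1..4}" for i
  proof -
    have "([i, i], []) \<in> set coxeter_equations" using that by (auto simp: coxeter_equations_def)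
    then show ?thesis using E fc by (fastforce simp: holds_def)
  qed
  have s4: "s \<in> {1..4}" using s by (auto simp: parabolic_def split: if_splits)
  consider "u @ [s] \<in> set (coset_words k)"
    | "u = []" "s \<in> set (parabolic (Suc k))"
    | "u \<noteq> []" "last u = s" "butlast u \<in> set (coset_words k)"
    | v where "chain_end (u @ [s]) = Some v" "v \<in> set (coset_words k)"
    | v where "chain_end (u @ [s]) = Some v" "v \<noteq> []" "hd v \<in> set (parabolic (Suc k))"
        "tl v \<in> set (coset_words k)"
    using coset_target[OF k u s] by (auto split: option.splits)
  then show ?thesis
  proof cases
    case 1
    then show ?thesis by (intro bexI[of _ "u @ [s]"] exI[of _ "[]"]) auto
  next
    case 2
    then show ?thesis using u by (intro bexI[of _ "[]"] exI[of _ "[s]"]) auto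
  next
    case 3
    then obtain w where w: "u = w @ [s]" "w \<in> set (coset_words k)"
      by (cases u rule: rev_cases) auto
    then have "list_prod G (map f (u @ [s])) = list_prod G (map f w)"
      using fc sq[OF s4] by (simp add: list_prod_append image_subset_iff m_assoc)
    then show ?thesis using w by (intro bexI[of _ w] exI[of _ "[]"]) auto
  next
    case 4
    show ?thesis using chain_end_holds[OF f E 4(1)] 4(2)
      by (intro bexI[of _ v] exI[of _ "[]"]) (simp_all del: map_append)
  next
    case 5
    then have "[hd v] @ tl v = v" by simp
    then show ?thesis using chain_end_holds[OF f E 5(1)] 5(3,4)
      by (intro bexI[of _ "tl v"] exI[of _ "[hd v]"]) (simp_all only:, blast)
  qed
qed

end

subsection \<open>The faithful realization\<close>

lemma normal_forms_letters:
  assumes "n \<in> normal_forms"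
  shows "set n \<subseteq> {1..4}"
proof -
  have *: "\<forall>u\<in>set (coset_words 0). set u \<subseteq> {1..4}" "\<forall>u\<in>set (coset_words 1). set u \<subseteq> {1..4}"
    "\<forall>u\<in>set (coset_words 2). set u \<subseteq> {1..4}" "\<forall>u\<in>set (coset_words 3). set u \<subseteq> {1..4}"
    by (simp_all add: coset_words_def)
  obtain a b c d where "n = d @ c @ b @ a" "a \<in> set (coset_words 0)"
    "b \<in> set (coset_words 1)" "c \<in> set (coset_words 2)" "d \<in> set (coset_words 3)"
    using assms by (auto simp: normal_forms_def)
  then show ?thesis using * by (simp del: atLeastAtMost_iff)
qed

text \<open>
  The path \<open>[i1, \<dots>, ik, j]\<close> stands for the conjugate of the simple reflection \<open>j\<close> by the product of the
  simple reflections \<open>i1, \<dots>, ik\<close>, which is the palindrome \<open>i1 \<dots> ik j ik \<dots> i1\<close>.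
\<close>

primrec root_path :: "root \<Rightarrow> nat list" where
  "root_path e4 = [3]"
| "root_path e3 = [2, 3]"
| "root_path e2 = [1, 2, 3]"
| "root_path h7 = [4]"
| "root_path h6 = [4, 3]"
| "root_path h5 = [4, 2, 3]"
| "root_path h4 = [3, 4, 2, 3]"
| "root_path e1 = [4, 3, 2, 3, 4, 1, 2, 3]"
| "root_path h3 = [4, 1, 2, 3]"
| "root_path h2 = [3, 4, 1, 2, 3]"
| "root_path h1 = [2, 3, 4, 1, 2, 3]"
| "root_path h0 = [3, 2, 3, 4, 1, 2, 3]"
| "root_path m34 = [2]"
| "root_path p34 = [3, 2]"
| "root_path m23 = [1]"
| "root_path m24 = [2, 1]"
| "root_path p24 = [3, 2, 1]"
| "root_path p23 = [2, 3, 2, 1]"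
| "root_path m12 = [4, 3, 2]"
| "root_path m13 = [4, 3, 2, 1]"
| "root_path m14 = [4, 2, 3, 2, 1]"
| "root_path p14 = [3, 4, 2, 3, 2, 1]"
| "root_path p13 = [2, 3, 4, 2, 3, 2, 1]"
| "root_path p12 = [1, 2, 3, 4, 2, 3, 2, 1]"

lemma act_single [simp]: "act [r] = reflect (vec r)"
  by (simp add: fun_eq_iff)

definition palindrome :: "nat list \<Rightarrow> nat list" where
  "palindrome p = p @ tl (rev p)"

lemma root_path_act: "act (map simple (palindrome (root_path r))) = act [r]"
proof -
  have "list_all (\<lambda>r. key (map simple (palindrome (root_path r))) = key [r]) roots" by code_simp
  then show ?thesis by (simp add: list_all_iff act_eq_iff del: act_single)
qed

lemma reflect_rconj:
  "reflect (vec (rconj b a)) v = reflect (vec b) (reflect (vec a) (reflect (vec b) v))"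
  using fun_cong[OF act_rconj, of b a v] by simp

text \<open>
  All that is needed of \<open>W\<close>: its reflections are named by the roots, and equality of products of
  reflections is decided by the linear action.
\<close>

locale F4_group = group W for W (structure) +
  fixes R :: "'a set" and t :: "root \<Rightarrow> 'a"
  assumes t_closed [simp]: "t r \<in> carrier W"
    and reflections_eq: "reflections W R = range t"
    and word_eq_iff: "list_prod W (map t us) = list_prod W (map t vs) \<longleftrightarrow> act us = act vs"
    and word_exists: "g \<in> carrier W \<Longrightarrow> \<exists>us. g = list_prod W (map t us)"

definition perm_group :: "('x \<Rightarrow> 'x) monoid" where
  "perm_group = \<lparr>carrier = {f. bij f}, mult = (\<circ>), one = id\<rparr>"

lemma group_perm_group: "group perm_group"
proof (rule groupI)
  fix f :: "'x \<Rightarrow> 'x" assume "f \<in> carrier perm_group"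
  then show "\<exists>g\<in>carrier perm_group. g \<otimes>\<^bsub>perm_group\<^esub> f = \<one>\<^bsub>perm_group\<^esub>"
    by (intro bexI[of _ "inv_into UNIV f"])
      (auto simp: perm_group_def bij_imp_bij_inv bij_is_inj)
qed (auto simp: perm_group_def bij_comp comp_assoc)

lemma list_prod_perm_group: "list_prod perm_group (map (\<lambda>r. act [r]) us) = act us"
  by (induction us) (auto simp: perm_group_def)

lemma simple_pair_order:
  assumes "i \<in> {1..4}" "j \<in> {1..4}"
  shows "act (concat (replicate (F4 i j) [simple i, simple j])) = act []"
proof -
  have m: "F4 1 1 = 1" "F4 1 2 = 3" "F4 1 3 = 2" "F4 1 4 = 2" "F4 2 1 = 3" "F4 2 2 = 1" "F4 2 3 = 4"
    "F4 2 4 = 2" "F4 3 1 = 2" "F4 3 2 = 4" "F4 3 3 = 1" "F4 3 4 = 3" "F4 4 1 = 2" "F4 4 2 = 2"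
    "F4 4 3 = 3" "F4 4 4 = 1"
    by (simp_all add: F4_def doubleton_eq_iff)
  have "i = 1 \<or> i = 2 \<or> i = 3 \<or> i = 4" "j = 1 \<or> j = 2 \<or> j = 3 \<or> j = 4" using assms by auto
  then show ?thesis unfolding act_eq_iff by (elim disjE; simp only: m; code_simp)
qed

context group
begin

lemma list_prod_map_closed [simp]:
  "(\<And>x. f x \<in> carrier G) \<Longrightarrow> list_prod G (map f us) \<in> carrier G"
  by (induction us) simp_all

lemma pow_eq_list_prod:
  "x \<in> carrier G \<Longrightarrow> y \<in> carrier G \<Longrightarrow>
    list_prod G (concat (replicate n [x, y])) = (x \<otimes> y) [^] n"
proof (induction n)
  case (Suc n)
  have "(x \<otimes> y) [^] Suc n = (x \<otimes> y) \<otimes> (x \<otimes> y) [^] n"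
    using Suc.prems by (intro nat_pow_Suc2) simp
  then show ?case using Suc by (simp add: m_assoc del: nat_pow_Suc)
qed simp

text \<open>
  For involutions, \<open>(x y)\<^sup>m = 1\<close> is the braid relation of length \<open>m\<close> with one side moved across.
\<close>

lemma involutions_braid:
  assumes [simp]: "x \<in> carrier G" "y \<in> carrier G" and sq: "x \<otimes> x = \<one>" "y \<otimes> y = \<one>"
  shows "(x \<otimes> y) [^] (2 :: nat) = \<one> \<Longrightarrow> x \<otimes> y = y \<otimes> x"
    and "(x \<otimes> y) [^] (3 :: nat) = \<one> \<Longrightarrow> x \<otimes> (y \<otimes> x) = y \<otimes> (x \<otimes> y)"
    and "(x \<otimes> y) [^] (4 :: nat) = \<one> \<Longrightarrow> x \<otimes> (y \<otimes> (x \<otimes> y)) = y \<otimes> (x \<otimes> (y \<otimes> x))"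
proof -
  have c: "x \<otimes> (x \<otimes> z) = z" "y \<otimes> (y \<otimes> z) = z" if "z \<in> carrier G" for z
    using that sq by (simp_all add: m_assoc[symmetric])
  show "x \<otimes> y = y \<otimes> x" if "(x \<otimes> y) [^] (2 :: nat) = \<one>"
  proof -
    have "x \<otimes> (y \<otimes> (x \<otimes> y)) = \<one>" using that by (simp add: numeral_eq_Suc m_assoc)
    then have "y \<otimes> x = y \<otimes> (x \<otimes> (x \<otimes> (y \<otimes> (x \<otimes> y))))" by simp
    then show ?thesis by (simp add: c)
  qed
  show "x \<otimes> (y \<otimes> x) = y \<otimes> (x \<otimes> y)" if "(x \<otimes> y) [^] (3 :: nat) = \<one>"
  proof -
    have "x \<otimes> (y \<otimes> (x \<otimes> (y \<otimes> (x \<otimes> y)))) = \<one>"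
      using that by (simp add: numeral_eq_Suc m_assoc)
    then have "x \<otimes> (y \<otimes> x) = x \<otimes> (y \<otimes> (x \<otimes> (x \<otimes> (y \<otimes> (x \<otimes> (y \<otimes> (x \<otimes> y)))))))"
      by simp
    then show ?thesis by (simp add: c)
  qed
  show "x \<otimes> (y \<otimes> (x \<otimes> y)) = y \<otimes> (x \<otimes> (y \<otimes> x))" if "(x \<otimes> y) [^] (4 :: nat) = \<one>"
  proof -
    have "x \<otimes> (y \<otimes> (x \<otimes> (y \<otimes> (x \<otimes> (y \<otimes> (x \<otimes> y)))))) = \<one>"
      using that by (simp add: numeral_eq_Suc m_assoc)
    then have "y \<otimes> (x \<otimes> (y \<otimes> x)) = y \<otimes> (x \<otimes> (y \<otimes> (x \<otimes>
        (x \<otimes> (y \<otimes> (x \<otimes> (y \<otimes> (x \<otimes> (y \<otimes> (x \<otimes> y))))))))))"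
      by simp
    then show ?thesis by (simp add: c)
  qed
qed

text \<open>
  The set of products is closed under right multiplication by generators: on each level the generator
  is absorbed, or passed on as a generator of the next parabolic subgroup.
\<close>

lemma normal_form_exists:
  assumes f: "range f \<subseteq> carrier G" and E: "\<forall>e\<in>set coxeter_equations. holds G f e"
  shows "set us \<subseteq> {1..4} \<Longrightarrow> \<exists>n\<in>normal_forms. list_prod G (map f us) = list_prod G (map f n)"
proof -
  define same where "same u v \<longleftrightarrow> list_prod G (map f u) = list_prod G (map f v)" for u v
  have fc: "f i \<in> carrier G" for i using f by auto
  have app: "list_prod G (map f (u @ v)) = list_prod G (map f u) \<otimes> list_prod G (map f v)" for u v
    using fc by (simp add: list_prod_append image_subset_iff)
  define N where "N k = (case k of 0 \<Rightarrow> normal_forms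
    | Suc 0 \<Rightarrow> {d @ c @ b | b c d. b \<in> set (coset_words 1) \<and> c \<in> set (coset_words 2) \<and> d \<in> set (coset_words 3)}
    | Suc (Suc 0) \<Rightarrow> {d @ c | c d. c \<in> set (coset_words 2) \<and> d \<in> set (coset_words 3)}
    | Suc (Suc (Suc 0)) \<Rightarrow> set (coset_words 3) | _ \<Rightarrow> {[]})" for k :: nat
  have N: "N k = {n @ u | n u. n \<in> N (Suc k) \<and> u \<in> set (coset_words k)}" if "k < 4" for k
    using that unfolding N_def normal_forms_def
    by (auto simp: numeral_eq_Suc less_Suc_eq) (metis append_assoc)+
  have closed: "\<exists>n'\<in>N k. same (n @ [s]) n'" if "k \<le> 4" "n \<in> N k" "s \<in> set (parabolic k)" for k n s
    using that
  proof (induction "4 - k" arbitrary: k n s)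
    case 0
    then have "k = 4" by simp
    then show ?case using 0 by (simp add: parabolic_def)
  next
    case (Suc l)
    then have k: "k < 4" by simp
    obtain m u where n: "n = m @ u" and m: "m \<in> N (Suc k)" and u: "u \<in> set (coset_words k)"
      using Suc.prems(2) N[OF k] by auto
    obtain u' e where u': "u' \<in> set (coset_words k)" and e: "e = [] \<or> (\<exists>x\<in>set (parabolic (Suc k)). e = [x])"
      and eq: "same (u @ [s]) (e @ u')"
      using coset_step[OF f E k u Suc.prems(3)] unfolding same_def by blast
    have "\<exists>m'\<in>N (Suc k). same (m @ e) m'"
    proof (cases "e = []")
      case True
      then show ?thesis using m by (auto simp: same_def)
    next
      case False
      then obtain x where "x \<in> set (parabolic (Suc k))" "e = [x]" using e by auto
      then show ?thesis using Suc.hyps(1)[of "Suc k" m x] Suc.hyps(2) k m by auto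
    qed
    then obtain m' where m': "m' \<in> N (Suc k)" "same (m @ e) m'" by blast
    have "list_prod G (map f (m @ u @ [s])) = list_prod G (map f m) \<otimes> list_prod G (map f (e @ u'))"
      using eq unfolding same_def by (subst app) simp
    also have "\<dots> = list_prod G (map f (m @ e)) \<otimes> list_prod G (map f u')"
      using fc by (simp only: app) (simp add: m_assoc image_subset_iff)
    also have "\<dots> = list_prod G (map f (m' @ u'))" using m'(2) unfolding same_def app by simp
    finally have "same (n @ [s]) (m' @ u')" by (simp add: same_def n)
    moreover have "m' @ u' \<in> N k" using m' u' N[OF k] by blast
    ultimately show ?case by blast
  qed
  show "\<exists>n\<in>normal_forms. list_prod G (map f us) = list_prod G (map f n)" if "set us \<subseteq> {1..4}"
    using that
  proof (induction us rule: rev_induct)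
    case Nil
    have "[] \<in> normal_forms" by (auto simp: normal_forms_def coset_words_def)
    then show ?case by (intro bexI[of _ "[]"]) simp_all
  next
    case (snoc s us)
    then obtain n where n: "n \<in> normal_forms" "same us n" by (auto simp: same_def)
    have "s \<in> {1..4}" using snoc.prems by simp
    then have "s \<in> set (parabolic 0)" by (auto simp: parabolic_def)
    then obtain n' where n': "n' \<in> normal_forms" "same (n @ [s]) n'"
      using closed[of 0 n s] n(1) by (auto simp: N_def)
    have "same (us @ [s]) (n @ [s])" using n(2) unfolding same_def app by simp
    then show ?case using n' by (auto simp: same_def)
  qed
qed

lemma reflections_conj:
  assumes R: "R \<subseteq> carrier G" and x: "x \<in> reflections G R" and h: "h \<in> carrier G"
  shows "inv h \<otimes> x \<otimes> h \<in> reflections G R"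
proof -
  obtain g r where g: "g \<in> carrier G" "r \<in> R" "x = inv g \<otimes> r \<otimes> g"
    using x by (auto simp: reflections_def)
  have "inv h \<otimes> x \<otimes> h = inv (g \<otimes> h) \<otimes> r \<otimes> (g \<otimes> h)"
    using g h R by (auto simp: inv_mult_group m_assoc subset_iff)
  then show ?thesis using g h unfolding reflections_def by blast
qed

end

text \<open>
  The presentation of \<open>W\<close> gives a homomorphism to the permutations of the vectors. An element of its
  kernel has a normal form that acts trivially, and such a normal form is empty.
\<close>

theorem F4_group_exists:
  fixes W (structure)
  assumes "finite_coxeter_system W R" "coxeter_type W R {1..4} F4"
  obtains t where "F4_group W R t" "R = t ` simple ` {1..4}"
proof -
  have cox: "group W" "R \<subseteq> carrier W" "\<forall>r\<in>R. group.ord W r = 2"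
    "is_presentation W R (coxeter_relations R (\<lambda>r s. group.ord W (r \<otimes> s))) (\<lambda>r. r)"
    using assms(1) by (auto simp: finite_coxeter_system_def coxeter_system_def)
  interpret group W by fact
  obtain b where b: "bij_betw b {1..4} R"
    and ord: "\<And>i j. i \<in> {1..4} \<Longrightarrow> j \<in> {1..4} \<Longrightarrow> ord (b i \<otimes> b j) = F4 i j"
    using assms(2) by (auto simp: coxeter_type_def)
  define f where "f i = (if i \<in> {1..4} then b i else \<one>)" for i
  have fR: "f i \<in> R" if "i \<in> {1..4}" for i using that b by (auto simp: f_def bij_betw_def)
  have f: "range f \<subseteq> carrier W" using fR cox(2) by (auto simp: f_def)
  then have fc [simp]: "f i \<in> carrier W" for i by auto
  have R: "R = f ` {1..4}" using b by (auto simp: bij_betw_def f_def)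
  have inj: "inj_on f {1..4}" using b by (auto simp: bij_betw_def f_def inj_on_def)
  have pow: "(f i \<otimes> f j) [^] F4 i j = \<one>" if "i \<in> {1..4}" "j \<in> {1..4}" for i j
  proof -
    have "ord (f i \<otimes> f j) = F4 i j" using ord[OF that] that by (simp add: f_def)
    then show ?thesis by (metis pow_ord_eq_1 m_closed fc)
  qed
  have sq: "f i \<otimes> f i = \<one>" if "i \<in> {1..4}" for i
    using pow[OF that that] that by (simp add: F4_def)
  have E: "\<forall>e\<in>set coxeter_equations. holds W f e"
    using sq involutions_braid(1)[OF fc fc sq sq, of 1 3] involutions_braid(1)[OF fc fc sq sq, of 1 4]
      involutions_braid(1)[OF fc fc sq sq, of 2 4] involutions_braid(2)[OF fc fc sq sq, of 1 2]
      involutions_braid(2)[OF fc fc sq sq, of 3 4] involutions_braid(3)[OF fc fc sq sq, of 2 3]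
      pow[of 1 3] pow[of 1 4] pow[of 2 4] pow[of 1 2] pow[of 3 4] pow[of 2 3]
    by (simp add: coxeter_equations_def holds_def F4_def doubleton_eq_iff)
  define k where "k r = act [simple (inv_into {1..4} f r)]" for r
  have kf: "k (f i) = act [simple i]" if "i \<in> {1..4}" for i
    using that inj by (simp add: k_def inv_into_f_f)
  have "satisfies perm_group k (coxeter_relations R (\<lambda>r s. ord (r \<otimes> s)))"
    unfolding satisfies_def
  proof clarify
    fix l r assume "(l, r) \<in> coxeter_relations R (\<lambda>r s. ord (r \<otimes> s))"
    then obtain i j where ij: "i \<in> {1..4}" "j \<in> {1..4}" and
      l: "l = concat (replicate (ord (f i \<otimes> f j)) [(f i, True), (f j, True)])" and r: "r = []"
      unfolding coxeter_relations_def R by blast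
    have m: "ord (f i \<otimes> f j) = F4 i j" using ord ij by (simp add: f_def)
    have "word_eval perm_group k (concat (replicate n [(f i, True), (f j, True)])) =
        list_prod perm_group (map (\<lambda>r. act [r]) (concat (replicate n [simple i, simple j])))" for n
      by (induction n) (simp_all add: kf[OF ij(1)] kf[OF ij(2)])
    then have "word_eval perm_group k l =
        list_prod perm_group (map (\<lambda>r. act [r]) (concat (replicate (F4 i j) [simple i, simple j])))"
      unfolding l m .
    also have "\<dots> = act []" unfolding list_prod_perm_group by (rule simple_pair_order[OF ij])
    finally show "word_eval perm_group k l = word_eval perm_group k r" by (simp add: r perm_group_def fun_eq_iff)
  qed
  moreover have "k \<in> R \<rightarrow> carrier perm_group" using bij_act
    by (auto simp: k_def perm_group_def simp del: act_single)
  ultimately obtain \<rho> where \<rho>: "\<rho> \<in> hom W perm_group" "\<And>x. x \<in> R \<Longrightarrow> \<rho> x = k x"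
    using is_presentation_hom[OF cox(1,4) group_perm_group] by metis
  interpret S: group "perm_group :: (vec \<Rightarrow> vec) monoid" by (rule group_perm_group)
  interpret \<rho>: group_hom W perm_group \<rho> by unfold_locales (rule \<rho>(1))
  have \<rho>_word: "\<rho> (list_prod W (map f us)) = act (map simple us)" if "set us \<subseteq> {1..4}" for us
    using that
  proof (induction us)
    case (Cons i us)
    have c: "list_prod W (map f us) \<in> carrier W" by simp
    have "\<rho> (f i) = act [simple i]" using Cons.prems \<rho>(2) fR kf by simp
    then show ?case using Cons c by (simp add: \<rho>.hom_mult) (auto simp: perm_group_def)
  qed (simp add: perm_group_def fun_eq_iff)
  have gen: "\<exists>us. set us \<subseteq> {1..4} \<and> g = list_prod W (map f us)" if g: "g \<in> carrier W" for g
  proof -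
    obtain u where u: "u \<in> words R" "g = word_eval W (\<lambda>r. r) u"
      using is_presentation_generates[OF cox(1,4) g] by blast
    have "\<exists>us. set us \<subseteq> {1..4} \<and> word_eval W (\<lambda>r. r) u = list_prod W (map f us)"
      using u(1)
    proof (induction u)
      case Nil
      show ?case by (intro exI[of _ "[]"]) simp
    next
      case (Cons a u)
      obtain r c where a: "a = (r, c)" by (cases a)
      obtain i where i: "i \<in> {1..4}" "r = f i" using Cons.prems a R by auto
      have "inv f i = f i" using sq[OF i(1)] by (intro inv_equality) simp_all
      moreover obtain us where "set us \<subseteq> {1..4}" "word_eval W (\<lambda>r. r) u = list_prod W (map f us)"
        using Cons by auto
      ultimately show ?case using i a by (intro exI[of _ "i # us"]) (simp add: word_eval_Cons)
    qed
    then show ?thesis using u(2) by simp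
  qed
  \<comment> \<open>It is enough to write the quotient in normal form.\<close>
  have inj_\<rho>: "g = h" if "g \<in> carrier W" "h \<in> carrier W" "\<rho> g = \<rho> h" for g h
  proof -
    have "g \<otimes> inv h \<in> carrier W" using that by simp
    then obtain us where us: "set us \<subseteq> {1..4}" "g \<otimes> inv h = list_prod W (map f us)"
      using gen by blast
    obtain n where n: "n \<in> normal_forms" "list_prod W (map f us) = list_prod W (map f n)"
      using normal_form_exists[OF f E us(1)] by blast
    have "set n \<subseteq> {1..4}" by (rule normal_forms_letters[OF n(1)])
    then have "act (map simple n) = \<rho> (g \<otimes> inv h)" using \<rho>_word us(2) n(2) by simp
    also have "\<dots> = \<one>\<^bsub>perm_group\<^esub>" using that by simp
    also have "\<dots> = act []" by (simp add: perm_group_def fun_eq_iff)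
    finally have "n = []" by (rule normal_form_faithful[OF n(1)])
    then have "g \<otimes> inv h = \<one>" using us n by simp
    then show ?thesis using that inv_equality inv_inv by fastforce
  qed
  define t where "t r = list_prod W (map f (palindrome (root_path r)))" for r
  have tc [simp]: "t r \<in> carrier W" for r by (simp add: t_def)
  have path: "root_path r \<noteq> []" "set (root_path r) \<subseteq> {1..4}" for r by (cases r; simp)+
  have \<rho>t: "\<rho> (t r) = act [r]" for r
  proof -
    have "set (palindrome (root_path r)) \<subseteq> {1..4}"
      using path[of r] list.set_sel(2)[of "rev (root_path r)"]
      by (auto simp: palindrome_def simp del: atLeastAtMost_iff)
    then show ?thesis unfolding t_def using root_path_act by (simp add: \<rho>_word)
  qed
  have word_t: "\<rho> (list_prod W (map t us)) = act us" for us
  proof (induction us)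
    case (Cons r us)
    have "list_prod W (map t us) \<in> carrier W" by simp
    then show ?case using Cons \<rho>t[of r] by (simp add: \<rho>.hom_mult) (auto simp: perm_group_def)
  qed (simp add: perm_group_def fun_eq_iff)
  have tf: "t (simple i) = f i" if "i \<in> {1..4}" for i
    using that by (intro inj_\<rho>) (simp_all add: \<rho>t \<rho>(2) fR kf)
  \<comment> \<open>Conjugation by a simple reflection moves the root of a reflection; hence all reflections are named by roots.\<close>
  have simple_conj: "\<rho> (f i \<otimes> x \<otimes> f i) = act [rconj (simple i) r]"
    if "\<rho> x = act [r]" "x \<in> carrier W" "i \<in> {1..4}" for x r i
    using that by (simp add: \<rho>(2) fR kf) (simp add: perm_group_def fun_eq_iff reflect_rconj)
  have invf: "inv f i = f i" if "i \<in> {1..4}" for i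
    using sq[OF that] by (intro inv_equality) simp_all
  have sub1: "reflections W R \<subseteq> range t"
  proof
    fix x assume "x \<in> reflections W R"
    then obtain g i where g: "g \<in> carrier W" "i \<in> {1..4}" "x = inv g \<otimes> f i \<otimes> g"
      unfolding reflections_def R by blast
    obtain us where us: "set us \<subseteq> {1..4}" "g = list_prod W (map f us)" using gen[OF g(1)] by blast
    have "\<exists>r. \<rho> (inv list_prod W (map f us) \<otimes> f i \<otimes> list_prod W (map f us)) = act [r]"
      using us(1)
    proof (induction us rule: rev_induct)
      case Nil
      then show ?case using g(2) by (auto simp: \<rho>(2) fR kf)
    next
      case (snoc j us)
      define y where "y = inv list_prod W (map f us) \<otimes> f i \<otimes> list_prod W (map f us)"
      have c: "list_prod W (map f us) \<in> carrier W" by simp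
      have y: "y \<in> carrier W" using c by (simp add: y_def)
      obtain r where "\<rho> y = act [r]" using snoc by (auto simp: y_def)
      moreover have "inv list_prod W (map f (us @ [j])) \<otimes> f i \<otimes> list_prod W (map f (us @ [j]))
          = f j \<otimes> y \<otimes> f j"
        using snoc.prems c by (simp add: list_prod_append image_subset_iff inv_mult_group invf m_assoc y_def)
      ultimately show ?case using simple_conj[of y r j] y snoc.prems by auto
    qed
    then obtain r where "\<rho> x = act [r]" using g us by auto
    then have "x = t r" using g by (intro inj_\<rho>) (simp_all add: \<rho>t)
    then show "x \<in> range t" by simp
  qed
  have pal: "list_prod W (map f (palindrome p)) \<in> reflections W R" if "p \<noteq> []" "set p \<subseteq> {1..4}" for p
    using that
  proof (induction p)
    case (Cons i p)
    show ?case
    proof (cases "p = []")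
      case True
      have "f i \<in> reflections W R"
        using Cons.prems fR[of i] unfolding reflections_def
        by (intro CollectI exI[of _ "\<one>"] exI[of _ "f i"]) simp
      then show ?thesis using True by (simp add: palindrome_def)
    next
      case False
      then have "palindrome (i # p) = i # palindrome p @ [i]" by (simp add: palindrome_def tl_append split: list.splits)
      moreover have "inv f i \<otimes> list_prod W (map f (palindrome p)) \<otimes> f i \<in> reflections W R"
        using Cons False cox(2) by (intro reflections_conj) auto
      moreover have "list_prod W (map f (palindrome p)) \<in> carrier W" by simp
      ultimately show ?thesis using Cons.prems
        by (simp add: invf list_prod_append image_subset_iff m_assoc)
    qed
  qed simp
  have "F4_group W R t"
  proof
    show "reflections W R = range t" using sub1 pal[OF path] by (auto simp: t_def)
    show "list_prod W (map t us) = list_prod W (map t vs) \<longleftrightarrow> act us = act vs" for us vs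
    proof
      assume "act us = act vs"
      then show "list_prod W (map t us) = list_prod W (map t vs)"
        by (intro inj_\<rho>) (simp_all add: word_t)
    qed (metis word_t)
    show "\<exists>us. g = list_prod W (map t us)" if g: "g \<in> carrier W" for g
    proof -
      obtain us where us: "set us \<subseteq> {1..4}" "g = list_prod W (map f us)" using gen[OF g] by blast
      then have "map t (map simple us) = map f us" using tf by (induction us) auto
      then show ?thesis using us(2) by metis
    qed
  qed simp
  moreover have "R = t ` simple ` {1..4}" using tf R by (force simp: image_iff)
  ultimately show thesis by (rule that)
qed

section \<open>Proper quasi-Coxeter elements\<close>

text \<open>
  The product \<open>s1 s3 s2 s4\<close> over the diagram, with \<open>e4\<close>, \<open>h0\<close>, \<open>p23\<close>, \<open>m24\<close> at the vertices
  \<open>1, 2, 3, 4\<close>.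
\<close>

definition w0 :: "root list" where
  "w0 = [e4, p23, h0, m24]"

text \<open>
  The \<open>24\<close> orderings of the simple roots give eight different elements; one ordering for each of them.
\<close>

definition coxeter_words :: "root list list" where
  "coxeter_words =
    [[m23, m34, e4, h7], [m23, m34, h7, e4], [m23, e4, m34, h7], [m23, h7, e4, m34],
     [m34, m23, e4, h7], [m34, m23, h7, e4], [e4, m34, m23, h7], [h7, e4, m34, m23]]"

primrec rconjs :: "root list \<Rightarrow> root \<Rightarrow> root" where
  "rconjs [] a = a"
| "rconjs (g # gs) a = rconj g (rconjs gs a)"

definition stable :: "root list \<Rightarrow> root \<Rightarrow> bool" where
  "stable S u \<longleftrightarrow> list_all (\<lambda>r. rconj u r \<in> set S) S"

text \<open>
  The twelve roots of either length form three orthogonal frames. Short reflections permute the three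
  short frames and preserve each long one, and vice versa; these two actions are the projections of the
  group to the symmetric group on three letters.
\<close>

definition long_frames :: "root list list" where
  "long_frames = [[p12, m12, p34, m34], [p13, m13, p24, m24], [p14, m14, p23, m23]]"

definition short_frames :: "root list list" where
  "short_frames = [[e1, e2, e3, e4], [h0, h3, h5, h6], [h1, h2, h4, h7]]"

text \<open>
  Matching on the nonempty list of keys delays the unfolding until the key has been computed.
\<close>

fun matches :: "vec list \<Rightarrow> root list list \<Rightarrow> bool" where
  "matches ks [] \<longleftrightarrow> False"
| "matches (k # ks) (v # vs) \<longleftrightarrow> k # ks = key v \<or> matches (k # ks) vs"
| "matches [] vs \<longleftrightarrow> False"

lemma matches_imp: "matches ks vs \<Longrightarrow> \<exists>v\<in>set vs. ks = key v"
  by (induction ks vs rule: matches.induct) auto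

lemma act_root_inj: "act [a] = act [b] \<Longrightarrow> a = b"
proof -
  have "list_all (\<lambda>a. list_all (\<lambda>b. key [a] = key [b] \<longrightarrow> a = b) roots) roots" by code_simp
  then show "act [a] = act [b] \<Longrightarrow> a = b" by (simp add: list_all_iff act_eq_iff del: act_single)
qed

lemma rconj_short: "a \<in> set short_roots \<Longrightarrow> rconj b a \<in> set short_roots"
proof -
  have "list_all (\<lambda>b. list_all (\<lambda>a. rconj b a \<in> set short_roots) short_roots) roots" by code_simp
  then show "a \<in> set short_roots \<Longrightarrow> rconj b a \<in> set short_roots" by (simp only: list_all_iff in_roots)
qed

lemma short_or_long: "a \<in> set short_roots \<or> a \<in> set long_roots"
  using in_roots[of a] unfolding roots_def by simp

lemma frames_not_stable:
  "S \<in> set ([p23, m24, p34] # long_frames @ short_frames) \<Longrightarrow> \<exists>b. \<not> stable S b"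
proof -
  have "list_all (\<lambda>S. list_ex (\<lambda>b. \<not> stable S b) roots) ([p23, m24, p34] # long_frames @ short_frames)"
    by code_simp
  then show "S \<in> set ([p23, m24, p34] # long_frames @ short_frames) \<Longrightarrow> \<exists>b. \<not> stable S b"
    by (simp only: list_all_iff list_ex_iff) blast
qed

text \<open>
  Commuting short reflections have roots in the same frame and act on the short frames by the same
  transposition. The case of a single reflection is covered by equal roots.
\<close>

lemma commuting_short_stable_frame:
  assumes "a \<in> set short_roots" "b \<in> set short_roots" "rconj a b = b"
  shows "\<exists>S\<in>set short_frames. stable S a \<and> stable S b \<and> (\<forall>l\<in>set long_roots. stable S l)"
proof -
  have "list_all (\<lambda>a. list_all (\<lambda>b. rconj a b = b \<longrightarrow>
      list_ex (\<lambda>S. stable S a \<and> stable S b) short_frames) short_roots) short_roots"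
    by code_simp
  moreover have "list_all (\<lambda>l. list_all (\<lambda>S. stable S l) short_frames) long_roots"
    by code_simp
  ultimately show ?thesis using assms unfolding list_all_iff list_ex_iff by blast
qed

lemma commuting_long_stable_frame:
  assumes "a \<in> set long_roots" "b \<in> set long_roots" "rconj a b = b"
  shows "\<exists>S\<in>set long_frames. stable S a \<and> stable S b \<and> (\<forall>l\<in>set short_roots. stable S l)"
proof -
  have "list_all (\<lambda>a. list_all (\<lambda>b. rconj a b = b \<longrightarrow>
      list_ex (\<lambda>S. stable S a \<and> stable S b) long_frames) long_roots) long_roots"
    by code_simp
  moreover have "list_all (\<lambda>l. list_all (\<lambda>S. stable S l) long_frames) short_roots"
    by code_simp
  ultimately show ?thesis using assms unfolding list_all_iff list_ex_iff by blast
qed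

text \<open>
  The first root is moved by one reflection, the second one by a further reflection that fixes the first
  root; the empty words take care of roots that are already in place.
\<close>

lemma long_pairs_conjugate:
  assumes "a \<in> set long_roots" "b \<in> set long_roots" "rconj a b \<noteq> b"
  shows "\<exists>g. rconjs g a = p23 \<and> rconjs g b = m24"
proof -
  have "list_all (\<lambda>a. list_all (\<lambda>b. rconj a b \<noteq> b \<longrightarrow>
      list_ex (\<lambda>g. rconjs g a = p23 \<and> list_ex (\<lambda>h. rconjs h p23 = p23 \<and> rconjs h (rconjs g b) = m24)
        [[], [e4], [h4], [h3], [m23], [p23], [m14], [p14]])
      [[], [e3], [h7], [h6], [m34], [p34], [m24], [p24], [m12], [m13], [p13], [p12]])
      long_roots) long_roots"
    by code_simp
  then obtain g h where "rconjs g a = p23" "rconjs h p23 = p23" "rconjs h (rconjs g b) = m24"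
    using assms unfolding list_all_iff list_ex_iff by blast
  moreover have "rconjs (h @ g) x = rconjs h (rconjs g x)" for x by (induction h) simp_all
  ultimately show ?thesis by metis
qed

text \<open>
  The six exceptional pairs consist of short roots orthogonal to both long ones. The product then has
  order three, and the roots of the long plane form a stable set.
\<close>

lemma short_pairs_classified:
  assumes "c \<in> set short_roots" "d \<in> set short_roots" "rconj c d \<noteq> d"
  shows "stable [p23, m24, p34] c \<and> stable [p23, m24, p34] d \<or>
    (\<exists>g. \<exists>v\<in>set (w0 # coxeter_words). act (g @ [p23, m24, c, d] @ rev g) = act v)"
proof -
  have "list_all (\<lambda>c. list_all (\<lambda>d. rconj c d \<noteq> d \<longrightarrow>
      list_ex (\<lambda>g. matches (key (g @ [p23, m24, c, d] @ rev g)) (w0 # coxeter_words))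
        [[], [e2], [e2, h5], [e4, e3], [h4], [p23, m13], [e3, m24], [m34, p24], [h5, p13], [e1]] \<or>
      stable [p23, m24, p34] c \<and> stable [p23, m24, p34] d) short_roots) short_roots"
    by code_simp
  then have "stable [p23, m24, p34] c \<and> stable [p23, m24, p34] d \<or>
    (\<exists>g. matches (key (g @ [p23, m24, c, d] @ rev g)) (w0 # coxeter_words))"
    using assms unfolding list_all_iff list_ex_iff by blast
  then show ?thesis using matches_imp unfolding act_eq_iff by blast
qed

lemma rconj_inj: "rconj b x = rconj b y \<Longrightarrow> x = y"
proof (rule act_root_inj, rule ext)
  fix v
  assume eq: "rconj b x = rconj b y"
  have "reflect (vec b) (reflect (vec z) (reflect (vec b) (reflect (vec b) v))) =
      reflect (vec (rconj b z)) (reflect (vec b) v)" for z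
    by (simp only: reflect_rconj)
  from this[of x] this[of y] have "reflect (vec b) (reflect (vec x) v) = reflect (vec b) (reflect (vec y) v)"
    using act_self[of b v] eq by simp
  then have "act [b, b] (reflect (vec x) v) = act [b, b] (reflect (vec y) v)" by simp
  then show "act [x] v = act [y] v" unfolding act_self by simp
qed

lemma p23_m24_stable: "stable [p23, m24, p34] p23" "stable [p23, m24, p34] m24"
  by code_simp+

lemma act_rconjs: "act (g @ us @ rev g) = act (map (rconjs g) us)"
proof -
  have one: "act (g @ [r] @ rev g) v = act [rconjs g r] v" for r v
  proof (induction g arbitrary: v)
    case (Cons b g)
    then show ?case by (simp add: reflect_rconj)
  qed simp
  show ?thesis
  proof
    fix v
    show "act (g @ us @ rev g) v = act (map (rconjs g) us) v"
    proof (induction us arbitrary: v)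
      case (Cons r us)
      have "act (g @ (r # us) @ rev g) v = act (g @ [r] @ rev g) (act (g @ us @ rev g) v)"
        by simp
      also have "\<dots> = act [rconjs g r] (act (map (rconjs g) us) v)" by (simp only: one Cons)
      finally show ?case by simp
    qed simp
  qed
qed

context F4_group
begin

lemma t_words [simp]: "t ` S \<subseteq> carrier W"
  by auto

lemma word_append:
  "set xs \<subseteq> carrier W \<Longrightarrow> list_prod W (map t us @ xs) = list_prod W (map t us) \<otimes> list_prod W xs"
  by (simp add: list_prod_append)

lemma t_square [simp]: "t r \<otimes> t r = \<one>"
  using word_eq_iff[of "[r, r]" "[]"] act_self[of r] by (simp add: fun_eq_iff)

lemma inv_t [simp]: "inv t r = t r"
  by (rule inv_equality) simp_all

lemma t_rconj: "t (rconj b a) = t b \<otimes> (t a \<otimes> t b)"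
  using word_eq_iff[of "[rconj b a]" "[b, a, b]"] act_rconj[of b a] by simp

lemma t_inj: "t a = t b \<Longrightarrow> a = b"
  using word_eq_iff[of "[a]" "[b]"] act_root_inj[of a b] by (simp del: act_single)

lemma inv_word: "inv (list_prod W (map t us)) = list_prod W (map t (rev us))"
  by (induction us) (simp_all add: inv_mult_group word_append)

lemma reflection_words: "set ts \<subseteq> reflections W R \<longleftrightarrow> (\<exists>us. ts = map t us)"
proof
  show "set ts \<subseteq> reflections W R \<Longrightarrow> \<exists>us. ts = map t us"
    unfolding reflections_eq by (simp add: ex_map_conv subset_iff image_iff)
qed (auto simp: reflections_eq)

lemma refl_length_eq: "refl_length W R g = (LEAST k. \<exists>us. length us = k \<and> g = list_prod W (map t us))"
  unfolding refl_length_def reflection_words by (rule arg_cong[where f = Least]) (force simp: fun_eq_iff)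

lemma refl_length_le: "refl_length W R (list_prod W (map t us)) \<le> length us"
  unfolding refl_length_eq by (rule Least_le) auto

lemma refl_length_word:
  assumes "g \<in> carrier W"
  obtains us where "length us = refl_length W R g" "g = list_prod W (map t us)"
proof -
  have "\<exists>k us. length us = k \<and> g = list_prod W (map t us)" using word_exists[OF assms] by blast
  then have "\<exists>us. length us = refl_length W R g \<and> g = list_prod W (map t us)"
    unfolding refl_length_eq by (rule LeastI_ex)
  then show thesis using that by blast
qed

lemma refl_length_le_4: "g \<in> carrier W \<Longrightarrow> refl_length W R g \<le> 4"
  using word_exists[of g] act_short_word word_eq_iff refl_length_le by (metis order_trans)

text \<open>
  A set of roots that is stable under generating reflections is stable under all reflections, but none
  of the frames is, and neither is the set of roots of the plane.
\<close>

lemma not_all_stable: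
  assumes gen: "generate W (t ` set us) = carrier W"
    and S: "S \<in> set ([p23, m24, p34] # long_frames @ short_frames)"
  shows "\<not> (\<forall>u\<in>set us. stable S u)"
proof
  assume st: "\<forall>u\<in>set us. stable S u"
  have "\<forall>r\<in>set S. \<exists>r'\<in>set S. g \<otimes> t r \<otimes> inv g = t r'" if "g \<in> generate W (t ` set us)" for g
    using that
  proof (induction rule: generate.induct)
    case one
    then show ?case by auto
  next
    case (incl h)
    then obtain u where "u \<in> set us" "h = t u" by auto
    then show ?case using st by (auto simp: stable_def list_all_iff t_rconj m_assoc intro!: bexI[of _ "rconj u _"])
  next
    case (inv h)
    then obtain u where "u \<in> set us" "h = t u" by auto
    then show ?case using st by (auto simp: stable_def list_all_iff t_rconj m_assoc intro!: bexI[of _ "rconj u _"])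
  next
    case (eng g h)
    have gc: "g \<in> carrier W" "h \<in> carrier W" using eng.hyps gen by auto
    show ?case
    proof
      fix r assume "r \<in> set S"
      then obtain r' r'' where "r' \<in> set S" "h \<otimes> t r \<otimes> inv h = t r'" "r'' \<in> set S" "g \<otimes> t r' \<otimes> inv g = t r''"
        using eng.IH by metis
      moreover have "g \<otimes> h \<otimes> t r \<otimes> inv (g \<otimes> h) = g \<otimes> (h \<otimes> t r \<otimes> inv h) \<otimes> inv g"
        using gc by (simp add: inv_mult_group m_assoc)
      ultimately show "\<exists>r'\<in>set S. g \<otimes> h \<otimes> t r \<otimes> inv (g \<otimes> h) = t r'" by auto
    qed
  qed
  then have inv: "\<exists>r'\<in>set S. t (rconj b r) = t r'" if "r \<in> set S" for b r
    using that gen by (simp add: t_rconj m_assoc[symmetric]) (metis inv_t t_closed)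
  have "stable S b" for b
    unfolding stable_def list_all_iff
  proof
    fix r assume "r \<in> set S"
    then show "rconj b r \<in> set S" using inv[of r b] t_inj by auto
  qed
  then show False using frames_not_stable[OF S] by blast
qed

lemma generate_mono_words:
  assumes "\<And>u. u \<in> set us \<Longrightarrow> t u \<in> generate W (t ` set vs)"
  shows "generate W (t ` set us) \<subseteq> generate W (t ` set vs)"
  using assms by (intro generate_subgroup_incl generate_is_subgroup) auto

lemma t_rconjs:
  "t (rconjs g r) = list_prod W (map t g) \<otimes> t r \<otimes> inv (list_prod W (map t g))"
  using word_eq_iff[of "[rconjs g r]" "g @ [r] @ rev g"] act_rconjs[of g "[r]"]
  by (simp add: inv_word word_append m_assoc)

lemma generate_conj:
  assumes gen: "generate W (t ` set us) = carrier W"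
  shows "generate W (t ` set (map (rconjs g) us)) = carrier W"
proof
  let ?h = "list_prod W (map t g)" and ?H = "generate W (t ` set (map (rconjs g) us))"
  show "?H \<subseteq> carrier W" by (rule generate_incl) auto
  have h: "?h \<in> carrier W" by simp
  have conj: "?h \<otimes> x \<otimes> inv ?h \<in> ?H" if "x \<in> generate W (t ` set us)" for x
    using that
  proof (induction rule: generate.induct)
    case one
    then show ?case by (simp add: generate.one)
  next
    case (incl x)
    then show ?case by (auto simp: t_rconjs[symmetric] intro: generate.incl)
  next
    case (inv x)
    then show ?case by (auto simp: t_rconjs[symmetric] intro: generate.incl)
  next
    case (eng x y)
    then have xy: "x \<in> carrier W" "y \<in> carrier W" using gen by auto
    have "?h \<otimes> (x \<otimes> y) \<otimes> inv ?h = (?h \<otimes> x \<otimes> inv ?h) \<otimes> (?h \<otimes> y \<otimes> inv ?h)"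
      using xy h by (simp add: m_assoc)
    then show ?case using eng.IH generate.eng by simp
  qed
  show "carrier W \<subseteq> ?H"
  proof
    fix x assume x: "x \<in> carrier W"
    have "?h \<otimes> (inv ?h \<otimes> x \<otimes> ?h) \<otimes> inv ?h \<in> ?H" using x h gen by (intro conj) simp
    moreover have "?h \<otimes> (inv ?h \<otimes> x \<otimes> ?h) \<otimes> inv ?h = x" using x h by (simp add: m_assoc)
    ultimately show "x \<in> ?H" by simp
  qed
qed

text \<open>
  A Hurwitz move replaces \<open>a l\<close> by \<open>l (l a l)\<close>. The generated subgroup stays the same, because \<open>a\<close> is recovered
  by conjugating back.
\<close>

lemma move_short_right:
  assumes "a \<in> set short_roots"
  shows "\<exists>a'\<in>set short_roots. act (a # ls) = act (ls @ [a']) \<and>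
    t ` set (a # ls) \<subseteq> generate W (t ` set (ls @ [a']))"
  using assms
proof (induction ls arbitrary: a)
  case Nil
  then show ?case by (auto intro: generate.incl)
next
  case (Cons l ls)
  obtain a' where a': "a' \<in> set short_roots" "act (rconj l a # ls) = act (ls @ [a'])"
    "t ` set (rconj l a # ls) \<subseteq> generate W (t ` set (ls @ [a']))"
    using Cons rconj_short by blast
  have "act (a # l # ls) v = act (l # ls @ [a']) v" for v
  proof -
    have "act (a # l # ls) v = act (l # rconj l a # ls) v"
      using act_self[of l] by (simp add: reflect_rconj)
    also have "\<dots> = act (l # ls @ [a']) v" using fun_cong[OF a'(2), of v] by simp
    finally show ?thesis .
  qed
  moreover have "t ` set (a # l # ls) \<subseteq> generate W (t ` set ((l # ls) @ [a']))"
  proof -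
    let ?H = "generate W (t ` set ((l # ls) @ [a']))"
    have l: "t l \<in> ?H" by (rule generate.incl) simp
    have "generate W (t ` set (ls @ [a'])) \<subseteq> ?H" by (rule mono_generate) auto
    then have r: "t (rconj l a) \<in> ?H" "t ` set ls \<subseteq> ?H" using a'(3) by auto
    have "t l \<otimes> (t (rconj l a) \<otimes> t l) \<in> ?H" using l r by (intro generate.eng)
    moreover have "t l \<otimes> (t (rconj l a) \<otimes> t l) = t a"
      by (simp add: t_rconj m_assoc) (simp add: m_assoc[symmetric])
    ultimately show ?thesis using l r by auto
  qed
  ultimately show ?case using a'(1) by (intro bexI[of _ a']) (auto simp: fun_eq_iff)
qed

lemma sort_word:
  "\<exists>ls ss. set ls \<subseteq> set long_roots \<and> set ss \<subseteq> set short_roots \<and>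
    length ls + length ss = length us \<and> act (ls @ ss) = act us \<and>
    generate W (t ` set us) \<subseteq> generate W (t ` set (ls @ ss))"
proof (induction us)
  case Nil
  show ?case by (intro exI[of _ "[]"]) simp
next
  case (Cons a us)
  then obtain ls ss where IH: "set ls \<subseteq> set long_roots" "set ss \<subseteq> set short_roots"
    "length ls + length ss = length us" "act (ls @ ss) = act us"
    "generate W (t ` set us) \<subseteq> generate W (t ` set (ls @ ss))" by blast
  have us: "t ` set us \<subseteq> generate W (t ` set (ls @ ss))"
    using IH(5) by (auto intro: generate.incl)
  show ?case
  proof (cases "a \<in> set long_roots")
    case True
    have "generate W (t ` set (ls @ ss)) \<subseteq> generate W (t ` set ((a # ls) @ ss))"
      by (rule mono_generate) auto
    then have "generate W (t ` set (a # us)) \<subseteq> generate W (t ` set ((a # ls) @ ss))"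
      using us by (intro generate_mono_words) (auto intro: generate.incl)
    moreover have "act ((a # ls) @ ss) = act (a # us)"
      using IH(4) by (simp add: fun_eq_iff)
    ultimately show ?thesis using True IH
      by (intro exI[of _ "a # ls"] exI[of _ ss]) simp
  next
    case False
    then have "a \<in> set short_roots" using short_or_long by blast
    then obtain a' where a': "a' \<in> set short_roots" "act (a # ls) = act (ls @ [a'])"
      "t ` set (a # ls) \<subseteq> generate W (t ` set (ls @ [a']))"
      using move_short_right by blast
    let ?H = "generate W (t ` set (ls @ a' # ss))"
    have "generate W (t ` set (ls @ [a'])) \<subseteq> ?H" by (rule mono_generate) auto
    then have 1: "t ` set (a # ls) \<subseteq> ?H" using a'(3) by blast
    have "t ` set ss \<subseteq> ?H" by (auto intro: generate.incl)
    then have "generate W (t ` set (ls @ ss)) \<subseteq> ?H"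
      using 1 by (intro generate_mono_words) auto
    then have "generate W (t ` set (a # us)) \<subseteq> ?H"
      using us 1 by (intro generate_mono_words) auto
    moreover have "act (ls @ a' # ss) v = act (a # us) v" for v
    proof -
      have "act (ls @ a' # ss) v = act (ls @ [a']) (act ss v)" by simp
      also have "\<dots> = act (a # ls) (act ss v)" by (simp only: a'(2))
      also have "\<dots> = act (a # us) v" using fun_cong[OF IH(4), of v] by simp
      finally show ?thesis .
    qed
    ultimately show ?thesis using a'(1) IH
      by (intro exI[of _ ls] exI[of _ "a' # ss"]) (auto simp: fun_eq_iff)
  qed
qed

text \<open>
  With fewer than two roots of one length, or with two commuting ones as the only roots of this length, all
  factors would preserve a common frame.
\<close>

lemma generating_word_conjugate:
  assumes gen: "generate W (t ` set us) = carrier W" and "length us \<le> 4"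
  shows "length us = 4 \<and> (\<exists>g. \<exists>v\<in>set (w0 # coxeter_words). act (g @ us @ rev g) = act v)"
proof -
  obtain ls ss where ls: "set ls \<subseteq> set long_roots" and ss: "set ss \<subseteq> set short_roots"
    and len: "length ls + length ss = length us" and eq: "act (ls @ ss) = act us"
    and sub: "generate W (t ` set us) \<subseteq> generate W (t ` set (ls @ ss))"
    using sort_word[of us] by blast
  have "generate W (t ` set (ls @ ss)) \<subseteq> carrier W" by (rule generate_incl) simp
  then have gen': "generate W (t ` set (ls @ ss)) = carrier W"
    using gen sub by (intro subset_antisym) simp_all
  have no_short_frame: "\<not> (\<exists>S\<in>set short_frames. (\<forall>a\<in>set ss. stable S a) \<and> (\<forall>l\<in>set long_roots. stable S l))"
  proof
    assume "\<exists>S\<in>set short_frames. (\<forall>a\<in>set ss. stable S a) \<and> (\<forall>l\<in>set long_roots. stable S l)"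
    then obtain S where "S \<in> set short_frames" "\<forall>u\<in>set (ls @ ss). stable S u" using ls by auto
    then show False using not_all_stable[OF gen', of S] by simp
  qed
  have no_long_frame: "\<not> (\<exists>S\<in>set long_frames. (\<forall>a\<in>set ls. stable S a) \<and> (\<forall>l\<in>set short_roots. stable S l))"
  proof
    assume "\<exists>S\<in>set long_frames. (\<forall>a\<in>set ls. stable S a) \<and> (\<forall>l\<in>set short_roots. stable S l)"
    then obtain S where "S \<in> set long_frames" "\<forall>u\<in>set (ls @ ss). stable S u" using ss by auto
    then show False using not_all_stable[OF gen', of S] by simp
  qed
  have "rconj e1 e1 = e1" "rconj p12 p12 = p12" by code_simp+
  then have frames: "\<exists>S\<in>set short_frames. \<forall>l\<in>set long_roots. stable S l"
    "\<exists>S\<in>set long_frames. \<forall>l\<in>set short_roots. stable S l"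
    using commuting_short_stable_frame[of e1 e1] commuting_long_stable_frame[of p12 p12]
    by (auto simp: short_roots_def long_roots_def)
  have self: "rconj r r = r" for r
  proof -
    have "act [rconj r r] = act [r]" using act_self[of r] by (simp add: reflect_rconj fun_eq_iff)
    then show ?thesis by (rule act_root_inj)
  qed
  \<comment> \<open>A list with fewer than two entries, or with two commuting ones, would preserve a short frame.\<close>
  have s2: "length ss \<ge> 2 \<and> (length ss = 2 \<longrightarrow> (\<exists>c d. ss = [c, d] \<and> rconj c d \<noteq> d))"
  proof (cases ss)
    case Nil
    then show ?thesis using no_short_frame frames(1) by auto
  next
    case (Cons c xs)
    show ?thesis
    proof (cases xs)
      case Nil
      then show ?thesis using Cons no_short_frame ss commuting_short_stable_frame[of c c] self by auto
    next
      case (Cons d ys)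
      then show ?thesis using \<open>ss = c # xs\<close> no_short_frame ss commuting_short_stable_frame[of c d]
        by (cases ys) auto
    qed
  qed
  have l2: "length ls \<ge> 2 \<and> (length ls = 2 \<longrightarrow> (\<exists>c d. ls = [c, d] \<and> rconj c d \<noteq> d))"
  proof (cases ls)
    case Nil
    then show ?thesis using no_long_frame frames(2) by auto
  next
    case (Cons c xs)
    show ?thesis
    proof (cases xs)
      case Nil
      then show ?thesis using Cons no_long_frame ls commuting_long_stable_frame[of c c] self by auto
    next
      case (Cons d ys)
      then show ?thesis using \<open>ls = c # xs\<close> no_long_frame ls commuting_long_stable_frame[of c d]
        by (cases ys) auto
    qed
  qed
  have 4: "length us = 4" "length ls = 2" "length ss = 2" using s2 l2 len assms(2) by auto
  obtain a b c d where ab: "ls = [a, b]" "rconj a b \<noteq> b" and cd: "ss = [c, d]" "rconj c d \<noteq> d"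
    using s2 l2 4 by blast
  obtain g where g: "rconjs g a = p23" "rconjs g b = m24"
    using long_pairs_conjugate[of a b] ab ls by auto
  define c' where "c' = rconjs g c"
  define d' where "d' = rconjs g d"
  have short: "rconjs g x \<in> set short_roots" if "x \<in> set short_roots" for x
    using that by (induction g) (auto intro: rconj_short)
  have conj_us: "act (g @ us @ rev g) = act [p23, m24, c', d']"
  proof -
    have "act (g @ us @ rev g) = act (g @ (ls @ ss) @ rev g)"
      using fun_cong[OF eq] by (intro ext) simp
    also have "\<dots> = act (map (rconjs g) (ls @ ss))" by (rule act_rconjs)
    also have "\<dots> = act [p23, m24, c', d']" by (simp add: ab cd g c'_def d'_def)
    finally show ?thesis .
  qed
  have rc: "rconjs g (rconj x y) = rconj (rconjs g x) (rconjs g y)" for x y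
  proof (rule act_root_inj, rule ext)
    fix v
    have "act [rconjs g (rconj x y)] v = act (g @ [rconj x y] @ rev g) v"
      by (simp only: act_rconjs list.map)
    also have "\<dots> = act (g @ [x, y, x] @ rev g) v" by (simp add: reflect_rconj)
    also have "\<dots> = act [rconj (rconjs g x) (rconjs g y)] v"
      by (simp only: act_rconjs list.map) (simp add: reflect_rconj)
    finally show "act [rconjs g (rconj x y)] v = act [rconj (rconjs g x) (rconjs g y)] v" .
  qed
  have "rconj c' d' \<noteq> d'"
  proof
    assume "rconj c' d' = d'"
    then have "rconjs g (rconj c d) = rconjs g d" by (simp add: rc c'_def d'_def)
    then have "rconj c d = d" by (induction g) (auto dest!: rconj_inj)
    then show False using cd by simp
  qed
  then consider "stable [p23, m24, p34] c'" "stable [p23, m24, p34] d'"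
    | h v where "v \<in> set (w0 # coxeter_words)" "act (h @ [p23, m24, c', d'] @ rev h) = act v"
    using short_pairs_classified[of c' d'] short ss cd by (auto simp: c'_def d'_def)
  then show ?thesis
  proof cases
    case 1
    \<comment> \<open>The conjugated factors still generate, although they preserve the roots of the long plane.\<close>
    have "generate W (t ` set (map (rconjs g) (ls @ ss))) = carrier W"
      by (rule generate_conj[OF gen'])
    then have "generate W (t ` set [p23, m24, c', d']) = carrier W"
      by (simp add: ab cd g c'_def d'_def)
    then have "\<not> (\<forall>u\<in>set [p23, m24, c', d']. stable [p23, m24, p34] u)"
      by (rule not_all_stable) simp
    then show ?thesis using 1 p23_m24_stable by simp
  next
    case 2
    have "act ((h @ g) @ us @ rev (h @ g)) = act v"
    proof
      fix v'
      have "act ((h @ g) @ us @ rev (h @ g)) v' = act h (act (g @ us @ rev g) (act (rev h) v'))" by simp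
      also have "\<dots> = act (h @ [p23, m24, c', d'] @ rev h) v'" by (simp only: conj_us act_append)
      finally show "act ((h @ g) @ us @ rev (h @ g)) v' = act v v'" by (simp only: 2(2))
    qed
    then show ?thesis using 2(1) 4 by blast
  qed
qed

text \<open>
  Renaming the reflections by a conjugation allows one to assume that a given conjugate of the product of
  \<open>w0\<close> is this product itself.
\<close>

lemma conjugate_F4_group:
  assumes g: "g \<in> carrier W"
  shows "F4_group W R (\<lambda>r. inv g \<otimes> t r \<otimes> g)"
proof
  have conj: "list_prod W (map (\<lambda>r. inv g \<otimes> t r \<otimes> g) us) = inv g \<otimes> list_prod W (map t us) \<otimes> g" for us
    using list_prod_conj[OF g, of "map t us"] by (simp add: image_subset_iff comp_def)
  have cancel: "inv g \<otimes> x \<otimes> g = inv g \<otimes> y \<otimes> g \<longleftrightarrow> x = y" if "x \<in> carrier W" "y \<in> carrier W" for x y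
    using that g by simp
  show "inv g \<otimes> t r \<otimes> g \<in> carrier W" for r using g by simp
  have sub: "(\<lambda>r. inv h \<otimes> t r \<otimes> h) ` UNIV \<subseteq> range t" if h: "h \<in> carrier W" for h
  proof
    fix x assume "x \<in> (\<lambda>r. inv h \<otimes> t r \<otimes> h) ` UNIV"
    then obtain r where x: "x = inv h \<otimes> t r \<otimes> h" by auto
    obtain us where "inv h = list_prod W (map t us)" using word_exists[of "inv h"] h by auto
    then have "x = t (rconjs us r)" using h x by (metis t_rconjs inv_inv)
    then show "x \<in> range t" by simp
  qed
  show "reflections W R = range (\<lambda>r. inv g \<otimes> t r \<otimes> g)"
  proof
    show "reflections W R \<subseteq> range (\<lambda>r. inv g \<otimes> t r \<otimes> g)"
    proof
      fix x assume "x \<in> reflections W R"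
      then obtain r where r: "x = t r" by (auto simp: reflections_eq)
      obtain s where s: "inv (inv g) \<otimes> t r \<otimes> inv g = t s" using sub[of "inv g"] g by blast
      have "inv g \<otimes> t s \<otimes> g = x" using g unfolding s[symmetric] r by (simp add: m_assoc)
      then show "x \<in> range (\<lambda>r. inv g \<otimes> t r \<otimes> g)" by blast
    qed
  qed (use sub[OF g] in \<open>simp add: reflections_eq\<close>)
  show "list_prod W (map (\<lambda>r. inv g \<otimes> t r \<otimes> g) us) = list_prod W (map (\<lambda>r. inv g \<otimes> t r \<otimes> g) vs) \<longleftrightarrow>
      act us = act vs" for us vs
    unfolding conj by (subst cancel) (simp_all add: word_eq_iff)
  show "\<exists>us. x = list_prod W (map (\<lambda>r. inv g \<otimes> t r \<otimes> g) us)" if "x \<in> carrier W" for x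
  proof -
    have "g \<otimes> x \<otimes> inv g \<in> carrier W" using that g by simp
    then obtain us where "g \<otimes> x \<otimes> inv g = list_prod W (map t us)"
      using word_exists by blast
    then have "list_prod W (map (\<lambda>r. inv g \<otimes> t r \<otimes> g) us) = inv g \<otimes> (g \<otimes> x \<otimes> inv g) \<otimes> g"
      by (simp add: conj)
    also have "\<dots> = x" using that g by (simp add: m_assoc)
    finally show ?thesis by metis
  qed
qed

end

theorem proper_quasi_coxeter_realization:
  fixes W (structure)
  assumes "finite_coxeter_system W R" "coxeter_type W R {1..4} F4" "proper_quasi_coxeter W R w"
  obtains t where "F4_group W R t" "w = list_prod W (map t w0)" "refl_length W R w = 4"
proof -
  obtain t where t: "F4_group W R t" and R: "R = t ` simple ` {1..4}"
    using F4_group_exists[OF assms(1,2)] .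
  interpret F4_group W R t by (rule t)
  obtain ts where "reduced_decomposition W R w ts" and gen: "generate W (set ts) = carrier W"
    and not_cox: "\<not> coxeter_element W R w"
    using assms(3) by (auto simp: proper_quasi_coxeter_def quasi_coxeter_def)
  then obtain us where us: "ts = map t us" "length us = refl_length W R w" "w = list_prod W (map t us)"
    unfolding reduced_decomposition_def reflection_words by auto
  have "length us \<le> 4" using us refl_length_le_4[of w] by simp
  then obtain h v where len: "length us = 4" and v: "v \<in> set (w0 # coxeter_words)"
    and h: "act (h @ us @ rev h) = act v"
    using generating_word_conjugate[of us] gen us(1) by auto
  define g where "g = list_prod W (map t h)"
  have g: "g \<in> carrier W" by (simp add: g_def)
  have "list_prod W (map t (h @ us @ rev h)) = list_prod W (map t v)" using h word_eq_iff by blast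
  then have "g \<otimes> w \<otimes> inv g = list_prod W (map t v)"
    by (simp add: word_append g_def inv_word us(3) m_assoc)
  then have "inv g \<otimes> list_prod W (map t v) \<otimes> g = inv g \<otimes> (g \<otimes> w \<otimes> inv g) \<otimes> g"
    by simp
  also have "\<dots> = w" using g by (simp add: us(3) m_assoc)
  finally have w: "w = inv g \<otimes> list_prod W (map t v) \<otimes> g" by simp
  have "v = w0"
  proof (rule ccontr)
    assume "v \<noteq> w0"
    then have "distinct v \<and> set v = {m23, m34, e4, h7}" using v by (auto simp: coxeter_words_def)
    moreover have "simple ` {1..4} = {m23, m34, e4, h7}"
    proof -
      have "{1..4} = {1, 2, 3, 4 :: nat}" by auto
      then show ?thesis by (auto simp: simple_def)
    qed
    ultimately have "distinct (map t v)" "set (map t v) = R"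
      using R t_inj by (auto simp: distinct_map inj_on_def)
    then show False using not_cox w g unfolding coxeter_element_def by blast
  qed
  then have "w = list_prod W (map (\<lambda>r. inv g \<otimes> t r \<otimes> g) w0)"
    using w list_prod_conj[OF g, of "map t w0"] by (simp add: image_subset_iff comp_def)
  then show thesis using that conjugate_F4_group[OF g] len us(2) by simp
qed

section \<open>Reduced decompositions of the quasi-Coxeter element\<close>

subsection \<open>Lifting all reflections\<close>

text \<open>
  The entry \<open>(a, b, left, c)\<close> defines the lift of \<open>c\<close> from those of \<open>a\<close> and \<open>b\<close>, as \<open>a b a\<^sup>-\<^sup>1\<close> if \<open>left\<close> holds and
  as \<open>b\<^sup>-\<^sup>1 a b\<close> otherwise. The reflections \<open>a\<close> and \<open>b\<close> are adjacent factors, in this order, of a reduced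
  decomposition; in the interval group the lift is then the generator that belongs to \<open>c\<close>. The first
  entries produce the conjugates that occur in the commutator relators.
\<close>

definition lift_defs :: "(root \<times> root \<times> bool \<times> root) list" where
  "lift_defs = [
    (e4,h0,False,h1), (p23,h1,True,h7), (p23,m24,True,p34), (p34,h0,False,p12), (e4,p34,False,e3),
    (e4,p34,True,m34), (e4,m24,False,e2), (e4,m24,True,p24), (h7,e4,False,h6), (h7,p34,False,h4),
    (h7,p34,True,m12), (h7,p23,True,m14), (h1,m24,True,p13), (h1,p12,False,h2), (h0,p12,False,h3),
    (m24,p12,False,p14), (e4,p14,False,e1), (e3,p23,True,m23), (e3,p13,True,m13), (h7,e3,False,h5)]"

fun def_equation :: "root \<times> root \<times> bool \<times> root \<Rightarrow> root list \<times> root list" where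
  "def_equation (a, b, left, c) = ([a, b], if left then [c, a] else [b, c])"

text \<open>
  The relations of the diagram. The last two are the commutator relators: with \<open>h1 = s2\<^sup>-\<^sup>1 s1 s2\<close> and
  \<open>h7 = s3 h1 s3\<^sup>-\<^sup>1\<close>, the element \<open>h1\<close> commutes with \<open>s3\<^sup>-\<^sup>1 s4 s3\<close> if and only if \<open>h7\<close> commutes with \<open>s4\<close>, and
  similarly for \<open>p12 = s2\<^sup>-\<^sup>1 (s3 s4 s3\<^sup>-\<^sup>1) s2\<close> and \<open>s1\<close>.
\<close>

definition vertex_equations :: "(root list \<times> root list) list" where
  "vertex_equations = [
    ([e4,h0,e4],[h0,e4,h0]), ([p23,m24,p23],[m24,p23,m24]), ([e4,p23],[p23,e4]),
    ([h0,m24],[m24,h0]), ([e4,m24,e4,m24],[m24,e4,m24,e4]), ([h0,p23,h0,p23],[p23,h0,p23,h0]),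
    ([h7,m24],[m24,h7]), ([e4,p12],[p12,e4])]"

text \<open>
  The two ends of a chain of words of length three or four begin or end with the same letter, and
  cancelling it gives a new relation. The last chains, of words of length two, only combine previous
  relations.
\<close>

definition lift_chains :: "root list list list" where
  "lift_chains = [
    [[h0,h1,e4],[e4,h0,e4],[h0,e4,h0]], [[p23,m24,p23],[m24,p23,m24],[m24,p34,p23]],
    [[e4,h6,p23],[h7,e4,p23],[h7,p23,e4],[p23,h1,e4],[p23,e4,h0],[e4,p23,h0]],
    [[h0,p13,h1],[h0,h1,m24],[e4,h0,m24],[e4,m24,h0],[p24,e4,h0],[p24,h0,h1]],
    [[h1,p24,e4],[h1,e4,m24],[e4,h0,m24],[e4,m24,h0],[p24,e4,h0],[p24,h1,e4]],
    [[h1,p12,e4],[h1,e4,p12],[e4,h0,p12],[e4,p34,h0],[m34,e4,h0],[m34,h1,e4]],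
    [[p34,e3,h0],[e4,p34,h0],[e4,h0,p12],[h0,h1,p12],[h0,p12,h2],[p34,h0,h2]],
    [[p12,e4,h3],[e4,p12,h3],[e4,h0,p12],[h0,h1,p12],[h0,p12,h2],[p12,h3,h2]],
    [[p12,h2,e4],[h1,p12,e4],[h1,e4,p12],[e4,h0,p12],[e4,p12,h3],[p12,e4,h3]],
    [[p34,e3,p23],[e4,p34,p23],[e4,p23,m24],[p23,e4,m24],[p23,m24,e2],[p34,p23,e2]],
    [[m34,p23,e4],[m34,e4,p23],[e4,p34,p23],[e4,p23,m24],[p23,e4,m24],[p23,p24,e4]],
    [[p24,m34,e4],[p24,e4,p34],[e4,m24,p34],[e4,p23,m24],[p23,e4,m24],[p23,p24,e4]],
    [[m24,e2,p34],[e4,m24,p34],[e4,p23,m24],[p23,e4,m24],[p23,m24,e2],[m24,p34,e2]],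
    [[m24,e2,p12],[e4,m24,p12],[e4,p12,p14],[p12,e4,p14],[p12,p14,e1],[m24,p12,e1]],
    [[m12,p23,h1],[m12,h7,p23],[h7,p34,p23],[h7,p23,m24],[p23,h1,m24],[p23,p13,h1]],
    [[m12,m14,h7],[m12,h7,p23],[h7,p34,p23],[h7,p23,m24],[m14,h7,m24],[m14,m24,h7]],
    [[m24,m12,h7],[m24,h7,p34],[h7,m24,p34],[h7,p23,m24],[m14,h7,m24],[m14,m24,h7]],
    [[p23,h1,m24],[h7,p23,m24],[h7,m24,p34],[m24,h7,p34],[m24,p34,h4],[p23,m24,h4]],
    [[p12,h3,p14],[h0,p12,p14],[h0,m24,p12],[m24,h0,p12],[m24,p12,h3],[p12,p14,h3]],
    [[e4,h6,p23],[e4,p23,h0],[p23,e4,h0],[p23,h0,h1],[h6,p23,h1],[h6,h7,p23]],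
    [[m24,e2,h0],[e4,m24,h0],[e4,h0,m24],[h0,h1,m24],[h0,m24,h4],[m24,h0,h4]],
    [[m24,h4,e2],[h1,m24,e2],[h1,e4,m24],[e4,h0,m24],[e4,m24,h0],[m24,e2,h0]],
    [[h0,m34,h1],[h0,h1,p12],[e4,h0,p12],[e4,p34,h0],[m34,e4,h0],[m34,h0,h1]],
    [[h7,m34,p23],[h7,p23,p24],[p23,h1,p24],[p23,p24,h1],[m34,p23,h1],[m34,h7,p23]],
    [[p34,h4,p23],[h7,p34,p23],[h7,p23,m24],[p23,h1,m24],[p23,m24,h4],[p34,p23,h4]],
    [[h6,p34,p23],[h6,p23,m24],[p23,h0,m24],[p23,m24,h0],[p34,p23,h0],[p34,h6,p23]],
    [[h6,m12,p23],[h6,p23,p13],[p23,h0,p13],[p23,p24,h0],[m34,p23,h0],[m34,h6,p23]],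
    [[p34,e3,h6],[e4,p34,h6],[e4,h6,p34],[h7,e4,p34],[h7,p34,e3],[p34,h4,e3]],
    [[p34,h6,h4],[h6,p34,h4],[h6,h7,p34],[e4,h6,p34],[e4,p34,h6],[p34,e3,h6]],
    [[h0,h4,p12],[e2,h0,p12],[e2,p34,h0],[p34,e2,h0],[p34,h0,h4],[h0,p12,h4]],
    [[p12,e1,h3],[e2,p12,h3],[e2,h0,p12],[h0,h4,p12],[h0,p12,h4],[p12,h3,h4]],
    [[p12,h4,e1],[h4,p12,e1],[h4,e2,p12],[e2,h0,p12],[e2,p12,h3],[p12,e1,h3]],
    [[p12,h2,p14],[h1,p12,p14],[h1,m24,p12],[m24,h4,p12],[m24,p12,h4],[p12,p14,h4]],
    [[p34,m23,e3],[p34,e3,p23],[e4,p34,p23],[e4,p23,m24],[e4,m24,p34],[p24,e4,p34],[p24,p34,e3]],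
    [[p34,p23,h0],[p23,m24,h0],[m24,p34,h0],[m24,h0,p12],[h0,m24,p12],[h0,p12,p14],[p34,h0,p14]],
    [[h0,h1,p14],[e4,h0,p14],[e4,p23,h0],[p23,e4,h0],[p23,h0,h1],[h0,p14,h1]],
    [[h0,p14,m24],[p23,h0,m24],[p23,m24,h0],[p34,p23,h0],[p34,h0,p14],[h0,p12,p14]],
    [[h0,p14,p13],[p23,h0,p13],[p23,p24,h0],[m34,p23,h0],[m34,h0,p14],[h0,m34,p14]],
    [[h0,p13,m34],[p24,h0,m34],[p24,m34,h0],[p23,p24,h0],[p23,h0,p13],[h0,p14,p13]],
    [[p14,e1,m24],[e4,p14,m24],[e4,p12,p14],[p12,e4,p14],[p12,p14,e1],[p14,m24,e1]],
    [[h6,m14,h7],[h6,h7,p23],[e4,h6,p23],[h7,e4,p23],[h7,p23,e4],[m14,h7,e4],[m14,e4,h6],[m14,h6,h7]],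
    [[m24,e2,e4,m24],[e4,m24,e4,m24],[m24,e4,m24,e4]], [[e4,m24,e4],[e2,e4,m24],[e2,p24,e4]],
    [[h0,h1,m24],[e4,h0,m24],[e4,m24,h0],[e2,p24,h0],[e2,h0,p13],[h0,h4,p13]],
    [[e4,p34,p23],[e4,p23,m24],[p23,e4,m24],[p23,e2,p24],[e3,p23,p24],[e3,m34,p23]],
    [[h6,h7,p34],[e4,h6,p34],[e4,p34,h6],[e3,m34,h6],[e3,h6,m12],[h6,h4,m12]],
    [[e3,m34,h6],[e4,p34,h6],[e4,h6,p34],[h7,e4,p34],[h7,e3,m34],[e3,h5,m34]],
    [[h0,h1,p12],[e4,h0,p12],[e4,p34,h0],[e3,m34,h0],[e3,h0,m34],[h0,h2,m34]],
    [[e4,h3,p34],[h2,e4,p34],[h2,m34,e4],[h1,p12,e4],[h1,e4,p12],[e4,h0,p12]],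
    [[h7,p23,m24],[h7,m24,p34],[m24,h7,p34],[m24,h4,m12],[h1,m24,m12],[h1,m14,m24]],
    [[h3,h2,p34],[e4,h3,p34],[e4,h0,p12],[h0,h1,p12],[h0,p12,h2],[h3,p34,h2]],
    [[h2,e3,m34],[h2,e4,p34],[e4,h3,p34],[e4,h0,p12],[h0,h1,p12],[h0,h2,m34]],
    [[e2,h3,p34],[e2,h0,p12],[h0,h4,p12],[h0,p12,h4],[h3,p34,h4],[h3,h7,p34]],
    [[h1,m14,p24],[h7,p23,p24],[h7,m34,p23],[m34,h7,p23],[m34,h1,m14],[h1,p12,m14]],
    [[h4,m12,p23],[h7,p34,p23],[h7,p23,m24],[h1,m14,m24],[h1,m24,m12],[h4,p13,m12]],
    [[m12,h1,m14],[m12,h7,p23],[h7,p34,p23],[h7,p23,m24],[h1,m14,m24],[h1,m12,m14]],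
    [[e3,h5,m34],[e3,m34,h6],[e4,p34,h6],[m34,e4,h6],[m34,h6,h7],[h5,m34,h7],[h5,h7,m34]],
    [[h1,m14,e4],[h7,p23,e4],[p23,h1,e4],[p23,e4,h0],[e4,p23,h0],[e4,h0,p14],[h1,e4,p14]],
    [[p34,e3,p23],[e4,p34,p23],[e4,p23,m24],[e4,m24,p34],[e2,p24,p34],[e2,p34,m23],[p34,e2,m23]],
    [[h4,m23,e3],[h4,e3,p23],[e3,h6,p23],[e3,p23,h0],[m23,e3,h0],[m23,h0,h2],[m23,h2,e3]],
    [[e2,h3,p34],[e2,h0,p12],[e2,p34,h0],[p34,e2,h0],[p34,h4,e2],[h7,p34,e2],[h7,e2,p34]],
    [[h4,e2,p12],[e2,h0,p12],[e2,p34,h0],[p34,e2,h0],[p34,h4,e2],[h7,p34,e2],[h4,m12,e2]],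
    [[h4,e1,m12],[e1,h3,m12],[h3,h4,m12],[h3,h7,p34],[e2,h3,p34],[e2,h0,p12],[h4,e2,p12]],
    [[h1,m14,p24],[h7,p23,p24],[p23,h1,p24],[p23,p24,h1],[p24,m34,h1],[p24,h1,p12],[h1,p24,p12]],
    [[h7,p24,m34],[h7,p23,p24],[p23,h1,p24],[p23,p24,h1],[p24,m34,h1],[p24,h1,p12],[p24,h2,m34]],
    [[h6,m24,p34],[h6,p23,m24],[p23,h0,m24],[p23,m24,h0],[m24,p34,h0],[m24,h0,p12],[m24,h3,p34]],
    [[p13,h2,m34],[p13,h1,p12],[h1,m24,p12],[h1,p12,p14],[h2,m34,p14],[h2,p14,p13],[h2,p13,m34]],
    [[e2,p24,h3],[e4,m24,h3],[e4,h6,m24],[h7,e4,m24],[h7,e2,p24],[e2,h3,p24]],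
    [[e4,h6,p23],[h7,e4,p23],[h7,p23,e4],[m14,h7,e4],[m14,e4,h6],[e4,p14,h6]],
    [[h2,m14,e4],[h2,e4,p14],[e4,h3,p14],[e4,p14,h3],[m14,e4,h3],[m14,h2,e4]],
    [[e2,m23,h0],[e3,p23,h0],[e3,h6,p23],[h4,e3,p23],[h4,e2,m23],[e2,h0,m23]],
    [[h6,h1,m24],[h6,m24,h4],[m24,h3,h4],[m24,e1,h3],[e1,m24,h3],[e1,h6,m24]],
    [[h1,e1,m24],[h1,m24,e1],[m24,h4,e1],[m24,e1,h3],[e1,m24,h3],[e1,h6,m24]],
    [[e3,p24,h0],[e3,h0,p13],[h0,h2,p13],[h0,p13,h2],[p24,h0,h2],[p24,e3,h0]],
    [[h2,m13,e3],[h2,e3,p13],[h0,h2,p13],[h0,p13,h2],[p24,h0,h2],[p24,h2,e3]],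
    [[e1,h3,m12],[h4,e1,m12],[h4,e2,p12],[e2,h0,p12],[e2,p12,h3],[e1,m12,h3]],
    [[e4,m24,h3],[p24,e4,h3],[p24,h3,h2],[h3,p24,h2],[h3,h2,m13],[e4,h3,m13]],
    [[e4,p14,h6],[e4,h6,p23],[h6,h7,p23],[h6,h1,m14],[e1,h6,m14],[e1,m14,h6]],
    [[e3,p14,h6],[e3,h6,p23],[h6,h4,p23],[h6,p23,h4],[p14,h6,h4],[p14,e3,h6]],
    [[h0,h2,p14],[e3,h0,p14],[e3,p23,h0],[m23,e3,h0],[m23,h0,h2],[h0,m23,h2]],
    [[e1,m34,h6],[e1,h6,m12],[h6,h1,m12],[h6,m12,h1],[m34,h6,h1],[m34,e1,h6]],
    [[p14,h6,p13],[h6,p23,p13],[h6,m12,p23],[m34,h6,p23],[m34,p14,h6],[p14,p13,h6]],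
    [[h0,p12,m23],[p34,h0,m23],[p34,m23,h0],[p24,p34,h0],[p24,h0,p12],[h0,p13,p12]],
    [[h3,h2,m13],[e4,h3,m13],[e4,m24,h3],[m24,e2,h3],[m24,h3,h7],[h3,m13,h7]],
    [[h2,e4,m13],[e4,h3,m13],[e4,m24,h3],[p24,e4,h3],[p24,h2,e4],[h2,m13,e4]],
    [[h3,m23,h2],[h3,h2,p14],[e4,h3,p14],[e4,p14,h3],[m14,e4,h3],[m14,h3,h2]],
    [[h4,m13,e3],[h4,e3,p13],[e3,h6,p13],[e3,p13,h6],[m13,e3,h6],[m13,h4,e3]],
    [[h2,m13,p34],[p24,h2,p34],[p24,p34,h2],[p34,m23,h2],[p34,h2,p14],[h2,p34,p14]],
    [[e4,h3,m13],[h2,e4,m13],[h2,m13,e4],[m13,h7,e4],[m13,e4,h6],[e4,m13,h6]],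
    [[m34,m14,e4],[m34,e4,p14],[e4,p34,p14],[e4,m13,p34],[m13,e4,p34],[m13,m34,e4]],
    [[h3,m13,m12],[m24,h3,m12],[m24,m12,h3],[m14,m24,h3],[m14,h3,m13],[h3,m23,m13]],
    [[h3,m23,m13],[m14,h3,m13],[m14,m24,h3],[m12,m14,h3],[m12,h3,m23],[h3,m12,m23]],
    [[m13,e3,h6],[m13,h6,h4],[h3,m13,h4],[h3,h4,m13],[e1,h3,m13],[e1,m13,h6]],
    [[e3,m12,p23],[e3,p23,p13],[m23,e3,p13],[m23,m13,e3],[m12,m23,e3],[m12,e3,p23]],
    [[h2,m13,p34],[m13,h7,p34],[m13,m12,h7],[m23,m13,h7],[m23,h2,m13],[h2,p14,m13]],
    [[m13,m34,h6],[m13,h6,m12],[h3,m13,m12],[h3,m23,m13],[m14,h3,m13],[m14,m13,h6]],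
    [[m13,h5,m34],[m13,m34,h6],[m34,m14,h6],[m34,h6,m14],[h5,m34,m14],[h5,m13,m34]],
    [[h5,h2,m13],[h5,m13,h7],[m13,h5,h7],[m13,e3,h5],[e1,m13,h5],[e1,h5,m13]],
    [[h2,e1,m13],[h2,m13,e3],[m13,h7,e3],[m13,e3,h5],[e1,m13,h5],[e1,h5,m13]],
    [[p23,e2,p13],[e3,p23,p13],[e3,m12,p23],[m12,e3,p23],[m12,p23,e2],[p23,p13,e2]],
    [[e2,m23,p13],[e3,p23,p13],[e3,m12,p23],[m12,e3,p23],[m12,e2,m23],[e2,p12,m23]],
    [[m23,e1,m13],[m23,m13,e3],[m13,m12,e3],[m13,e3,m12],[e1,m13,m12],[e1,m23,m13]],
    [[p24,p34,h2],[p24,h2,p34],[h2,m13,p34],[h2,p14,m13],[m23,h2,m13],[m23,p24,h2]],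
    [[m14,h3,m13],[m14,m13,h6],[m13,m34,h6],[m13,h5,m34],[h5,m13,m34],[h5,m14,m13]],
    [[e1,h3,m23],[h4,e1,m23],[h4,m23,e1],[m23,h2,e1],[m23,e1,h5],[e1,m23,h5]],
    [[h7,m23,p24],[h7,p24,p34],[p24,h2,p34],[p24,p34,h2],[m23,p24,h2],[m23,h7,p24]],
    [[h6,m12,m14],[h6,m14,m24],[m14,h6,m24],[m14,m24,h3],[m12,m14,h3],[m12,h5,m14]],
    [[h5,p24,p12],[h5,m14,p24],[m14,h3,p24],[m14,p24,h3],[p24,p12,h3],[p24,h0,p12]],
    [[h5,p12,m14],[h5,m14,p24],[m14,h3,p24],[m14,p24,h3],[p12,m14,h3],[p12,h5,m14]],
    [[h1,e2,p24],[h1,e4,m24],[e4,h0,m24],[e4,m24,h0],[e2,p24,h0],[e2,h5,p24]],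
    [[e3,h5,p23],[h7,e3,p23],[h7,m23,e3],[m23,h7,e3],[m23,e3,h5],[e3,p23,h5]],
    [[m14,e2,h3],[m14,h3,h7],[h3,m23,h7],[h3,h7,m23],[e2,h3,m23],[e2,m14,h3]],
    [[e2,h5,p12],[e2,p12,h5],[p12,e1,h5],[p12,h5,h2],[h5,p12,h2],[h5,h1,p12]],
    [[h0,p13,p12],[h0,p12,m23],[p12,h3,m23],[p12,m23,h5],[p13,p12,h5],[p13,h5,p12]],
    [[e3,p13,h5],[e3,h0,p13],[h0,h2,p13],[h0,p13,h2],[p13,h5,h2],[p13,e1,h5]],
    [[e1,m13],[m13,e3],[e3,p13]], [[h7,p24],[p24,h2],[h2,m13]], [[h6,m24],[m24,h3],[h3,m13]],
    [[h0,p14],[p23,h0],[h6,p23]], [[h5,m34],[m34,h6],[h6,m12]], [[h5,p24],[p24,h0],[h0,p13]],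
    [[h5,m14],[m14,h3],[h3,m23]], [[h4,m23],[m23,h2],[h2,p14]]]"

definition base_equations :: "(root list \<times> root list) list" where
  "base_equations = map def_equation lift_defs @ vertex_equations"

definition lift_equations :: "(root list \<times> root list) list" where
  "lift_equations = map (\<lambda>c. strip (hd c) (last c)) lift_chains @ base_equations"

lemma lift_chains_ok: "chains_ok base_equations lift_chains"
  by code_simp

subsection \<open>The list of all reduced decompositions\<close>

text \<open>
  An entry \<open>(b, X)\<close> for \<open>a\<close> says that \<open>a b\<close> is an element below \<open>w\<close> with chosen factorization \<open>X\<close>. Two
  pairs with the same \<open>X\<close> have the same product in every group that satisfies the lifted relations.
\<close>

primrec canonical_pairs :: "root \<Rightarrow> (root \<times> root list) list" where
  "canonical_pairs e4 = [(h6,[e4,h6]), (h3,[e4,h3]), (h0,[e4,h0]), (p34,[e4,p34]), (m24,[e4,m24]), (p23,[e4,p23]),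
      (m13,[e4,m13]), (p14,[e4,p14]), (p12,[e4,p12])]"
| "canonical_pairs e3 = [(h6,[e3,h6]), (h5,[e3,h5]), (h0,[h0,h2]), (m34,[e4,p34]), (p24,[e3,p24]), (p23,[e3,p23]),
      (m12,[e3,m12]), (p14,[e3,p14]), (p13,[e3,p13])]"
| "canonical_pairs e2 = [(h5,[e2,h5]), (h3,[e2,h3]), (h0,[e2,h0]), (p34,[e2,p34]), (m23,[e3,p23]), (p24,[e4,m24]),
      (m14,[e2,m14]), (p13,[e2,p13]), (p12,[e2,p12])]"
| "canonical_pairs h7 = [(e4,[e4,h6]), (e3,[e3,h5]), (e2,[e2,h3]), (m34,[h7,m34]), (p34,[h7,p34]), (m23,[h7,m23]),
      (m24,[h7,m24]), (p24,[h2,m13]), (p23,[h7,p23])]"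
| "canonical_pairs h6 = [(h7,[e4,h6]), (h4,[e3,h6]), (h1,[e1,h6]), (p34,[h6,p34]), (m24,[h3,m13]), (p23,[h6,p23]),
      (m12,[h6,m12]), (m14,[h6,m14]), (p13,[h6,p13])]"
| "canonical_pairs h5 = [(h7,[e3,h5]), (h2,[e1,h5]), (h1,[e2,h5]), (m34,[h6,m12]), (p24,[h0,p13]), (p23,[h5,p23]),
      (m13,[h5,m13]), (m14,[h3,m23]), (p12,[h5,p12])]"
| "canonical_pairs h4 = [(e3,[e3,h6]), (e2,[e2,h0]), (e1,[e1,h3]), (m23,[h2,p14]), (p23,[h4,p23]), (m12,[h7,p34]),
      (m13,[h4,m13]), (p13,[h1,m24]), (p12,[h4,p12])]"
| "canonical_pairs e1 = [(h6,[e1,h6]), (h5,[e1,h5]), (h3,[e1,h3]), (m34,[e1,m34]), (m23,[e1,m23]), (m24,[e1,m24]),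
      (m12,[e2,p12]), (m13,[e3,p13]), (m14,[e4,p14])]"
| "canonical_pairs h3 = [(h7,[e2,h3]), (h4,[e1,h3]), (h2,[e4,h3]), (p34,[h0,p12]), (m23,[h3,m23]), (p24,[h3,p24]),
      (m12,[h3,m12]), (m13,[h3,m13]), (p14,[h3,p14])]"
| "canonical_pairs h2 = [(e4,[e4,h3]), (e3,[h0,h2]), (e1,[e1,h5]), (m34,[h1,p12]), (p34,[h2,p34]), (m13,[h2,m13]),
      (m14,[h2,m14]), (p14,[h2,p14]), (p13,[h2,p13])]"
| "canonical_pairs h1 = [(e4,[e4,h0]), (e2,[e2,h5]), (e1,[e1,h6]), (m24,[h1,m24]), (p24,[h1,p24]), (m12,[h1,m12]),
      (m14,[h7,p23]), (p14,[h1,p14]), (p12,[h1,p12])]"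
| "canonical_pairs h0 = [(h4,[e2,h0]), (h2,[h0,h2]), (h1,[e4,h0]), (m34,[h0,m34]), (m23,[h0,m23]), (m24,[h0,m24]),
      (p14,[h6,p23]), (p13,[h0,p13]), (p12,[h0,p12])]"
| "canonical_pairs m34 = [(e4,[e4,p34]), (h7,[h7,m34]), (h6,[h6,m12]), (e1,[e1,m34]), (h1,[h1,p12]), (h0,[h0,m34]),
      (p23,[p23,p24]), (m14,[m13,m34]), (p14,[p14,p13])]"
| "canonical_pairs p34 = [(e3,[e4,p34]), (e2,[e2,p34]), (h6,[h6,p34]), (h4,[h7,p34]), (h2,[h2,p34]), (h0,[h0,p12]),
      (m23,[p24,p34]), (p23,[p23,m24]), (p14,[m13,p34])]"
| "canonical_pairs m23 = [(e3,[e3,p23]), (h7,[h7,m23]), (h5,[h3,m23]), (e1,[e1,m23]), (h2,[h2,p14]), (h0,[h0,m23]),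
      (p24,[p24,p34]), (m13,[m23,m13]), (p13,[p12,m23])]"
| "canonical_pairs m24 = [(e2,[e4,m24]), (h7,[h7,m24]), (h4,[h1,m24]), (e1,[e1,m24]), (h3,[h3,m13]), (h0,[h0,m24]),
      (p34,[p23,m24]), (m12,[m14,m24]), (p12,[p12,p14])]"
| "canonical_pairs p24 = [(e4,[e4,m24]), (e3,[e3,p24]), (h3,[h3,p24]), (h2,[h2,m13]), (h1,[h1,p24]), (h0,[h0,p13]),
      (m34,[p23,p24]), (p34,[p24,p34]), (p12,[m14,p24])]"
| "canonical_pairs p23 = [(e4,[e4,p23]), (e2,[e3,p23]), (h5,[h5,p23]), (h4,[h4,p23]), (h1,[h7,p23]), (h0,[h6,p23]),
      (m24,[p23,m24]), (p24,[p23,p24]), (p13,[m12,p23])]"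
| "canonical_pairs m12 = [(e3,[e3,m12]), (e2,[e2,p12]), (h7,[h7,p34]), (h5,[h6,m12]), (h3,[h3,m12]), (h1,[h1,m12]),
      (m23,[m23,m13]), (p23,[m12,p23]), (m14,[m14,m24])]"
| "canonical_pairs m13 = [(e4,[e4,m13]), (e3,[e3,p13]), (h7,[h2,m13]), (h6,[h3,m13]), (h5,[h5,m13]), (h4,[h4,m13]),
      (m34,[m13,m34]), (p34,[m13,p34]), (m12,[m23,m13])]"
| "canonical_pairs m14 = [(e4,[e4,p14]), (e2,[e2,m14]), (h7,[h7,p23]), (h6,[h6,m14]), (h3,[h3,m23]), (h2,[h2,m14]),
      (m24,[m14,m24]), (p24,[m14,p24]), (m13,[m13,m34])]"
| "canonical_pairs p14 = [(e3,[e3,p14]), (h6,[h6,p23]), (h4,[h2,p14]), (e1,[e4,p14]), (h3,[h3,p14]), (h1,[h1,p14]),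
      (m24,[p12,p14]), (m13,[m13,p34]), (p13,[p14,p13])]"
| "canonical_pairs p13 = [(e2,[e2,p13]), (h6,[h6,p13]), (h5,[h0,p13]), (e1,[e3,p13]), (h2,[h2,p13]), (h1,[h1,m24]),
      (m34,[p14,p13]), (m12,[m12,p23]), (p12,[p12,m23])]"
| "canonical_pairs p12 = [(e4,[e4,p12]), (h5,[h5,p12]), (h4,[h4,p12]), (e1,[e2,p12]), (h3,[h0,p12]), (h2,[h1,p12]),
      (m23,[p12,m23]), (m14,[m14,p24]), (p14,[p12,p14])]"

fun canon :: "root \<Rightarrow> root \<Rightarrow> root list option" where
  "canon a b = map_of (canonical_pairs a) b"

fun normal_word :: "root list \<Rightarrow> root list option" where
  "normal_word [a, b, c, d] =
    (case canon a b of None \<Rightarrow> None | Some X \<Rightarrow>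
     (case canon c d of None \<Rightarrow> None | Some Y \<Rightarrow> Some (X @ Y)))"
| "normal_word u = None"

text \<open>
  Choosing the factorizations of the first and of the last two factors brings every reduced decomposition
  to one of \<open>78\<close> normal words \<open>n\<close>. The words \<open>u\<close> and \<open>v\<close> differ by a move on the two middle factors; \<open>u\<close> has
  normal word \<open>n\<close>, and the normal word of \<open>v\<close> occurs later in the list, until \<open>w0\<close> is reached.
\<close>

definition links :: "(root list \<times> root list \<times> root list) list" where
  "links = [
    ([e1,m23,h5,m13],[e1,m23,m13,h5],[e1,m12,m23,h5]),
    ([h5,p12,h2,m14],[h5,p12,h2,m14],[h5,h1,p12,m14]),
    ([h2,p13,e1,m34],[p13,h2,m34,e1],[p13,h1,p12,e1]),
    ([e2,p13,h5,p12],[p13,e2,h5,p12],[p13,h1,e2,p12]),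
    ([h4,p12,e1,m23],[h4,p12,m23,e1],[h4,p13,p12,e1]),
    ([h5,m13,h7,m34],[h5,m13,m34,h7],[h5,m34,m14,h7]),
    ([h6,p13,h1,m12],[h6,p13,m12,h1],[h6,m12,p23,h1]),
    ([h3,m12,h7,m23],[h3,m12,h7,m23],[h3,h7,p34,m23]),
    ([h4,m13,e3,m12],[m13,h4,m12,e3],[m13,h7,p34,e3]),
    ([h2,p34,e3,p14],[h2,p34,p14,e3],[h2,m13,p34,e3]),
    ([h2,p14,e3,p13],[p14,h4,e1,m13],[p14,e1,h3,m13]),
    ([h3,p14,h4,m13],[p14,h3,h4,m13],[p14,e1,h3,m13]),
    ([h2,m14,e4,m13],[m14,h2,e4,m13],[m14,e4,h3,m13]),
    ([e3,p13,h6,m12],[e1,m13,m34,h6],[e1,m14,m13,h6]),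
    ([e1,h5,m13,m34],[e1,h5,m14,m13],[e1,m14,h3,m13]),
    ([e1,h3,m23,m13],[e1,h3,m23,m13],[e1,m14,h3,m13]),
    ([p12,m23,e1,h5],[m23,p13,e1,h5],[m23,e3,p13,h5]),
    ([m23,m13,e3,h5],[m23,m13,e3,h5],[m23,e3,p13,h5]),
    ([h0,m23,h2,p13],[m23,h0,h2,p13],[m23,e3,h0,p13]),
    ([h3,m23,h2,m13],[m23,h5,h7,p24],[m23,e3,h5,p24]),
    ([h7,m23,e3,p24],[m23,h7,e3,p24],[m23,e3,h5,p24]),
    ([e2,p12,h3,m23],[e2,p12,m23,h5],[e2,m23,p13,h5]),
    ([e3,m12,h5,p23],[e3,m12,p23,h5],[e3,p23,p13,h5]),
    ([h5,p23,h1,p24],[p23,h5,p24,h1],[p23,p24,h0,h1]),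
    ([h4,p23,e2,p13],[p23,h4,p13,e2],[p23,h1,m24,e2]),
    ([h1,m12,e2,m14],[h1,m12,m14,e2],[h1,m14,m24,e2]),
    ([m12,p23,e2,h5],[p23,p13,h5,h1],[p23,h0,p13,h1]),
    ([m14,p24,e4,h3],[p24,p12,e4,h3],[p24,e4,p12,h3]),
    ([e3,p24,h0,m34],[p24,e3,m34,h0],[p24,e4,p34,h0]),
    ([h3,p24,h2,p34],[p24,h3,h2,p34],[p24,e4,h3,p34]),
    ([e1,m24,h3,m12],[m24,e1,m12,h3],[m24,e2,p12,h3]),
    ([m14,m24,e2,h3],[m24,m12,e2,h3],[m24,e2,p12,h3]),
    ([p12,p14,e1,h3],[m24,p12,e1,h3],[m24,e2,p12,h3]),
    ([e2,m14,h3,p24],[e2,m14,p24,h3],[e2,p24,p12,h3]),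
    ([m13,p34,e3,h6],[p34,p14,e3,h6],[p34,e3,p14,h6]),
    ([e2,p34,h0,m23],[p34,e2,m23,h0],[p34,e3,p23,h0]),
    ([p24,p34,h0,h2],[p34,m23,e3,h0],[p34,e3,p23,h0]),
    ([e1,m34,h6,m14],[m34,e1,m14,h6],[m34,e4,p14,h6]),
    ([m13,m34,e4,h6],[m34,m14,e4,h6],[m34,e4,p14,h6]),
    ([p14,p13,e1,h6],[m34,p14,e1,h6],[m34,e4,p14,h6]),
    ([e3,p14,h6,p13],[e3,p14,p13,h6],[e3,m34,p14,h6]),
    ([e4,m13,h6,p34],[e4,m13,p34,h6],[e4,p34,p14,h6]),
    ([h0,h2,p14,p13],[h0,h2,m34,p14],[h0,h1,p12,p14]),
    ([h0,m34,h1,p14],[h0,m34,h1,p14],[h0,h1,p12,p14]),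
    ([h0,p12,h2,p14],[h0,p12,h2,p14],[h0,h1,p12,p14]),
    ([e2,h0,p12,m23],[h0,h4,p13,p12],[h0,h1,m24,p12]),
    ([h0,m24,h4,p12],[h0,m24,h4,p12],[h0,h1,m24,p12]),
    ([h0,p13,h1,p12],[h0,p13,h1,p12],[h0,h1,m24,p12]),
    ([h1,p12,e4,p14],[h1,p12,e4,p14],[h1,e4,p12,p14]),
    ([h1,p14,e1,m24],[h1,p14,e1,m24],[h1,e4,p14,m24]),
    ([e2,h5,m14,p24],[h1,e2,p24,p12],[h1,e4,m24,p12]),
    ([h1,p24,e4,p12],[h1,p24,e4,p12],[h1,e4,m24,p12]),
    ([h1,m24,e2,p12],[h1,m24,e2,p12],[h1,e4,m24,p12]),
    ([e4,h3,m13,p34],[e4,h3,p34,p14],[e4,h0,p12,p14]),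
    ([e4,p12,h3,p14],[e4,p12,h3,p14],[e4,h0,p12,p14]),
    ([e1,h6,m14,m24],[h6,h1,m14,m24],[h6,h7,p23,m24]),
    ([h6,m14,h7,m24],[h6,m14,h7,m24],[h6,h7,p23,m24]),
    ([h3,m13,h7,p34],[h6,m24,h7,p34],[h6,h7,m24,p34]),
    ([e3,h6,m12,p23],[h6,h4,m12,p23],[h6,h7,p34,p23]),
    ([h6,m12,h7,p23],[h6,m12,h7,p23],[h6,h7,p34,p23]),
    ([h6,p34,h4,p23],[h6,p34,h4,p23],[h6,h7,p34,p23]),
    ([e2,h3,p24,p34],[h7,e2,p24,p34],[h7,e4,m24,p34]),
    ([h2,m13,e4,p34],[h7,p24,e4,p34],[h7,e4,m24,p34]),
    ([h7,m24,e2,p34],[h7,m24,e2,p34],[h7,e4,m24,p34]),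
    ([e3,h5,p23,p24],[h7,e3,m34,p23],[h7,e4,p34,p23]),
    ([h7,m34,e4,p23],[h7,m34,e4,p23],[h7,e4,p34,p23]),
    ([h7,p34,e3,p23],[h7,p34,e3,p23],[h7,e4,p34,p23]),
    ([e4,p14,h3,m13],[e4,p14,h6,m24],[e4,h6,p23,m24]),
    ([e3,p23,h0,p13],[p23,e2,p24,h0],[p23,e4,m24,h0]),
    ([p23,p24,e4,h0],[p23,p24,e4,h0],[p23,e4,m24,h0]),
    ([p23,m24,e2,h0],[p23,m24,e2,h0],[p23,e4,m24,h0]),
    ([h7,p23,e4,m24],[p23,h1,e4,m24],[p23,e4,h0,m24]),
    ([h6,p23,h1,m24],[p23,h0,h1,m24],[p23,e4,h0,m24]),
    ([e4,m24,h0,p12],[e4,m24,p34,h0],[e4,p23,m24,h0]),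
    ([e4,p34,h6,p23],[e4,p34,p23,h0],[e4,p23,m24,h0]),
    ([e4,h0,p12,p14],[e4,h0,p14,m24],[e4,p23,h0,m24]),
    ([e4,h6,p23,m24],[e4,h6,p23,m24],[e4,p23,h0,m24]),
    ([e4,p23,h0,m24],[e4,p23,h0,m24],[e4,p23,h0,m24])]"

fun middle_move :: "root list \<Rightarrow> root list \<Rightarrow> bool" where
  "middle_move [a, b, c, d] [a', b', c', d'] \<longleftrightarrow>
    a = a' \<and> d = d' \<and> canon b c = canon b' c' \<and> canon b c \<noteq> None"
| "middle_move u v \<longleftrightarrow> False"

fun linked :: "root list \<Rightarrow> (root list \<times> root list \<times> root list) list \<Rightarrow> bool" where
  "linked n [] \<longleftrightarrow> False"
| "linked n ((m, u, v) # ls) \<longleftrightarrow> (if n = m then True else linked n ls)"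

fun reaches :: "root list option \<Rightarrow> (root list \<times> root list \<times> root list) list \<Rightarrow> bool" where
  "reaches None ls \<longleftrightarrow> False"
| "reaches (Some n) ls \<longleftrightarrow> linked n ls"

fun links_ok :: "(root list \<times> root list \<times> root list) list \<Rightarrow> bool" where
  "links_ok [] \<longleftrightarrow> True"
| "links_ok ((n, u, v) # ls) \<longleftrightarrow>
    normal_word u = Some n \<and> middle_move u v \<and>
    (if v = w0 then True else reaches (normal_word v) ls) \<and> links_ok ls"

fun listed :: "root list \<Rightarrow> bool" where
  "listed [a, b, c, d] \<longleftrightarrow> reaches (normal_word [a, b, c, d]) links"
| "listed u \<longleftrightarrow> False"

fun canon_ok :: "(root list \<times> root list) list \<Rightarrow> root \<Rightarrow> (root \<times> root list) list \<Rightarrow> bool" where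
  "canon_ok E a [] \<longleftrightarrow> True"
| "canon_ok E a ((b, X) # xs) \<longleftrightarrow> step_ok E ([a, b], X) \<and> canon_ok E a xs"

lemma canonical_pairs_ok: "list_all (\<lambda>a. canon_ok lift_equations a (canonical_pairs a)) roots"
  by code_simp

lemma links_ok: "links_ok links"
  by code_simp

text \<open>
  A quick necessary condition for a matrix to be a reflection: it is symmetric and has trace \<open>2 = -1\<close>. Few
  matrices pass it, so that the comparison with the \<open>24\<close> reflections is rarely made.
\<close>

fun candidate :: "vec list \<Rightarrow> bool" where
  "candidate [(a1, a2, a3, a4), (b1, b2, b3, b4), (c1, c2, c3, c4), (d1, d2, d3, d4)] \<longleftrightarrow>
    a2 = b1 \<and> a3 = c1 \<and> a4 = d1 \<and> b3 = c2 \<and> b4 = d2 \<and> c4 = d3 \<and> a1 + b2 + c3 + d4 = Neg"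
| "candidate ks \<longleftrightarrow> False"

text \<open>
  The search for all reduced decompositions \<open>a b c d\<close>: three roots are chosen in all ways, the matrix of
  \<open>c b a w\<close> is updated after each choice, and \<open>d\<close> has to be the remaining reflection. The recursion is
  spelled out so that rewriting works on concrete matrices.
\<close>

fun check_d :: "root list \<Rightarrow> vec list \<Rightarrow> root list \<Rightarrow> bool" where
  "check_d u ks [] \<longleftrightarrow> True"
| "check_d u ks (d # ds) \<longleftrightarrow> (if ks = key [d] then listed (u @ [d]) else check_d u ks ds)"

fun check_candidate :: "root list \<Rightarrow> vec list \<Rightarrow> bool" where
  "check_candidate u [] \<longleftrightarrow> False"
| "check_candidate u (k # ks) \<longleftrightarrow> (if candidate (k # ks) then check_d u (k # ks) roots else True)"

fun check_c :: "root list \<Rightarrow> vec list \<Rightarrow> root list \<Rightarrow> bool" where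
  "check_c u ks [] \<longleftrightarrow> True"
| "check_c u ks (c # cs) \<longleftrightarrow>
    check_candidate (u @ [c]) (map (reflect (vec c)) ks) \<and> check_c u ks cs"

fun check_b :: "root \<Rightarrow> vec list \<Rightarrow> root list \<Rightarrow> bool" where
  "check_b a ks [] \<longleftrightarrow> True"
| "check_b a ks (b # bs) \<longleftrightarrow>
    check_c [a, b] (map (reflect (vec b)) ks) roots \<and> check_b a ks bs"

fun check_a :: "root list \<Rightarrow> bool" where
  "check_a [] \<longleftrightarrow> True"
| "check_a (a # as) \<longleftrightarrow> check_b a (map (reflect (vec a)) (key w0)) roots \<and> check_a as"

lemma check_short: "check_a short_roots" by code_simp

lemma check_long: "check_a long_roots" by code_simp

lemma candidate_root: "candidate (key [d])"
proof -
  have "list_all (\<lambda>d. candidate (key [d])) roots" by code_simp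
  then show ?thesis by (simp add: list_all_iff)
qed

lemma check_d_sound:
  "check_d u ks ds \<Longrightarrow> d \<in> set ds \<Longrightarrow> ks = key [d] \<Longrightarrow> \<exists>d'. key [d'] = key [d] \<and> listed (u @ [d'])"
  by (induction u ks ds rule: check_d.induct) (auto split: if_splits simp del: listed.simps key.simps)

lemma check_candidate_sound:
  assumes "check_candidate u ks" "ks = key [d]"
  shows "listed (u @ [d])"
proof -
  obtain k ks' where k: "ks = k # ks'" using assms(1) by (cases ks) auto
  have "candidate (k # ks')" using candidate_root[of d] assms(2) k by metis
  then have "check_d u ks roots" using assms(1) unfolding k by simp
  then obtain d' where "key [d'] = key [d]" "listed (u @ [d'])"
    using check_d_sound[of u ks roots d] assms(2) in_roots by blast
  then show ?thesis using act_root_inj[of d' d] unfolding act_eq_iff by simp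
qed

lemma check_sound:
  "check_c u ks cs \<Longrightarrow> c \<in> set cs \<Longrightarrow> check_candidate (u @ [c]) (map (reflect (vec c)) ks)"
  "check_b a ks bs \<Longrightarrow> b \<in> set bs \<Longrightarrow> check_c [a, b] (map (reflect (vec b)) ks) roots"
  "check_a as \<Longrightarrow> a \<in> set as \<Longrightarrow> check_b a (map (reflect (vec a)) (key w0)) roots"
  by (induction cs, auto) (induction bs, auto, induction as, auto)

lemma reduced_words_listed:
  assumes "act [a, b, c, d] = act w0"
  shows "listed [a, b, c, d]"
proof -
  have "check_b a (map (reflect (vec a)) (key w0)) roots"
    using check_sound(3)[OF check_short, of a] check_sound(3)[OF check_long, of a] short_or_long[of a]
    by blast
  from check_sound(2)[OF this in_roots] have "check_c [a, b] (key ([b, a] @ w0)) roots"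
    by simp
  from check_sound(1)[OF this in_roots] have "check_candidate ([a, b] @ [c]) (key ([c, b, a] @ w0))"
    by simp
  moreover have "act ([c, b, a] @ w0) = act [d]"
  proof
    fix v
    have "act ([c, b, a] @ w0) v = act [c, b, a] (act (rev [c, b, a]) (act [d] v))"
      using fun_cong[OF assms, of v] by simp
    then show "act ([c, b, a] @ w0) v = act [d] v" by (simp only: act_rev)
  qed
  then have "key ([c, b, a] @ w0) = key [d]" by (simp only: act_eq_iff)
  ultimately show ?thesis using check_candidate_sound by fastforce
qed

context group
begin

lemma holds_canon:
  assumes E: "\<forall>e\<in>set lift_equations. holds G f e" and X: "canon a b = Some X"
  shows "holds G f ([a, b], X)"
proof -
  have "canon_ok lift_equations a xs \<Longrightarrow> (b, X) \<in> set xs \<Longrightarrow> holds G f ([a, b], X)" for xs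
    by (induction lift_equations a xs rule: canon_ok.induct) (auto simp del: step_ok.simps intro: holds_step[OF E])
  moreover have "canon_ok lift_equations a (canonical_pairs a)"
    using canonical_pairs_ok in_roots by (simp add: list_all_iff)
  moreover have "(b, X) \<in> set (canonical_pairs a)" using X by (auto dest: map_of_SomeD)
  ultimately show ?thesis by blast
qed

lemma holds_normal_word:
  assumes f: "range f \<subseteq> carrier G" and E: "\<forall>e\<in>set lift_equations. holds G f e"
    and n: "normal_word u = Some n"
  shows "holds G f (u, n)"
proof -
  have fc: "f x \<in> carrier G" for x using f by auto
  obtain a b c d X Y where u: "u = [a, b, c, d]" "canon a b = Some X" "canon c d = Some Y" "n = X @ Y"
    using n by (cases u rule: normal_word.cases) (auto split: option.splits)
  have "f a \<otimes> f b = list_prod G (map f X)" "f c \<otimes> f d = list_prod G (map f Y)"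
    using holds_canon[OF E u(2)] holds_canon[OF E u(3)] fc by (simp_all add: holds_def)
  then have "list_prod G (map f n) = (f a \<otimes> f b) \<otimes> (f c \<otimes> f d)"
    using fc by (simp add: u(4) list_prod_append image_subset_iff)
  then show ?thesis using fc by (simp add: holds_def u(1) m_assoc)
qed

lemma holds_middle_move:
  assumes f: "range f \<subseteq> carrier G" and E: "\<forall>e\<in>set lift_equations. holds G f e"
    and m: "middle_move u v"
  shows "holds G f (u, v)"
proof -
  have fc: "f x \<in> carrier G" for x using f by auto
  obtain a b c d b' c' where uv': "u = [a, b, c, d]" "v = [a, b', c', d]"
      "canon b c = canon b' c'" "canon b c \<noteq> None"
    using m by (cases "(u, v)" rule: middle_move.cases) (auto simp del: canon.simps dest!: HOL.sym[of "Some _"])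
  then obtain X where "canon b c = Some X" by (cases "canon b c") auto
  with uv' have uv: "u = [a, b, c, d]" "v = [a, b', c', d]" "canon b c = Some X" "canon b' c' = Some X"
    by simp_all
  have "f b \<otimes> f c = f b' \<otimes> f c'"
    using holds_canon[OF E uv(3)] holds_canon[OF E uv(4)] fc by (simp add: holds_def)
  then have "f a \<otimes> (f b \<otimes> f c) \<otimes> f d = f a \<otimes> (f b' \<otimes> f c') \<otimes> f d" by simp
  then show ?thesis using fc by (simp add: holds_def uv m_assoc)
qed

lemma holds_linked:
  assumes f: "range f \<subseteq> carrier G" and E: "\<forall>e\<in>set lift_equations. holds G f e"
  shows "links_ok ls \<Longrightarrow> linked n ls \<Longrightarrow> holds G f (n, w0)"
proof (induction ls arbitrary: n)
  case (Cons l ls)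
  obtain m u v where l: "l = (m, u, v)" by (cases l)
  have ok: "normal_word u = Some m" "middle_move u v" "v = w0 \<or> reaches (normal_word v) ls" "links_ok ls"
    using Cons.prems(1) by (auto simp: l split: if_splits)
  have "holds G f (v, w0)"
  proof (cases "v = w0")
    case False
    then obtain k where k: "normal_word v = Some k" "linked k ls"
      using ok(3) by (cases "normal_word v") auto
    then show ?thesis using Cons.IH[OF ok(4) k(2)] holds_normal_word[OF f E k(1)] by (simp add: holds_def)
  qed (simp add: holds_def)
  then have "holds G f (m, w0)"
    using holds_middle_move[OF f E ok(2)] holds_normal_word[OF f E ok(1)] by (simp add: holds_def)
  then show ?case using Cons.IH[OF ok(4)] Cons.prems(2) by (auto simp: l split: if_splits)
qed simp

text \<open>
  Normal words and links connect every reduced decomposition with \<open>w0\<close> by relations that the lifts satisfy.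
\<close>

theorem reduced_words_equal:
  assumes f: "range f \<subseteq> carrier G" and E: "\<forall>e\<in>set base_equations. holds G f e"
    and "length us = 4" "act us = act w0"
  shows "list_prod G (map f us) = list_prod G (map f w0)"
proof -
  obtain a b c d where us: "us = [a, b, c, d]" using assms(3) by (auto simp: numeral_eq_Suc length_Suc_conv)
  have "listed us" using reduced_words_listed assms(4) us by simp
  then obtain n where n: "normal_word us = Some n" "linked n links"
    by (cases "normal_word us") (simp_all add: us del: normal_word.simps)
  have E': "\<forall>e\<in>set lift_equations. holds G f e"
    using E holds_chains[OF f E lift_chains_ok] by (auto simp: lift_equations_def holds_strip[OF f])
  have "holds G f (us, w0)"
    using holds_linked[OF f E' links_ok n(2)] holds_normal_word[OF f E' n(1)] by (simp add: holds_def)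
  then show ?thesis by (simp add: holds_def)
qed

end

section \<open>The presentation of the interval group\<close>

subsection \<open>The relations on the vertices of the diagram\<close>

definition vertex :: "nat \<Rightarrow> root" where
  "vertex i = (if i = 1 then e4 else if i = 2 then h0 else if i = 3 then p23 else m24)"

lemma vertex_simps [simp]: "vertex (Suc 0) = e4" "vertex 1 = e4" "vertex 2 = h0" "vertex 3 = p23" "vertex 4 = m24"
  by (simp_all add: vertex_def)

lemma one_to_four: "{1..4} = {1, 2, 3, 4 :: nat}"
  by auto

lemma word_eval_restrict:
  "(\<And>x. x \<in> X \<Longrightarrow> f x = f' x) \<Longrightarrow> u \<in> words X \<Longrightarrow> word_eval G f u = word_eval G f' u"
  by (induction u) (auto simp: word_eval_Cons)

text \<open>
  Every entry defines a new letter from letters that are already defined.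
\<close>

fun wf_defs :: "root list \<Rightarrow> (root \<times> root \<times> bool \<times> root) list \<Rightarrow> bool" where
  "wf_defs K [] \<longleftrightarrow> True"
| "wf_defs K ((a, b, left, c) # ds) \<longleftrightarrow>
    a \<in> set K \<and> b \<in> set K \<and> c \<notin> set K \<and> wf_defs (c # K) ds"

lemma wf_lift_defs: "wf_defs [e4, h0, p23, m24] lift_defs"
  by code_simp

lemma lift_defs_cover: "set ([e4, h0, p23, m24] @ map (\<lambda>(a, b, left, c). c) lift_defs) = UNIV"
proof -
  have "list_all (\<lambda>r. r \<in> set ([e4, h0, p23, m24] @ map (\<lambda>(a, b, left, c). c) lift_defs)) roots"
    by code_simp
  then show ?thesis by (simp only: list_all_iff) (use in_roots in blast)
qed

context group
begin

lemma conj_eq_iff: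
  assumes "a \<in> carrier G" "b \<in> carrier G" "c \<in> carrier G"
  shows "a \<otimes> b = b \<otimes> c \<longleftrightarrow> c = inv b \<otimes> a \<otimes> b" "a \<otimes> b = c \<otimes> a \<longleftrightarrow> c = a \<otimes> b \<otimes> inv a"
proof -
  show "a \<otimes> b = b \<otimes> c \<longleftrightarrow> c = inv b \<otimes> a \<otimes> b"
  proof
    assume "a \<otimes> b = b \<otimes> c"
    then have "inv b \<otimes> (a \<otimes> b) = inv b \<otimes> (b \<otimes> c)" by simp
    then show "c = inv b \<otimes> a \<otimes> b" using assms by (simp add: m_assoc)
  qed (use assms in \<open>simp add: m_assoc\<close>)
  show "a \<otimes> b = c \<otimes> a \<longleftrightarrow> c = a \<otimes> b \<otimes> inv a"
  proof
    assume "a \<otimes> b = c \<otimes> a"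
    then have "a \<otimes> b \<otimes> inv a = c \<otimes> a \<otimes> inv a" by simp
    then show "c = a \<otimes> b \<otimes> inv a" using assms by (simp add: m_assoc)
  qed (use assms in \<open>simp add: m_assoc\<close>)
qed

lemma holds_def_equation:
  assumes "range f \<subseteq> carrier G"
  shows "holds G f (def_equation (a, b, left, c)) \<longleftrightarrow>
    f c = (if left then f a \<otimes> f b \<otimes> inv (f a) else inv (f b) \<otimes> f a \<otimes> f b)"
proof -
  have "f x \<in> carrier G" for x using assms by auto
  then show ?thesis by (simp add: holds_def conj_eq_iff)
qed

lemma lift_exists:
  assumes "wf_defs K ds" "range f \<subseteq> carrier G"
  shows "\<exists>f'. range f' \<subseteq> carrier G \<and> (\<forall>k\<in>set K. f' k = f k) \<and>
    (\<forall>e\<in>set (map def_equation ds). holds G f' e)"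
  using assms
proof (induction K ds arbitrary: f rule: wf_defs.induct)
  case (2 K a b left c ds)
  have fc: "f x \<in> carrier G" for x using 2(3) by auto
  let ?y = "if left then f a \<otimes> f b \<otimes> inv (f a) else inv (f b) \<otimes> f a \<otimes> f b"
  have "range (f(c := ?y)) \<subseteq> carrier G" using fc by auto
  then obtain f' where f': "range f' \<subseteq> carrier G" "\<forall>k\<in>set (c # K). f' k = (f(c := ?y)) k"
    "\<forall>e\<in>set (map def_equation ds). holds G f' e"
    using 2(1)[of "f(c := ?y)"] 2(2) by auto
  have ne: "a \<noteq> c" "b \<noteq> c" "a \<in> set K" "b \<in> set K" "c \<notin> set K" using 2(2) by auto
  have "f' c = ?y" "f' a = f a" "f' b = f b" using f'(2) ne by auto
  then have "holds G f' (def_equation (a, b, left, c))"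
    unfolding holds_def_equation[OF f'(1)] by simp
  then show ?case using f' ne by (intro exI[of _ f']) (auto simp del: def_equation.simps)
qed auto

lemma lift_generated:
  assumes f: "range f \<subseteq> carrier G" and "wf_defs K ds"
    and "\<forall>e\<in>set (map def_equation ds). holds G f e"
    and S: "subgroup S G" and "f ` set K \<subseteq> S"
  shows "f ` set (K @ map (\<lambda>(a, b, left, c). c) ds) \<subseteq> S"
  using assms(2,3,5)
proof (induction K ds rule: wf_defs.induct)
  case (2 K a b left c ds)
  have "holds G f (def_equation (a, b, left, c))" using 2(3) by (simp del: def_equation.simps)
  then have "f c = (if left then f a \<otimes> f b \<otimes> inv (f a) else inv (f b) \<otimes> f a \<otimes> f b)"
    by (simp only: holds_def_equation[OF f])
  moreover have "f a \<in> S" "f b \<in> S" using 2(2,4) by auto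
  ultimately have "f c \<in> S"
    using S by (simp add: subgroup.m_closed subgroup.m_inv_closed)
  then show ?case using 2 by (simp del: def_equation.simps)
qed simp

lemma commutator_eq_one_iff:
  assumes "a \<in> carrier G" "b \<in> carrier G"
  shows "inv a \<otimes> (inv b \<otimes> (a \<otimes> b)) = \<one> \<longleftrightarrow> a \<otimes> b = b \<otimes> a"
proof
  assume "inv a \<otimes> (inv b \<otimes> (a \<otimes> b)) = \<one>"
  then have "b \<otimes> (a \<otimes> (inv a \<otimes> (inv b \<otimes> (a \<otimes> b)))) = b \<otimes> (a \<otimes> \<one>)" by simp
  then show "a \<otimes> b = b \<otimes> a" using assms by simp
qed (use assms in simp)

text \<open>
  Conjugation by \<open>c\<close> moves the conjugate of \<open>b\<close> back to \<open>b\<close>.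
\<close>

lemma conj_commute_iff:
  assumes [simp]: "a \<in> carrier G" "b \<in> carrier G" "c \<in> carrier G"
  shows "a \<otimes> (inv c \<otimes> b \<otimes> c) = (inv c \<otimes> b \<otimes> c) \<otimes> a \<longleftrightarrow>
    (c \<otimes> a \<otimes> inv c) \<otimes> b = b \<otimes> (c \<otimes> a \<otimes> inv c)"
proof
  assume "a \<otimes> (inv c \<otimes> b \<otimes> c) = (inv c \<otimes> b \<otimes> c) \<otimes> a"
  then have "c \<otimes> (a \<otimes> (inv c \<otimes> b \<otimes> c)) \<otimes> inv c = c \<otimes> ((inv c \<otimes> b \<otimes> c) \<otimes> a) \<otimes> inv c" by simp
  then show "(c \<otimes> a \<otimes> inv c) \<otimes> b = b \<otimes> (c \<otimes> a \<otimes> inv c)" by (simp add: m_assoc)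
next
  assume "(c \<otimes> a \<otimes> inv c) \<otimes> b = b \<otimes> (c \<otimes> a \<otimes> inv c)"
  then have "inv c \<otimes> ((c \<otimes> a \<otimes> inv c) \<otimes> b) \<otimes> c = inv c \<otimes> (b \<otimes> (c \<otimes> a \<otimes> inv c)) \<otimes> c" by simp
  then show "a \<otimes> (inv c \<otimes> b \<otimes> c) = (inv c \<otimes> b \<otimes> c) \<otimes> a" by (simp add: m_assoc)
qed

lemma satisfies_braid_iff:
  "satisfies G x (braid_relations {1..4} F4a1) \<longleftrightarrow>
    word_eval G x [(1, True), (2, True), (1, True)] = word_eval G x [(2, True), (1, True), (2, True)] \<and>
    word_eval G x [(3, True), (4, True), (3, True)] = word_eval G x [(4, True), (3, True), (4, True)] \<and>
    word_eval G x [(1, True), (3, True)] = word_eval G x [(3, True), (1, True)] \<and>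
    word_eval G x [(2, True), (4, True)] = word_eval G x [(4, True), (2, True)] \<and>
    word_eval G x [(1, True), (4, True), (1, True), (4, True)] =
      word_eval G x [(4, True), (1, True), (4, True), (1, True)] \<and>
    word_eval G x [(2, True), (3, True), (2, True), (3, True)] =
      word_eval G x [(3, True), (2, True), (3, True), (2, True)]"
proof -
  have m: "F4a1 1 2 = 3" "F4a1 1 3 = 2" "F4a1 1 4 = 4" "F4a1 2 1 = 3" "F4a1 2 3 = 4" "F4a1 2 4 = 2"
    "F4a1 3 1 = 2" "F4a1 3 2 = 4" "F4a1 3 4 = 3" "F4a1 4 1 = 4" "F4a1 4 2 = 2" "F4a1 4 3 = 3"
    by (simp_all add: F4a1_def doubleton_eq_iff)
  have alt: "alternating_word 2 i j = [(i, True), (j, True)]"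
    "alternating_word 3 i j = [(i, True), (j, True), (i, True)]"
    "alternating_word 4 i j = [(i, True), (j, True), (i, True), (j, True)]" for i j :: nat
    by (simp_all add: numeral_eq_Suc)
  have "satisfies G x (braid_relations {1..4} F4a1) \<longleftrightarrow> (\<forall>i\<in>{1, 2, 3, 4}. \<forall>j\<in>{1, 2, 3, 4}. i \<noteq> j \<longrightarrow>
      word_eval G x (alternating_word (F4a1 i j) i j) = word_eval G x (alternating_word (F4a1 i j) j i))"
    unfolding satisfies_def braid_relations_def one_to_four by fast
  then show ?thesis
    by (simp only: ball_simps m alt) (auto simp del: word_eval_simps One_nat_def)
qed

text \<open>
  Used in both directions: for the group of the diagram, to obtain the relations between the lifts, and for
  the interval group, to obtain the relations of the diagram.
\<close>

lemma vertex_equations_iff: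
  assumes f: "range f \<subseteq> carrier G" and defs: "\<forall>e\<in>set (map def_equation lift_defs). holds G f e"
  shows "(\<forall>e\<in>set vertex_equations. holds G f e) \<longleftrightarrow> satisfies G (\<lambda>i. f (vertex i)) F4a1_relations"
proof -
  have fc [simp]: "f x \<in> carrier G" for x using f by auto
  have "(e4, h0, False, h1) \<in> set lift_defs" "(p23, h1, True, h7) \<in> set lift_defs \<or> (h7, p23, False, h1) \<in> set lift_defs"
    "(p23, m24, True, p34) \<in> set lift_defs" "(p34, h0, False, p12) \<in> set lift_defs"
    by (simp_all add: lift_defs_def)
  then have "holds G f (def_equation (e4, h0, False, h1))" "holds G f (def_equation (p23, h1, True, h7))"
    "holds G f (def_equation (p23, m24, True, p34))" "holds G f (def_equation (p34, h0, False, p12))"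
    using defs by (auto simp: holds_def)
  then have d: "f h1 = inv (f h0) \<otimes> f e4 \<otimes> f h0" "f h7 = f p23 \<otimes> f h1 \<otimes> inv (f p23)"
    "f p34 = f p23 \<otimes> f m24 \<otimes> inv (f p23)" "f p12 = inv (f h0) \<otimes> f p34 \<otimes> f h0"
    by (simp_all only: holds_def_equation[OF f] if_True if_False)
  let ?x = "\<lambda>i. f (vertex i)"
  have "word_eval G ?x (word_commutator (conj_word 1 2) (conj_word 4 3)) = \<one> \<longleftrightarrow>
      inv (f h1) \<otimes> (inv (inv (f p23) \<otimes> f m24 \<otimes> f p23) \<otimes> (f h1 \<otimes> (inv (f p23) \<otimes> f m24 \<otimes> f p23))) = \<one>"
    by (simp add: word_commutator_def word_inv_def conj_word_def d(1) inv_mult_group m_assoc)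
  also have "\<dots> \<longleftrightarrow> f h7 \<otimes> f m24 = f m24 \<otimes> f h7"
    by (simp only: commutator_eq_one_iff conj_commute_iff fc d(2) m_closed inv_closed)
  finally have c1: "word_eval G ?x (word_commutator (conj_word 1 2) (conj_word 4 3)) = \<one> \<longleftrightarrow>
    f h7 \<otimes> f m24 = f m24 \<otimes> f h7" .
  have "word_eval G ?x (word_commutator (conj_word' 1 2) (conj_word' 4 3)) = \<one> \<longleftrightarrow>
      inv (f h0 \<otimes> f e4 \<otimes> inv (f h0)) \<otimes> (inv (f p34) \<otimes> ((f h0 \<otimes> f e4 \<otimes> inv (f h0)) \<otimes> f p34)) = \<one>"
    by (simp add: word_commutator_def word_inv_def conj_word'_def d(3) inv_mult_group m_assoc)
  also have "\<dots> \<longleftrightarrow> f e4 \<otimes> f p12 = f p12 \<otimes> f e4"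
    by (simp only: commutator_eq_one_iff conj_commute_iff[symmetric] fc d(4) m_closed inv_closed)
  finally have c2: "word_eval G ?x (word_commutator (conj_word' 1 2) (conj_word' 4 3)) = \<one> \<longleftrightarrow>
    f e4 \<otimes> f p12 = f p12 \<otimes> f e4" .
  have "satisfies G ?x F4a1_relations \<longleftrightarrow> satisfies G ?x (braid_relations {1..4} F4a1) \<and>
      word_eval G ?x (word_commutator (conj_word 1 2) (conj_word 4 3)) = \<one> \<and>
      word_eval G ?x (word_commutator (conj_word' 1 2) (conj_word' 4 3)) = \<one>"
    by (auto simp: F4a1_relations_def satisfies_def)
  also have "\<dots> \<longleftrightarrow> (\<forall>e\<in>set vertex_equations. holds G f e)"
    unfolding c1 c2 satisfies_braid_iff by (auto simp: vertex_equations_def holds_def)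
  finally show ?thesis by simp
qed

end

subsection \<open>Subwords of reduced decompositions\<close>

definition reduced :: "root list \<Rightarrow> bool" where
  "reduced us \<longleftrightarrow> (\<exists>cs. length us + length cs = 4 \<and> act (us @ cs) = act w0)"

text \<open>
  Moving a prefix to the right end conjugates its letters. Thus every factor of a reduced decomposition
  also begins a reduced decomposition of the same element.
\<close>

lemma act_swap: "act (us @ xs) = act (xs @ map (rconjs (rev xs)) us)"
proof
  fix v
  have "act (xs @ map (rconjs (rev xs)) us) v = act xs (act (rev xs @ us @ rev (rev xs)) v)"
    by (simp only: act_append act_rconjs)
  then show "act (us @ xs) v = act (xs @ map (rconjs (rev xs)) us) v" by simp
qed

lemma act_append_cong: "act us = act us' \<Longrightarrow> act (us @ vs) = act (us' @ vs)"
  by (intro ext) simp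

lemma reduced_prefix:
  assumes "reduced (us @ vs)"
  shows "reduced us"
proof -
  obtain cs where "length (us @ vs) + length cs = 4" "act ((us @ vs) @ cs) = act w0"
    using assms by (auto simp: reduced_def)
  then show ?thesis unfolding reduced_def by (intro exI[of _ "vs @ cs"]) simp
qed

lemma reduced_suffix:
  assumes "reduced (us @ vs)"
  shows "reduced vs"
proof -
  obtain cs where "length (us @ vs) + length cs = 4" "act ((us @ vs) @ cs) = act w0"
    using assms by (auto simp: reduced_def)
  then have "length vs + length (cs @ map (rconjs (rev (vs @ cs))) us) = 4"
    "act (vs @ (cs @ map (rconjs (rev (vs @ cs))) us)) = act w0"
    using act_swap[of us "vs @ cs"] by simp_all
  then show ?thesis unfolding reduced_def by blast
qed

lemma act_rev_eq:
  assumes "act us = act vs"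
  shows "act (rev us) = act (rev vs)"
proof
  fix v
  have "act (rev us) v = act (rev us) (act vs (act (rev vs) v))" by simp
  also have "\<dots> = act (rev vs) v" by (simp only: assms[symmetric] act_rev)
  finally show "act (rev us) v = act (rev vs) v" .
qed

lemma act_cancel:
  assumes "act (us @ vs) = act (us @ vs')"
  shows "act vs = act vs'"
proof
  fix v
  have "act (rev us) (act (us @ vs) v) = act (rev us) (act (us @ vs') v)" by (simp only: assms)
  then show "act vs v = act vs' v" by simp
qed

lemma reduced_cong:
  assumes "reduced us" "length us = length us'" "act us = act us'"
  shows "reduced us'"
proof -
  obtain cs where "length us + length cs = 4" "act (us @ cs) = act w0"
    using assms(1) by (auto simp: reduced_def)
  then show ?thesis
    using act_append_cong[OF assms(3), of cs] assms(2) unfolding reduced_def by (intro exI[of _ cs]) simp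
qed

fun completes :: "root list \<Rightarrow> root list option \<Rightarrow> bool" where
  "completes u None \<longleftrightarrow> False"
| "completes u (Some v) \<longleftrightarrow> length v = 2 \<and> key (u @ v) = key w0"

text \<open>
  The last two letters of the normal word that starts with the given factorization.
\<close>

fun completion :: "root list option \<Rightarrow> root list option" where
  "completion None = None"
| "completion (Some X) = map_of (map (\<lambda>(n, u, v). (take 2 n, drop 2 n)) links) X"

definition extra_equations :: "(root list \<times> root list) list" where
  "extra_equations = [
    ([h0,h1],[h1,e4]), ([p23,m24],[m24,p34]), ([m24,e2],[e2,p24]), ([p23,h0],[h0,p14]),
    ([h0,p14],[p14,h6]), ([p14,h6],[h6,p23])]"

text \<open>
  The braid relations of length three and four from relations of length two: for reflections \<open>a\<close>, \<open>b\<close> the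
  element \<open>a b\<close> has as many factorizations as the dihedral group has reflections, and walking through them
  turns one side of the braid relation into the other.
\<close>

definition braid_chains :: "root list list list" where
  "braid_chains = [
    [[e4,h0,e4],[h0,h1,e4],[h0,h0,h1],[h0,e4,h0]], [[p23,m24,p23],[m24,p34,p23],[m24,p23,m24]],
    [[e4,m24,e4,m24],[m24,e2,e4,m24],[m24,e2,p24,e4],[m24,m24,e2,e4],[m24,e4,m24,e4]],
    [[h0,p23,h0,p23],[h0,h0,p14,p23],[h0,p14,h6,p23],[p23,h0,h6,p23],[p23,h0,p14,h6],[p23,h0,h0,p14],[p23,h0,p23,h0]]]"

definition pair_equations :: "(root list \<times> root list) list" where
  "pair_equations = map def_equation lift_defs @ filter (\<lambda>(l, r). length l = 2) vertex_equations @ extra_equations"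

fun pair_ok :: "root list \<times> root list \<Rightarrow> bool" where
  "pair_ok ([a, b], [c, d]) \<longleftrightarrow>
    completes [a, b] (completion (canon a b)) \<and> completes [c, d] (completion (canon a b))"
| "pair_ok e \<longleftrightarrow> False"

lemma pair_equations_ok: "list_all pair_ok pair_equations"
  by code_simp

lemma braid_chains_ok: "chains_ok pair_equations braid_chains"
  by code_simp

lemma vertex_equations_derived:
  "list_all (\<lambda>e. length (fst e) = 2 \<or> e \<in> set (map (\<lambda>c. (hd c, last c)) braid_chains)) vertex_equations"
  by code_simp

text \<open>
  All \<open>24\<close> reflections lie below \<open>w\<close>.
\<close>

lemma root_reduced: "reduced [r]"
proof -
  have "list_all (\<lambda>r. completes [r, fst (hd (canonical_pairs r))]
      (completion (canon r (fst (hd (canonical_pairs r)))))) roots"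
    by code_simp
  then have "completes [r, fst (hd (canonical_pairs r))] (completion (canon r (fst (hd (canonical_pairs r)))))"
    by (simp only: list_all_iff in_roots)
  then obtain v where "length v = 2" "key ([r, fst (hd (canonical_pairs r))] @ v) = key w0"
    by (metis completes.elims(2))
  moreover from this have "act ([r, fst (hd (canonical_pairs r))] @ v) = act w0" by (simp only: act_eq_iff)
  ultimately have "reduced ([r] @ [fst (hd (canonical_pairs r))])"
    unfolding reduced_def by (intro exI[of _ v]) simp
  then show ?thesis by (rule reduced_prefix)
qed

locale F4_interval = F4_group W R t for W (structure) and R and t +
  fixes w
  assumes w_eq: "w = list_prod W (map t w0)" and w_length: "refl_length W R w = 4"
begin

abbreviation el :: "root list \<Rightarrow> 'a" where
  "el us \<equiv> list_prod W (map t us)"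

abbreviation gen :: "'a \<Rightarrow> 'a word set" where
  "gen \<equiv> interval_gen W R w"

abbreviation IG :: "'a word set monoid" where
  "IG \<equiv> interval_group W R w"

lemma reduced_length: "reduced us \<Longrightarrow> refl_length W R (el us) = length us"
  and reduced_interval: "reduced us \<Longrightarrow> el us \<in> interval W R w"
proof -
  assume "reduced us"
  then obtain cs where cs: "length us + length cs = 4" "act (us @ cs) = act w0" by (auto simp: reduced_def)
  obtain xs where xs: "length xs = refl_length W R (el us)" "el us = el xs"
    using refl_length_word[of "el us"] by auto
  obtain ys where ys: "length ys = refl_length W R (el cs)" "el cs = el ys"
    using refl_length_word[of "el cs"] by auto
  have "el (us @ cs) = el w0" using cs(2) word_eq_iff by blast
  then have w: "w = el us \<otimes> el cs" by (simp add: w_eq word_append)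
  then have "w = el (xs @ ys)" using xs ys by (simp add: word_append)
  then have "4 \<le> length xs + length ys" using refl_length_le[of "xs @ ys"] w_length by simp
  moreover have "length xs \<le> length us" "length ys \<le> length cs"
    using xs ys refl_length_le[of us] refl_length_le[of cs] by simp_all
  ultimately have l: "refl_length W R (el us) = length us" "refl_length W R (el cs) = length cs"
    using xs ys cs by simp_all
  then show "refl_length W R (el us) = length us" by simp
  have "inv (el us) \<otimes> w = el cs" unfolding w by simp
  then show "el us \<in> interval W R w"
    using l cs(1) w_length by (simp add: interval_def abs_le_def)
qed

lemma interval_reduced:
  assumes "x \<in> interval W R w"
  obtains us where "reduced us" "x = el us"
proof -
  have x: "x \<in> carrier W" "refl_length W R w = refl_length W R x + refl_length W R (inv x \<otimes> w)"
    using assms by (auto simp: interval_def abs_le_def)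
  obtain us where us: "length us = refl_length W R x" "x = el us" using refl_length_word[OF x(1)] .
  have "inv x \<otimes> w \<in> carrier W" using x by (simp add: w_eq)
  then obtain cs where cs: "length cs = refl_length W R (inv x \<otimes> w)" "inv x \<otimes> w = el cs"
    using refl_length_word by blast
  have "el (us @ cs) = x \<otimes> (inv x \<otimes> w)" using cs(2) us(2) by (simp add: word_append)
  also have "\<dots> = el w0" using x(1) by (simp add: w_eq)
  finally have "act (us @ cs) = act w0" using word_eq_iff by blast
  then have "reduced us"
    using us(1) cs(1) x(2) w_length unfolding reduced_def by (intro exI[of _ cs]) simp
  then show thesis using that us(2) by blast
qed

lemma group_IG: "group IG"
  unfolding interval_group_def by (rule group_presented_group)

lemma gen_closed: "x \<in> interval W R w \<Longrightarrow> gen x \<in> carrier IG"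
  using presented_gen_closed[of "interval W R w" "interval_relations W R w"]
  unfolding interval_gen_def interval_group_def by (simp add: Pi_iff)

lemma interval_relation:
  assumes "u \<in> interval W R w" "v \<in> interval W R w" "u \<otimes> v \<in> interval W R w"
    "refl_length W R (u \<otimes> v) = refl_length W R u + refl_length W R v"
  shows "gen u \<otimes>\<^bsub>IG\<^esub> gen v = gen (u \<otimes> v)"
proof -
  let ?X = "interval W R w" and ?E = "interval_relations W R w"
  interpret P: group "presented_group ?X ?E" by (rule group_presented_group)
  have "satisfies (presented_group ?X ?E) (presented_gen ?X ?E) ?E"
    by (rule presented_gen_satisfies) (auto simp: interval_relations_def)
  moreover have "([(u, True), (v, True)], [(u \<otimes> v, True)]) \<in> ?E"
    using assms unfolding interval_relations_def by blast
  ultimately have "word_eval (presented_group ?X ?E) (presented_gen ?X ?E) [(u, True), (v, True)] =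
      word_eval (presented_group ?X ?E) (presented_gen ?X ?E) [(u \<otimes> v, True)]"
    unfolding satisfies_def by blast
  moreover have "presented_gen ?X ?E x \<in> carrier (presented_group ?X ?E)" if "x \<in> ?X" for x
    using presented_gen_closed[of ?X ?E] that by (simp add: Pi_iff)
  ultimately show ?thesis using assms
    by (simp add: interval_gen_def interval_group_def)
qed

lemma gen_append:
  assumes "reduced (us @ vs)"
  shows "gen (el us) \<otimes>\<^bsub>IG\<^esub> gen (el vs) = gen (el (us @ vs))"
proof -
  have r: "reduced us" "reduced vs" using assms reduced_prefix reduced_suffix by blast+
  have "el (us @ vs) = el us \<otimes> el vs" by (simp add: word_append)
  then have "el us \<otimes> el vs \<in> interval W R w"
    "refl_length W R (el us \<otimes> el vs) = refl_length W R (el us) + refl_length W R (el vs)"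
    "el (us @ vs) = el us \<otimes> el vs"
    using reduced_interval[OF assms] reduced_length[OF assms] reduced_length[OF r(1)]
      reduced_length[OF r(2)] by simp_all
  then show ?thesis
    using interval_relation[OF reduced_interval[OF r(1)] reduced_interval[OF r(2)]] by simp
qed

definition refl_gen :: "root \<Rightarrow> 'a word set" where
  "refl_gen r = gen (t r)"

lemma refl_gen_closed [simp]: "refl_gen r \<in> carrier IG" "range refl_gen \<subseteq> carrier IG"
proof -
  show "refl_gen r \<in> carrier IG" for r
    using reduced_interval[OF root_reduced[of r]] gen_closed by (simp add: refl_gen_def)
  then show "range refl_gen \<subseteq> carrier IG" by auto
qed

text \<open>
  In particular the value of the product of generators depends on the element only, which is the source of
  all relations between the generators of reflections.
\<close>

lemma gen_word: "reduced us \<Longrightarrow> gen (el us) = list_prod IG (map refl_gen us)"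
proof (induction us)
  case Nil
  interpret IG: group IG by (rule group_IG)
  have "gen (el []) \<otimes>\<^bsub>IG\<^esub> gen (el []) = gen (el [])" using gen_append[of "[]" "[]"] Nil by simp
  moreover have "gen (el []) \<in> carrier IG" using gen_closed reduced_interval[OF Nil] by simp
  ultimately show ?case using IG.l_cancel_one' by simp
next
  case (Cons r us)
  have "reduced us" using reduced_suffix[of "[r]" us] Cons.prems by simp
  then show ?case using gen_append[of "[r]" us] Cons by (simp add: refl_gen_def)
qed

text \<open>
  Both sides are factorizations of one element, because they are completed to \<open>w0\<close> by the same two letters.
\<close>

lemma refl_gen_pair: "\<forall>e\<in>set pair_equations. holds IG refl_gen e"
proof
  fix e assume "e \<in> set pair_equations"
  then have "pair_ok e" using pair_equations_ok by (simp add: list_all_iff)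
  then obtain a b c d where e: "e = ([a, b], [c, d])" "completes [a, b] (completion (canon a b))"
      "completes [c, d] (completion (canon a b))"
    by (cases e rule: pair_ok.cases) (auto simp del: canon.simps completion.simps completes.simps)
  then obtain v where v: "completion (canon a b) = Some v" by (cases "completion (canon a b)") auto
  have v': "length v = 2" "act ([a, b] @ v) = act w0" "act ([c, d] @ v) = act w0"
    using e(2,3) unfolding v act_eq_iff by simp_all
  then have r: "reduced [a, b]" "reduced [c, d]" unfolding reduced_def by (metis length_Cons list.size(3) numeral_2_eq_2 numeral_Bit0)+
  have "act (rev v @ rev [a, b]) = act (rev v @ rev [c, d])"
    using v'(2,3) by (metis act_rev_eq rev_append)
  then have "act [a, b] = act [c, d]"
    by (metis act_cancel act_rev_eq rev_rev_ident)
  then have "el [a, b] = el [c, d]" using word_eq_iff by blast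
  then show "holds IG refl_gen e" using gen_word[OF r(1)] gen_word[OF r(2)] by (simp add: holds_def e(1))
qed

lemma refl_gen_base: "\<forall>e\<in>set base_equations. holds IG refl_gen e"
proof -
  interpret IG: group IG by (rule group_IG)
  have "holds IG refl_gen e" if e: "e \<in> set vertex_equations" for e
  proof (cases "length (fst e) = 2")
    case True
    then have "e \<in> set pair_equations" using e by (cases e) (auto simp: pair_equations_def)
    then show ?thesis using refl_gen_pair by blast
  next
    case False
    then obtain c where "c \<in> set braid_chains" "e = (hd c, last c)"
      using vertex_equations_derived e by (auto simp: list_all_iff)
    then show ?thesis
      using IG.holds_chains[OF refl_gen_closed(2) refl_gen_pair braid_chains_ok] by simp
  qed
  moreover have "holds IG refl_gen e" if "e \<in> set (map def_equation lift_defs)" for e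
    using refl_gen_pair that unfolding pair_equations_def set_append by blast
  ultimately show ?thesis unfolding base_equations_def set_append by blast
qed

lemma refl_gen_generate:
  assumes "g \<in> carrier IG"
  shows "\<exists>u\<in>words {1..4}. g = word_eval IG (\<lambda>i. refl_gen (vertex i)) u"
proof -
  interpret IG: group IG by (rule group_IG)
  let ?f = "\<lambda>i. refl_gen (vertex i)"
  define S where "S = word_eval IG ?f ` words {1..4}"
  have f: "?f \<in> {1..4} \<rightarrow> carrier IG" by simp
  have S: "subgroup S IG"
  proof
    show "S \<subseteq> carrier IG" unfolding S_def using IG.word_eval_closed[OF f] by blast
    show "x \<otimes>\<^bsub>IG\<^esub> y \<in> S" if "x \<in> S" "y \<in> S" for x y
      using that IG.word_eval_append[OF f] unfolding S_def by (auto intro!: image_eqI[of _ _ "_ @ _"])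
    show "\<one>\<^bsub>IG\<^esub> \<in> S" unfolding S_def by (rule image_eqI[of _ _ "[]"]) simp_all
    show "inv\<^bsub>IG\<^esub> x \<in> S" if "x \<in> S" for x
    proof -
      obtain u where u: "u \<in> words {1..4}" "x = word_eval IG ?f u" using \<open>x \<in> S\<close> by (auto simp: S_def)
      have "(word_inv u @ u, []) \<in> word_cong {1..4} {}" by (rule word_cong_left_inverse[OF u(1)])
      then have "word_eval IG ?f (word_inv u) \<otimes>\<^bsub>IG\<^esub> x = \<one>\<^bsub>IG\<^esub>"
        using IG.word_eval_cong[OF f, of "{}"] IG.word_eval_append[OF f, of "word_inv u" u] u
        by (simp add: satisfies_def)
      then have "inv\<^bsub>IG\<^esub> x = word_eval IG ?f (word_inv u)"
        using u(2) IG.word_eval_closed[OF f word_inv_in_words[OF u(1)]] IG.word_eval_closed[OF f u(1)]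
        by (intro IG.inv_equality) simp_all
      then show ?thesis using u(1) by (simp add: S_def)
    qed
  qed
  have v: "refl_gen r \<in> S" if r: "r \<in> set [e4, h0, p23, m24]" for r
  proof -
    have "r = vertex 1 \<or> r = vertex 2 \<or> r = vertex 3 \<or> r = vertex 4" using r by simp
    then have "r \<in> vertex ` {1..4}" unfolding one_to_four by blast
    then obtain i where "i \<in> {1..4}" "r = vertex i" by blast
    then show ?thesis unfolding S_def by (intro image_eqI[of _ _ "[(i, True)]"]) simp_all
  qed
  have "refl_gen ` UNIV \<subseteq> S"
    using IG.lift_generated[OF refl_gen_closed(2) wf_lift_defs _ S] v refl_gen_base
    unfolding lift_defs_cover base_equations_def by auto
  then have gtS: "refl_gen r \<in> S" for r by auto
  have genS: "gen x \<in> S" if x: "x \<in> interval W R w" for x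
  proof -
    obtain us where us: "reduced us" "x = el us" using interval_reduced[OF x] .
    have "list_prod IG (map refl_gen us) \<in> S" for us
      using gtS S by (induction us) (auto intro: subgroup.m_closed subgroup.one_closed)
    then show ?thesis using us gen_word by simp
  qed
  obtain u where u: "u \<in> words (interval W R w)" "g = word_eval IG gen u"
    using assms unfolding interval_group_def interval_gen_def by (rule presented_induct)
  have "word_eval IG gen u \<in> S"
    using u(1)
  proof (induction u)
    case (Cons a u)
    then show ?case using genS S
      by (cases a) (auto simp: word_eval_Cons intro!: subgroup.m_closed subgroup.m_inv_closed)
  qed (use S in \<open>simp add: subgroup.one_closed\<close>)
  then show ?thesis using u(2) by (auto simp: S_def)
qed

text \<open>
  To define the inverse homomorphism, an element of the interval is sent to the product of the lifts along
  any reduced decomposition. Two decompositions of the element extend by the same letters to decompositions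
  of \<open>w\<close>, whose products agree; cancelling the additional letters shows that the choice does not matter. If
  \<open>u v = r\<close> with additive lengths, the decompositions of \<open>u\<close> and \<open>v\<close> join to one of \<open>r\<close>, which gives the
  relations of the interval group.
\<close>

theorem interval_group_presentation:
  "is_presentation IG {1..4} F4a1_relations (\<lambda>i. refl_gen (vertex i))"
proof -
  interpret IG: group IG by (rule group_IG)
  define P where "P = presented_group {1..4} F4a1_relations"
  define x where "x = presented_gen {1..4} F4a1_relations"
  interpret P: group P unfolding P_def by (rule group_presented_group)
  have x: "x i \<in> carrier P" if "i \<in> {1..4}" for i
    using presented_gen_closed[of "{1..4}" F4a1_relations] that unfolding P_def x_def by (simp only: Pi_iff)
  have relation_words: "l \<in> words {1..4} \<and> r \<in> words {1..4}" if lr: "(l, r) \<in> F4a1_relations" for l r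
  proof -
    have alt: "alternating_word n i j \<in> words {1..4}" if "i \<in> {1..4}" "j \<in> {1..4}" for n and i j :: nat
      using that by (induction n i j rule: alternating_word.induct) auto
    consider i j where "i \<in> {1..4}" "j \<in> {1..4}" "l = alternating_word (F4a1 i j) i j"
        "r = alternating_word (F4a1 i j) j i"
      | "l = word_commutator (conj_word 1 2) (conj_word 4 3)" "r = []"
      | "l = word_commutator (conj_word' 1 2) (conj_word' 4 3)" "r = []"
      using lr unfolding F4a1_relations_def braid_relations_def by blast
    then show ?thesis
    proof cases
      case 1
      then show ?thesis using alt by (simp only: simp_thms)
    qed (simp_all add: word_commutator_def word_inv_def conj_word_def conj_word'_def)
  qed
  have xsat: "satisfies P x F4a1_relations"
    unfolding P_def x_def by (rule presented_gen_satisfies) (rule relation_words)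
  define f0 where "f0 r = (if r = e4 then x 1 else if r = h0 then x 2 else if r = p23 then x 3 else x 4)" for r
  have f0: "range f0 \<subseteq> carrier P" using x by (auto simp: f0_def)
  obtain f where f: "range f \<subseteq> carrier P" "\<forall>k\<in>set [e4, h0, p23, m24]. f k = f0 k"
    "\<forall>e\<in>set (map def_equation lift_defs). holds P f e"
    using P.lift_exists[OF wf_lift_defs f0] by blast
  have fv: "f (vertex i) = x i" if "i \<in> {1..4}" for i
  proof -
    have "i = 1 \<or> i = 2 \<or> i = 3 \<or> i = 4" using that by auto
    then show ?thesis using f(2) by (elim disjE) (simp_all add: f0_def)
  qed
  have "satisfies P (\<lambda>i. f (vertex i)) F4a1_relations"
    unfolding satisfies_def
  proof clarify
    fix l r assume lr: "(l, r) \<in> F4a1_relations"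
    have "word_eval P (\<lambda>i. f (vertex i)) u = word_eval P x u" if "u \<in> words {1..4}" for u
      using word_eval_restrict[OF fv that] .
    then show "word_eval P (\<lambda>i. f (vertex i)) l = word_eval P (\<lambda>i. f (vertex i)) r"
      using relation_words[OF lr] xsat lr unfolding satisfies_def by auto
  qed
  then have base: "\<forall>e\<in>set base_equations. holds P f e"
    using P.vertex_equations_iff[OF f(1,3)] f(3) by (auto simp: base_equations_def)
  have fc: "f r \<in> carrier P" for r using f(1) by auto
  define \<phi> where "\<phi> x = list_prod P (map f (SOME us. reduced us \<and> x = el us))" for x
  \<comment> \<open>Extending both words by the same letters gives decompositions of the whole element.\<close>
  have unique: "list_prod P (map f us) = list_prod P (map f vs)"
    if r: "reduced us" "reduced vs" "el us = el vs" for us vs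
  proof -
    have len: "length us = length vs" using r reduced_length by metis
    obtain cs where cs: "length us + length cs = 4" "act (us @ cs) = act w0"
      using r(1) by (auto simp: reduced_def)
    have "act us = act vs" using r(3) word_eq_iff by blast
    then have "act (vs @ cs) = act w0" using act_append_cong[of us vs cs] cs(2) by simp
    then have "list_prod P (map f (us @ cs)) = list_prod P (map f (vs @ cs))"
      using P.reduced_words_equal[OF f(1) base, of "us @ cs"] P.reduced_words_equal[OF f(1) base, of "vs @ cs"]
        cs len by simp
    then show ?thesis using fc by (simp add: P.list_prod_append image_subset_iff)
  qed
  have \<phi>: "\<phi> (el us) = list_prod P (map f us)" if "reduced us" for us
  proof -
    have "reduced (SOME vs. reduced vs \<and> el us = el vs) \<and> el us = el (SOME vs. reduced vs \<and> el us = el vs)"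
      by (rule someI[of _ us]) (use that in simp)
    then show ?thesis unfolding \<phi>_def using unique that by metis
  qed
  have \<phi>c: "\<phi> \<in> interval W R w \<rightarrow> carrier P"
    using fc by (auto simp: \<phi>_def)
  have sat: "satisfies P \<phi> (interval_relations W R w)"
    unfolding satisfies_def
  proof clarify
    fix l r assume "(l, r) \<in> interval_relations W R w"
    then obtain u v where uv: "u \<in> interval W R w" "v \<in> interval W R w" "u \<otimes> v \<in> interval W R w"
      "refl_length W R (u \<otimes> v) = refl_length W R u + refl_length W R v"
      and lr: "l = [(u, True), (v, True)]" "r = [(u \<otimes> v, True)]"
      unfolding interval_relations_def by blast
    obtain us where us: "reduced us" "u = el us" using interval_reduced[OF uv(1)] .
    obtain vs where vs: "reduced vs" "v = el vs" using interval_reduced[OF uv(2)] .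
    obtain rs where rs: "reduced rs" "u \<otimes> v = el rs" using interval_reduced[OF uv(3)] .
    have el: "el (us @ vs) = el rs" using us vs rs by (simp add: word_append)
    have "length rs = length (us @ vs)" using us vs rs uv(4) reduced_length by (metis length_append)
    then have "reduced (us @ vs)" using reduced_cong[OF rs(1)] el word_eq_iff by metis
    then have "\<phi> (el (us @ vs)) = list_prod P (map f (us @ vs))" by (rule \<phi>)
    then have "\<phi> (u \<otimes> v) = list_prod P (map f (us @ vs))" by (simp only: rs(2) el)
    also have "\<dots> = \<phi> u \<otimes>\<^bsub>P\<^esub> \<phi> v"
      using fc us vs \<phi> by (simp add: P.list_prod_append image_subset_iff)
    finally show "word_eval P \<phi> l = word_eval P \<phi> r"
      using \<phi>c uv by (simp add: lr Pi_iff)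
  qed
  obtain h where "h \<in> hom (presented_group (interval W R w) (interval_relations W R w)) P"
    "\<And>u. u \<in> words (interval W R w) \<Longrightarrow>
      h (word_cong (interval W R w) (interval_relations W R w) `` {u}) = word_eval P \<phi> u"
    "\<And>x. x \<in> interval W R w \<Longrightarrow>
      h (presented_gen (interval W R w) (interval_relations W R w) x) = \<phi> x"
    using P.presented_hom_exists[OF \<phi>c sat] by blast
  then have h: "h \<in> hom IG P" "\<And>x. x \<in> interval W R w \<Longrightarrow> h (gen x) = \<phi> x"
    unfolding interval_group_def interval_gen_def by blast+
  show ?thesis
  proof (rule IG.is_presentationI[OF _ _ h(1)[unfolded P_def]])
    show "(\<lambda>i. refl_gen (vertex i)) \<in> {1..4} \<rightarrow> carrier IG" by simp
    show "satisfies IG (\<lambda>i. refl_gen (vertex i)) F4a1_relations"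
      using IG.vertex_equations_iff[OF refl_gen_closed(2)] refl_gen_base by (simp add: base_equations_def)
    show "h (refl_gen (vertex i)) = presented_gen {1..4} F4a1_relations i" if "i \<in> {1..4}" for i
    proof -
      have "h (refl_gen (vertex i)) = \<phi> (el [vertex i])"
        using h(2)[of "t (vertex i)"] reduced_interval[OF root_reduced[of "vertex i"]] by (simp add: refl_gen_def)
      also have "\<dots> = f (vertex i)" using \<phi>[OF root_reduced] fc by simp
      finally show ?thesis using fv[OF that] unfolding x_def by simp
    qed
  qed (rule refl_gen_generate)
qed

lemma t_pow: "(t a \<otimes> t b) [^] n = \<one> \<longleftrightarrow> key (concat (replicate n [a, b])) = key []"
proof -
  have "(t a \<otimes> t b) [^] n = el (concat (replicate n [a, b]))"
    using pow_eq_list_prod[of "t a" "t b" n] by (simp add: map_concat)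
  then show ?thesis using word_eq_iff[of "concat (replicate n [a, b])" "[]"] by (simp add: act_eq_iff)
qed

text \<open>
  The orders are at most four, so it suffices to test the proper divisor.
\<close>

lemma vertex_orders:
  assumes "i \<in> {1..4}" "j \<in> {1..4}"
  shows "ord (t (vertex i) \<otimes> t (vertex j)) = F4a1 i j"
proof -
  have m: "F4a1 1 2 = 3" "F4a1 1 3 = 2" "F4a1 1 4 = 4" "F4a1 2 1 = 3" "F4a1 2 3 = 4" "F4a1 2 4 = 2"
    "F4a1 3 1 = 2" "F4a1 3 2 = 4" "F4a1 3 4 = 3" "F4a1 4 1 = 4" "F4a1 4 2 = 2" "F4a1 4 3 = 3"
    "F4a1 1 1 = 1" "F4a1 2 2 = 1" "F4a1 3 3 = 1" "F4a1 4 4 = 1"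
    by (simp_all add: F4a1_def doubleton_eq_iff)
  have d: "ord (t a \<otimes> t b) dvd n \<longleftrightarrow> key (concat (replicate n [a, b])) = key []" for a b n
    using pow_eq_id[of "t a \<otimes> t b" n] t_pow[of a b n] by simp
  have o: "ord (t a \<otimes> t b) = 1" if "key (concat (replicate 1 [a, b])) = key []" for a b
    using that d[of a b 1] by simp
  have p: "ord (t a \<otimes> t b) = p" if p: "p = 2 \<or> p = 3" "key (concat (replicate p [a, b])) = key []"
      "key (concat (replicate 1 [a, b])) \<noteq> key []" for a b and p :: nat
  proof -
    have *: "ord (t a \<otimes> t b) dvd p" "\<not> ord (t a \<otimes> t b) dvd 1" using that(2,3) by (simp_all only: d not_False_eq_True)
    then have "ord (t a \<otimes> t b) \<le> p" "ord (t a \<otimes> t b) \<noteq> 0"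
      using p(1) by (auto dest: dvd_imp_le intro: Nat.gr0I)
    then have "ord (t a \<otimes> t b) \<in> {1, 2, 3}" using p(1) by auto
    then show ?thesis using * p(1) by auto
  qed
  have q: "ord (t a \<otimes> t b) = 4" if "key (concat (replicate 4 [a, b])) = key []"
      "key (concat (replicate 2 [a, b])) \<noteq> key []" for a b
  proof -
    have "ord (t a \<otimes> t b) dvd 4" "\<not> ord (t a \<otimes> t b) dvd 2" using that d by simp_all
    moreover have "ord (t a \<otimes> t b) \<in> {1, 2, 3, 4}"
    proof -
      have "ord (t a \<otimes> t b) \<le> 4" "ord (t a \<otimes> t b) \<noteq> 0"
        using \<open>ord (t a \<otimes> t b) dvd 4\<close> by (auto dest: dvd_imp_le intro: Nat.gr0I)
      then show ?thesis by auto
    qed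
    ultimately show ?thesis by auto
  qed
  have "i = 1 \<or> i = 2 \<or> i = 3 \<or> i = 4" "j = 1 \<or> j = 2 \<or> j = 3 \<or> j = 4" using assms by auto
  then show ?thesis
    apply (elim disjE)
    apply (simp_all only: m vertex_simps)
    apply (rule o, code_simp)
    apply (rule p[of 3], simp, code_simp, code_simp)
    apply (rule p[of 2], simp, code_simp, code_simp)
    apply (rule q, code_simp, code_simp)
    apply (rule p[of 3], simp, code_simp, code_simp)
    apply (rule p[of 2], simp, code_simp, code_simp)
    apply (rule q, code_simp, code_simp)
    apply (rule o, code_simp)
    apply (rule q, code_simp, code_simp)
    apply (rule p[of 2], simp, code_simp, code_simp)
    apply (rule q, code_simp, code_simp)
    apply (rule p[of 2], simp, code_simp, code_simp)
    apply (rule o, code_simp)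
    apply (rule p[of 3], simp, code_simp, code_simp)
    apply (rule p[of 3], simp, code_simp, code_simp)
    apply (rule o, code_simp)
    done
qed

theorem carter_diagram: "carter_realization W R w {1..4} F4a1 (\<lambda>i. t (vertex i))"
  unfolding carter_realization_def
proof
  have comm: "t e4 \<otimes> t p23 = t p23 \<otimes> t e4" "t h0 \<otimes> t m24 = t m24 \<otimes> t h0"
  proof -
    have "key [e4, p23] = key [p23, e4]" "key [h0, m24] = key [m24, h0]" by code_simp+
    then show "t e4 \<otimes> t p23 = t p23 \<otimes> t e4" "t h0 \<otimes> t m24 = t m24 \<otimes> t h0"
      using word_eq_iff[of "[e4, p23]" "[p23, e4]"] word_eq_iff[of "[h0, m24]" "[m24, h0]"]
      unfolding act_eq_iff by simp_all
  qed
  show "\<exists>xs ys. distinct (xs @ ys) \<and> set (xs @ ys) = {1..4} \<and>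
       reduced_decomposition W R w (map (\<lambda>i. t (vertex i)) (xs @ ys)) \<and>
       (\<forall>i\<in>set xs. \<forall>j\<in>set xs. t (vertex i) \<otimes> t (vertex j) = t (vertex j) \<otimes> t (vertex i)) \<and>
       (\<forall>i\<in>set ys. \<forall>j\<in>set ys. t (vertex i) \<otimes> t (vertex j) = t (vertex j) \<otimes> t (vertex i))"
    using comm w_length reflections_eq
    by (intro exI[of _ "[1, 3]"] exI[of _ "[2, 4]"])
      (auto simp: reduced_decomposition_def w_eq w0_def)
  show "\<forall>i\<in>{1..4}. \<forall>j\<in>{1..4}. ord (t (vertex i) \<otimes> t (vertex j)) = F4a1 i j"
    using vertex_orders by blast
qed

end

section \<open>Homomorphisms to the alternating group on four letters\<close>

text \<open>
  The alternating group on four letters as the group of affine maps \<open>z \<mapsto> u z + v\<close> of the field with four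
  elements, where \<open>u\<close> is a power of a primitive element. The first component is the exponent of \<open>u\<close>, and the
  two truth values are the coordinates of \<open>v\<close>.

  Commuting maps with nonzero exponents have the same fixed point. In type \<open>F4\<close> the generators \<open>1\<close>, \<open>3\<close>
  commute, as do \<open>1\<close>, \<open>4\<close> and \<open>2\<close>, \<open>4\<close>; if all exponents are nonzero, the four maps therefore have the
  same fixed point and the image is abelian. In the diagram only \<open>1\<close>, \<open>3\<close> and \<open>2\<close>, \<open>4\<close> commute, and two different
  fixed points become possible if the exponents of the generators \<open>1\<close>, \<open>2\<close> and \<open>3\<close>, \<open>4\<close> are opposite. These
  additional homomorphisms are what distinguishes the two groups.
\<close>

type_synonym alt = "trit \<times> bool \<times> bool"

fun rot :: "trit \<Rightarrow> bool \<times> bool \<Rightarrow> bool \<times> bool" where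
  "rot Nul (x, y) = (x, y)"
| "rot Pos (x, y) = (y, x \<noteq> y)"
| "rot Neg (x, y) = (x \<noteq> y, x)"

fun xor :: "bool \<times> bool \<Rightarrow> bool \<times> bool \<Rightarrow> bool \<times> bool" where
  "xor (x, y) (u, v) = (x \<noteq> u, y \<noteq> v)"

fun amul :: "alt \<Rightarrow> alt \<Rightarrow> alt" where
  "amul (i, v) (j, w) = (i + j, xor v (rot i w))"

fun ainv :: "alt \<Rightarrow> alt" where
  "ainv (i, v) = (- i, rot (- i) v)"

definition alt_group :: "alt monoid" where
  "alt_group = \<lparr>carrier = UNIV, mult = amul, one = (Nul, False, False)\<rparr>"

lemma alt_group_simps [simp]:
  "carrier alt_group = UNIV" "x \<otimes>\<^bsub>alt_group\<^esub> y = amul x y" "\<one>\<^bsub>alt_group\<^esub> = (Nul, False, False)"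
  by (simp_all add: alt_group_def)

lemma amul_ainv: "amul (ainv x) x = (Nul, False, False)"
  by (cases x; cases "fst x") auto

lemma amul_assoc: "amul (amul x y) z = amul x (amul y z)"
proof -
  have rot_xor: "rot i (xor v w) = xor (rot i v) (rot i w)" for i v w
    by (cases i; cases v; cases w) auto
  have rot_add: "rot (i + j) v = rot i (rot j v)" for i j v
    by (cases i; cases j; cases v) auto
  have "xor (xor u v) w = xor u (xor v w)" for u v w
    by (cases u; cases v; cases w) auto
  then show ?thesis
    by (cases x; cases y; cases z) (simp add: rot_xor rot_add add.assoc)
qed

lemma group_alt_group: "group alt_group"
proof (rule groupI)
  show "\<one>\<^bsub>alt_group\<^esub> \<otimes>\<^bsub>alt_group\<^esub> x = x" for x
    by (cases x; cases "snd x") auto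
  show "\<exists>y\<in>carrier alt_group. y \<otimes>\<^bsub>alt_group\<^esub> x = \<one>\<^bsub>alt_group\<^esub>" for x
    using amul_ainv[of x] by (intro bexI[of _ "ainv x"]) simp_all
qed (simp_all add: amul_assoc)

lemma inv_alt_group [simp]: "inv\<^bsub>alt_group\<^esub> x = ainv x"
  by (rule group.inv_equality[OF group_alt_group]) (simp_all add: amul_ainv)

definition tuple :: "'b \<times> 'b \<times> 'b \<times> 'b \<Rightarrow> nat \<Rightarrow> 'b" where
  "tuple p i = (case p of (a, b, c, d) \<Rightarrow> if i = 1 then a else if i = 2 then b else if i = 3 then c else d)"

definition solutions :: "('b, 'c) monoid_scheme \<Rightarrow> (nat word \<times> nat word) set \<Rightarrow> ('b \<times> 'b \<times> 'b \<times> 'b) set" where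
  "solutions H E = {p. range (tuple p) \<subseteq> carrier H \<and> satisfies H (tuple p) E}"

lemma tuple_self: "tuple (f 1, f 2, f 3, f 4) i = f i" if "i \<in> {1..4}" for f :: "nat \<Rightarrow> 'b"
proof -
  have "i = 1 \<or> i = 2 \<or> i = 3 \<or> i = 4" using that by auto
  then show ?thesis by (elim disjE) (simp_all add: tuple_def)
qed

lemma tuple_eqI: "(\<And>i. i \<in> {1..4} \<Longrightarrow> tuple p i = tuple q i) \<Longrightarrow> p = q"
proof -
  assume eq: "\<And>i. i \<in> {1..4} \<Longrightarrow> tuple p i = tuple q i"
  have "tuple p 1 = tuple q 1" "tuple p 2 = tuple q 2" "tuple p 3 = tuple q 3" "tuple p 4 = tuple q 4"
    by (rule eq, simp)+
  then show "p = q" by (cases p; cases q) (simp add: tuple_def)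
qed

text \<open>
  A solution of the relations is a homomorphism to \<open>H\<close>; composing it with an isomorphism gives a solution of
  the other relations, and different homomorphisms remain different.
\<close>

lemma iso_card_solutions:
  fixes E E' :: "(nat word \<times> nat word) set"
  assumes H: "group H" and fin: "finite (solutions H E')"
    and iso: "\<psi> \<in> iso (presented_group {1..4} E') (presented_group {1..4} E)"
    and E': "\<And>l r. (l, r) \<in> E' \<Longrightarrow> l \<in> words {1..4} \<and> r \<in> words {1..4}"
  shows "card (solutions H E) \<le> card (solutions H E')"
proof -
  define P where "P = presented_group {1..4} E"
  define P' where "P' = presented_group {1..4} E'"
  define x where "x = presented_gen {1..4} E"
  define x' where "x' = presented_gen {1..4} E'"
  interpret H: group H by fact
  interpret P: group P unfolding P_def by (rule group_presented_group)
  interpret P': group P' unfolding P'_def by (rule group_presented_group)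
  have x': "x' \<in> {1..4} \<rightarrow> carrier P'" and x: "x \<in> {1..4} \<rightarrow> carrier P"
    unfolding x'_def P'_def x_def P_def by (rule presented_gen_closed)+
  have \<psi>: "\<psi> \<in> hom P' P" "\<psi> ` carrier P' = carrier P"
    using iso by (auto simp: iso_def bij_betw_def P_def P'_def)
  have "\<exists>h. h \<in> hom P H \<and> (\<forall>i\<in>{1..4}. h (x i) = tuple p i)" if "p \<in> solutions H E" for p
  proof -
    have "tuple p \<in> {1..4} \<rightarrow> carrier H" "satisfies H (tuple p) E"
      using that by (auto simp: solutions_def)
    then obtain h where "h \<in> hom (presented_group {1..4} E) H"
      "\<And>u. u \<in> words {1..4} \<Longrightarrow> h (word_cong {1..4} E `` {u}) = word_eval H (tuple p) u"
      "\<And>i. i \<in> {1..4} \<Longrightarrow> h (presented_gen {1..4} E i) = tuple p i"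
      using H.presented_hom_exists[of "tuple p" "{1..4}" E] by blast
    then show ?thesis unfolding P_def x_def by blast
  qed
  then obtain h where h: "\<And>p. p \<in> solutions H E \<Longrightarrow> h p \<in> hom P H"
    "\<And>p i. p \<in> solutions H E \<Longrightarrow> i \<in> {1..4} \<Longrightarrow> h p (x i) = tuple p i"
    by metis
  define k where "k p i = h p (\<psi> (x' i))" for p i
  have comp: "(\<lambda>g. h p (\<psi> g)) \<in> hom P' H" if "p \<in> solutions H E" for p
    using h(1)[OF that] \<psi>(1) by (auto simp: hom_def Pi_iff)
  have eval: "h p (\<psi> (word_eval P' x' u)) = word_eval H (k p) u"
    if "p \<in> solutions H E" "u \<in> words {1..4}" for p u
    unfolding k_def using P'.hom_word_eval[OF H comp[OF that(1)] x' that(2)] .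
  have kc: "k p i \<in> carrier H" if "p \<in> solutions H E" "i \<in> {1..4}" for p i
    using comp[OF that(1)] x' that(2) unfolding k_def hom_def Pi_iff by blast
  define F where "F p = (k p 1, k p 2, k p 3, k p 4)" for p
  have tF: "tuple (F p) i = k p i" if "i \<in> {1..4}" for p i
    unfolding F_def by (rule tuple_self[OF that])
  have evalF: "word_eval H (tuple (F p)) u = word_eval H (k p) u" if "u \<in> words {1..4}" for p u
    by (rule word_eval_restrict[OF tF that])
  have "F p \<in> solutions H E'" if p: "p \<in> solutions H E" for p
  proof -
    have "range (tuple (F p)) \<subseteq> carrier H"
      using kc[OF p, of 1] kc[OF p, of 2] kc[OF p, of 3] kc[OF p, of 4] by (auto simp: F_def tuple_def)
    moreover have "satisfies H (tuple (F p)) E'"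
      unfolding satisfies_def
    proof clarify
      fix l r assume lr: "(l, r) \<in> E'"
      have "satisfies P' x' E'" unfolding P'_def x'_def by (rule presented_gen_satisfies[OF E'])
      then have "word_eval P' x' l = word_eval P' x' r" using lr unfolding satisfies_def by blast
      then show "word_eval H (tuple (F p)) l = word_eval H (tuple (F p)) r"
        using eval[OF p] evalF E'[OF lr] by metis
    qed
    ultimately show ?thesis by (simp add: solutions_def)
  qed
  moreover have "inj_on F (solutions H E)"
  proof (rule inj_onI, rule tuple_eqI)
    fix p q i assume p: "p \<in> solutions H E" and q: "q \<in> solutions H E" and eq: "F p = F q"
      and i: "i \<in> {1..4 :: nat}"
    have "x i \<in> \<psi> ` carrier P'" using \<psi>(2) x i by blast
    then obtain u where u: "u \<in> words {1..4}" "x i = \<psi> (word_eval P' x' u)"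
      unfolding P'_def x'_def by (auto elim: presented_induct)
    have "h p (x i) = h q (x i)"
      using eval[OF p u(1)] eval[OF q u(1)] evalF[OF u(1), of p] evalF[OF u(1), of q] eq u(2) by simp
    then show "tuple p i = tuple q i" using h(2) p q i by simp
  qed
  ultimately show ?thesis using card_inj_on_le[OF _ _ fin] by blast
qed

fun commute :: "alt \<Rightarrow> alt \<Rightarrow> bool" where
  "commute x y \<longleftrightarrow> amul x y = amul y x"

fun braid3 :: "alt \<Rightarrow> alt \<Rightarrow> bool" where
  "braid3 x y \<longleftrightarrow> amul x (amul y x) = amul y (amul x y)"

fun braid4 :: "alt \<Rightarrow> alt \<Rightarrow> bool" where
  "braid4 x y \<longleftrightarrow> amul x (amul y (amul x y)) = amul y (amul x (amul y x))"

definition alts :: "alt list" where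
  "alts = [(Nul, False, False), (Nul, False, True), (Nul, True, False), (Nul, True, True),
     (Pos, False, False), (Pos, False, True), (Pos, True, False), (Pos, True, True),
     (Neg, False, False), (Neg, False, True), (Neg, True, False), (Neg, True, True)]"

text \<open>
  Both presentations make the generators \<open>1\<close>, \<open>3\<close> and \<open>2\<close>, \<open>4\<close> commute. The search therefore runs over two commuting
  pairs and tests the remaining relations: those of the Artin group for \<open>True\<close>, those of the diagram for
  \<open>False\<close>.
\<close>

fun commuting_with :: "alt \<Rightarrow> alt list \<Rightarrow> (alt \<times> alt) list" where
  "commuting_with x [] = []"
| "commuting_with x (y # ys) = (if commute x y then (x, y) # commuting_with x ys else commuting_with x ys)"

fun commuting_pairs :: "alt list \<Rightarrow> (alt \<times> alt) list" where
  "commuting_pairs [] = []"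
| "commuting_pairs (x # xs) = commuting_with x alts @ commuting_pairs xs"

fun relations_hold :: "bool \<Rightarrow> alt \<Rightarrow> alt \<Rightarrow> alt \<Rightarrow> alt \<Rightarrow> bool" where
  "relations_hold True a b c d \<longleftrightarrow>
    (if braid3 a b then if braid3 c d then if commute a d then braid4 b c else False else False else False)"
| "relations_hold False a b c d \<longleftrightarrow>
    (if braid3 a b then if braid3 c d then if braid4 a d then if braid4 b c then
      commute (amul (ainv b) (amul a b)) (amul (ainv c) (amul d c)) \<and>
      commute (amul b (amul a (ainv b))) (amul c (amul d (ainv c)))
      else False else False else False else False)"

fun solution_row :: "bool \<Rightarrow> alt \<times> alt \<Rightarrow> (alt \<times> alt) list \<Rightarrow> (alt \<times> alt \<times> alt \<times> alt) list" where
  "solution_row k (a, c) [] = []"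
| "solution_row k (a, c) ((b, d) # ps) =
    (if relations_hold k a b c d then (a, b, c, d) # solution_row k (a, c) ps else solution_row k (a, c) ps)"

fun solution_table :: "bool \<Rightarrow> (alt \<times> alt) list \<Rightarrow> (alt \<times> alt \<times> alt \<times> alt) list" where
  "solution_table k [] = []"
| "solution_table k (p # ps) = solution_row k p (commuting_pairs alts) @ solution_table k ps"

lemma artin_table: "length (solution_table True (commuting_pairs alts)) = 96"
  by code_simp

lemma diagram_table: "distinct (solution_table False (commuting_pairs alts)) \<and>
    length (solution_table False (commuting_pairs alts)) = 120"
  by code_simp

lemma in_alts: "x \<in> set alts"
  by (cases x; cases "fst x"; cases "fst (snd x)"; cases "snd (snd x)") (auto simp: alts_def)

lemma commuting_with_iff: "(a, c) \<in> set (commuting_with x ys) \<longleftrightarrow> a = x \<and> c \<in> set ys \<and> commute a c"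
  by (induction ys) auto

lemma commuting_pairs_iff: "(a, c) \<in> set (commuting_pairs xs) \<longleftrightarrow> a \<in> set xs \<and> commute a c"
  by (induction xs) (auto simp: commuting_with_iff in_alts simp del: commute.simps)

lemma solution_row_iff: "(a, b, c, d) \<in> set (solution_row k p ps) \<longleftrightarrow>
    p = (a, c) \<and> (b, d) \<in> set ps \<and> relations_hold k a b c d"
  by (induction k p ps rule: solution_row.induct) (auto simp del: relations_hold.simps)

lemma solution_table_iff: "(a, b, c, d) \<in> set (solution_table k ps) \<longleftrightarrow>
    (a, c) \<in> set ps \<and> commute b d \<and> relations_hold k a b c d"
  by (induction ps) (auto simp: solution_row_iff commuting_pairs_iff in_alts
      simp del: relations_hold.simps commute.simps)

lemma alternating_words:
  "alternating_word 2 i j = [(i, True), (j, True)]"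
  "alternating_word 3 i j = [(i, True), (j, True), (i, True)]"
  "alternating_word 4 i j = [(i, True), (j, True), (i, True), (j, True)]"
  by (simp_all add: numeral_eq_Suc)

lemma artin_solutions: "solutions alt_group (braid_relations {1..4} F4) \<subseteq>
    set (solution_table True (commuting_pairs alts))"
proof clarify
  fix a b c d assume "(a, b, c, d) \<in> solutions alt_group (braid_relations {1..4} F4)"
  then have "satisfies alt_group (tuple (a, b, c, d)) (braid_relations {1..4} F4)"
    by (simp add: solutions_def)
  then have rel: "word_eval alt_group (tuple (a, b, c, d)) (alternating_word (F4 i j) i j) =
      word_eval alt_group (tuple (a, b, c, d)) (alternating_word (F4 i j) j i)"
    if "i \<in> {1..4}" "j \<in> {1..4}" "i \<noteq> j" for i j
    using that unfolding satisfies_def braid_relations_def by blast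
  have m: "F4 1 2 = 3" "F4 1 3 = 2" "F4 1 4 = 2" "F4 2 3 = 4" "F4 2 4 = 2" "F4 3 4 = 3"
    by (simp_all add: F4_def doubleton_eq_iff)
  have t: "tuple (a, b, c, d) 1 = a" "tuple (a, b, c, d) 2 = b" "tuple (a, b, c, d) 3 = c"
    "tuple (a, b, c, d) 4 = d"
    by (simp_all add: tuple_def)
  have one: "amul x (Nul, False, False) = x" for x
    using group.is_monoid[OF group_alt_group, THEN monoid.r_one, of x] by simp
  have "commute a c" "commute b d" "commute a d" "braid3 a b" "braid3 c d" "braid4 b c"
    using rel[of 1 3] rel[of 2 4] rel[of 1 4] rel[of 1 2] rel[of 3 4] rel[of 2 3]
    unfolding m alternating_words word_eval_simps t alt_group_simps one by simp_all
  then show "(a, b, c, d) \<in> set (solution_table True (commuting_pairs alts))"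
    unfolding solution_table_iff commuting_pairs_iff relations_hold.simps using in_alts by simp
qed

lemma diagram_solutions:
  "set (solution_table False (commuting_pairs alts)) \<subseteq> solutions alt_group F4a1_relations"
proof clarify
  fix a b c d assume "(a, b, c, d) \<in> set (solution_table False (commuting_pairs alts))"
  then have h: "commute a c" "commute b d" "braid3 a b" "braid3 c d" "braid4 a d" "braid4 b c"
    "commute (amul (ainv b) (amul a b)) (amul (ainv c) (amul d c))"
    "commute (amul b (amul a (ainv b))) (amul c (amul d (ainv c)))"
    unfolding solution_table_iff commuting_pairs_iff relations_hold.simps by (simp_all split: if_splits)
  interpret A: group alt_group by (rule group_alt_group)
  have t: "tuple (a, b, c, d) 1 = a" "tuple (a, b, c, d) 2 = b" "tuple (a, b, c, d) 3 = c"
    "tuple (a, b, c, d) 4 = d"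
    by (simp_all add: tuple_def)
  have one: "amul x (Nul, False, False) = x" for x using A.r_one[of x] by simp
  have inv: "ainv (amul x y) = amul (ainv y) (ainv x)" "ainv (ainv x) = x" for x y
    using A.inv_mult_group[of x y] A.inv_inv[of x] by simp_all
  have comm: "amul (ainv x) (amul (ainv y) (amul x y)) = (Nul, False, False)" if "commute x y" for x y
    using A.commutator_eq_one_iff[of x y] that by simp
  have "satisfies alt_group (tuple (a, b, c, d)) (braid_relations {1..4} F4a1)"
    using h unfolding A.satisfies_braid_iff word_eval_simps t alt_group_simps one by simp
  moreover have "word_eval alt_group (tuple (a, b, c, d)) (word_commutator (conj_word 1 2) (conj_word 4 3)) =
      (Nul, False, False)"
    using comm[OF h(7)]
    unfolding word_commutator_def word_inv_def conj_word_def
    by (simp add: t[simplified] one inv amul_assoc del: amul.simps ainv.simps commute.simps)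
  moreover have "word_eval alt_group (tuple (a, b, c, d)) (word_commutator (conj_word' 1 2) (conj_word' 4 3)) =
      (Nul, False, False)"
    using comm[OF h(8)]
    unfolding word_commutator_def word_inv_def conj_word'_def
    by (simp add: t[simplified] one inv amul_assoc del: amul.simps ainv.simps commute.simps)
  ultimately show "(a, b, c, d) \<in> solutions alt_group F4a1_relations"
    by (auto simp: solutions_def F4a1_relations_def satisfies_def)
qed

theorem diagram_group_not_artin:
  "\<not> presented_group {1..4} F4a1_relations \<cong> artin_group {1..4} F4"
proof
  assume "presented_group {1..4} F4a1_relations \<cong> artin_group {1..4} F4"
  then have "artin_group {1..4} F4 \<cong> presented_group {1..4} F4a1_relations"
    by (rule group.iso_sym[OF group_presented_group])
  then obtain \<psi> where \<psi>: "\<psi> \<in> iso (presented_group {1..4} (braid_relations {1..4} F4))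
      (presented_group {1..4} F4a1_relations)"
    by (auto simp: is_iso_def artin_group_def)
  have alt: "alternating_word n i j \<in> words {1..4}" if "i \<in> {1..4}" "j \<in> {1..4}" for n and i j :: nat
    using that by (induction n i j rule: alternating_word.induct) auto
  have fin: "finite (solutions alt_group (braid_relations {1..4} F4))"
    using finite_subset[OF artin_solutions] by simp
  have "120 = card (set (solution_table False (commuting_pairs alts)))"
    using diagram_table distinct_card by metis
  also have "\<dots> \<le> card (solutions alt_group F4a1_relations)"
  proof (rule card_mono[OF _ diagram_solutions])
    have "finite (set alts)" by simp
    moreover have "set alts = UNIV" using in_alts by blast
    ultimately have "finite (UNIV :: alt set)" by simp
    then have "finite (UNIV :: (alt \<times> alt \<times> alt \<times> alt) set)" by (simp add: finite_prod)
    then show "finite (solutions alt_group F4a1_relations)" by (rule finite_subset[OF subset_UNIV])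
  qed
  also have "\<dots> \<le> card (solutions alt_group (braid_relations {1..4} F4))"
    by (rule iso_card_solutions[OF group_alt_group fin \<psi>])
      (use alt in \<open>unfold braid_relations_def, blast\<close>)
  also have "\<dots> \<le> card (set (solution_table True (commuting_pairs alts)))"
    by (rule card_mono[OF _ artin_solutions]) simp
  also have "\<dots> \<le> 96" using card_length[of "solution_table True (commuting_pairs alts)"] artin_table by simp
  finally show False by simp
qed

theorem theorem2p25:
  fixes W :: "('a, 'b) monoid_scheme" and R :: "'a set" and w :: 'a
  assumes "finite_coxeter_system W R"
    and "coxeter_type W R {1..4} F4"
    and "proper_quasi_coxeter W R w"
  shows "(\<exists>s. carter_realization W R w {1..4} F4a1 s \<and>
            is_presentation (interval_group W R w) {1..4} F4a1_relations
              (\<lambda>i. interval_gen W R w (s i))) \<and>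
         \<not> (interval_group W R w \<cong> artin_group {1..4} F4)"
proof -
  obtain t where "F4_group W R t" and w: "w = list_prod W (map t w0)" "refl_length W R w = 4"
    using proper_quasi_coxeter_realization[OF assms] .
  then interpret F4_interval W R t w
    by (simp add: F4_interval_def F4_interval_axioms_def)
  have pres: "is_presentation (interval_group W R w) {1..4} F4a1_relations
      (\<lambda>i. interval_gen W R w (t (vertex i)))"
    using interval_group_presentation by (simp only: refl_gen_def)
  have "\<not> (interval_group W R w \<cong> artin_group {1..4} F4)"
  proof
    assume iso: "interval_group W R w \<cong> artin_group {1..4} F4"
    have "presented_group {1..4} F4a1_relations \<cong> interval_group W R w"
      using pres by (auto simp: is_presentation_def is_iso_def)
    then show False using iso_trans[OF _ iso] diagram_group_not_artin by blast
  qed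
  then show ?thesis using carter_diagram pres by blast
qed

end
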